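(* For every periodic sequence $\mathbf{s} = (s_n)_{n \geq 1}$ with values in $\{-1, +1\}$ there exists an effectively computable rational number $B_\mathbf{s} > 0$ such that \[ \log \operatorname{lcm} (L_1 + s_1, L_2 + s_2, \dots, L_n + s_n) \sim B_\mathbf{s} \cdot \frac{\log \alpha}{\pi^2} \cdot n^2 \qquad (n \to +\infty), \] where zero terms in the least common multiple are ignored.
   Context: $(L_n)_{n \geq 1}$ is the sequence of Lucas numbers: $L_1 = 1$, $L_2 = 3$, $L_{n+2} = L_{n+1} + L_n$ for all $n \geq 1$. $\alpha = (1+\sqrt5)/2$ is the golden ratio. "Effectively computable" means there is an algorithm which, given the period of $\mathbf{s}$ as input, outputs the numerator and denominator of $B_\mathbf{s}$. $f(n) \sim g(n)$ means $f(n)/g(n) \to 1$. *)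

theory Defs
  imports Complex_Main "HOL-Library.Landau_Symbols" "HOL-Library.Nat_Bijection"
begin

fun lucas :: "nat \<Rightarrow> int" where
  "lucas 0 = 2"
| "lucas (Suc 0) = 1"
| "lucas (Suc (Suc n)) = lucas (Suc n) + lucas n"

definition golden_ratio :: real where
  "golden_ratio = (1 + sqrt 5) / 2"

text \<open>Sequences indexed by \<open>n \<ge> 1\<close> are functions on \<^typ>\<open>nat\<close> whose value at \<open>0\<close> is irrelevant.\<close>

definition sign_sequence :: "(nat \<Rightarrow> int) \<Rightarrow> bool" where
  "sign_sequence s \<longleftrightarrow> (\<forall>n\<ge>1. s n \<in> {-1, 1})"

definition has_period :: "(nat \<Rightarrow> int) \<Rightarrow> nat \<Rightarrow> bool" where
  "has_period s T \<longleftrightarrow> T \<ge> 1 \<and> (\<forall>n\<ge>1. s (n + T) = s n)"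

definition periodic :: "(nat \<Rightarrow> int) \<Rightarrow> bool" where
  "periodic s \<longleftrightarrow> (\<exists>T. has_period s T)"

definition shifted_lucas_lcm :: "(nat \<Rightarrow> int) \<Rightarrow> nat \<Rightarrow> int" where
  "shifted_lucas_lcm s n = Lcm ((\<lambda>k. lucas k + s k) ` {1..n} - {0})"

text \<open>
  Total recursive functions of \<open>n\<close> arguments (Kleene): the least class containing the basic
  functions and closed under composition, primitive recursion, and minimisation of regular
  functions. The arguments are passed as a list; in \<open>total_recursive n f\<close>, only the values of
  \<open>f\<close> on lists of length \<open>n\<close> are meaningful.
\<close>

inductive total_recursive :: "nat \<Rightarrow> (nat list \<Rightarrow> nat) \<Rightarrow> bool" where
  zero: "total_recursive n (\<lambda>xs. 0)"
| succ: "total_recursive 1 (\<lambda>xs. Suc (xs ! 0))"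
| proj: "i < n \<Longrightarrow> total_recursive n (\<lambda>xs. xs ! i)"
| comp: "total_recursive (length gs) f \<Longrightarrow> \<forall>g\<in>set gs. total_recursive n g \<Longrightarrow>
           total_recursive n (\<lambda>xs. f (map (\<lambda>g. g xs) gs))"
| prec: "total_recursive n f \<Longrightarrow> total_recursive (Suc (Suc n)) g \<Longrightarrow>
           total_recursive (Suc n)
             (\<lambda>xs. rec_nat (f (tl xs)) (\<lambda>y r. g (y # r # tl xs)) (hd xs))"
| mini: "total_recursive (Suc n) f \<Longrightarrow> \<forall>xs. length xs = n \<longrightarrow> (\<exists>y. f (y # xs) = 0) \<Longrightarrow>
           total_recursive n (\<lambda>xs. LEAST y. f (y # xs) = 0)"

definition computable :: "(nat \<Rightarrow> nat) \<Rightarrow> bool" where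
  "computable h \<longleftrightarrow> (\<exists>f. total_recursive 1 f \<and> (\<forall>x. h x = f [x]))"

text \<open>The period \<open>(s\<^sub>1, \<dots>, s\<^sub>T)\<close>, coded as a natural number.\<close>

definition period_code :: "(nat \<Rightarrow> int) \<Rightarrow> nat \<Rightarrow> nat" where
  "period_code s T = list_encode (map (\<lambda>k. int_encode (s k)) [1..<Suc T])"

text \<open>
  One algorithm serves all sequences: from any period of \<open>s\<close>, not necessarily the least one, it
  outputs numerator and denominator of \<open>B s\<close> in lowest terms, the numerator coded by
  \<^const>\<open>int_encode\<close>.
\<close>

definition effectively_computable :: "((nat \<Rightarrow> int) \<Rightarrow> rat) \<Rightarrow> bool" where
  "effectively_computable B \<longleftrightarrow>
     (\<exists>num den. computable num \<and> computable den \<and>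
        (\<forall>s T. sign_sequence s \<and> has_period s T \<longrightarrow>
           quotient_of (B s) = (int_decode (num (period_code s T)), int (den (period_code s T)))))"

end

theory Submission
  imports Defs
    "HOL-Analysis.Analysis"
    "HOL-Number_Theory.Number_Theory"
    "HOL-Computational_Algebra.Squarefree"
    "HOL-Real_Asymp.Real_Asymp"
begin

text \<open>
  For even \<open>k = 2m\<close> the numbers \<open>L\<^sub>k \<plusminus> 1\<close> are \<open>F\<^bsub>3m\<^esub> / F\<^sub>m\<close> and
  \<open>L\<^bsub>3m\<^esub> / L\<^sub>m\<close>; for odd \<open>k = 2m + 1\<close> they are \<open>L\<^sub>m L\<^bsub>m+1\<^esub>\<close> and
  \<open>5 F\<^sub>m F\<^bsub>m+1\<^esub>\<close>. Hence a prime \<open>p > 5\<close> divides \<open>L\<^sub>k + s\<^sub>k\<close> iff its rank of apparition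
  \<open>d\<close> (the least \<open>d > 0\<close> with \<open>p | F\<^sub>d\<close>) satisfies \<open>3k = du\<close> or \<open>3k = du \<plusminus> 3\<close> for some \<open>u > 0\<close>
  subject to congruence conditions on \<open>u\<close>, \<open>k\<close> and the sign \<open>s\<^sub>k\<close>. By lifting the exponent, the
  primes of rank \<open>d\<close> contribute the primitive part of \<open>F\<^sub>d\<close> to the least common multiple, up to a
  negligible factor, and Moebius inversion of \<open>F\<^sub>n\<close> as a product of primitive parts over the divisors of \<open>n\<close>
  shows that the logarithm of this part is \<open>\<phi>(d) log \<alpha>\<close> up to an error that is small on average.

  If \<open>s\<close> has period \<open>T\<close>, the least admissible multiplier \<open>u\<close> depends only on \<open>d\<close> modulo \<open>12T\<close>, so
  the ranks occurring up to \<open>n\<close> in a given residue class are those with \<open>d \<le> 3n/u\<close>, up to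
  boundary effects. The sum of \<open>\<phi>(d)\<close> over \<open>d \<le> x\<close> in a residue class is asymptotic to an
  explicit rational multiple of \<open>x\<^sup>2 / \<pi>\<^sup>2\<close>, which yields a formula for the constant by finitely many
  arithmetic operations on the period.
\<close>

text \<open>Two devices keep the constant explicit. First, the four factorizations are folded into
  one equation, \<open>3 * k = d * u\<close> up to 3: the factor 3 accommodates F_{3m} and L_{3m},
  divisibility of \<open>u\<close> by 3 separates even from odd \<open>k\<close>, and the parity of
  \<open>u\<close> separates Fibonacci factors (\<open>u\<close> even) from Lucas factors
  (\<open>u\<close> odd), hence the two signs. These conditions involve \<open>k\<close> modulo 4
  and modulo \<open>T\<close>, and \<open>u\<close> modulo 6. Raising \<open>d\<close> by
  \<open>12 * T\<close> raises \<open>k\<close> by \<open>4 * T * u\<close> and preserves all of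
  them; this is the origin of 12. Second, the density of the totient in a residue class modulo
  \<open>M\<close> contains an infinite series over the integers coprime to \<open>M\<close>. It is
  never evaluated: it is the same for every class, so the total 3/pi^2 over all classes determines
  it, and only ratios of integer weights remain. Errors merely have to be o(n^2): the Moebius step
  costs O(n log^2 n), the excess multiplicities and the primes 2, 3, 5 cost O(n log n). The formula
  refers to a chosen period, but every period yields the same limit, so its value does not depend on
  the choice.\<close>

section \<open>Closure properties of the total recursive functions\<close>
definition nth_arg :: "nat \<Rightarrow> nat list \<Rightarrow> nat" where
  "nth_arg i xs = (if i < length xs then xs ! i else 0)"

text \<open>
  \<^const>\<open>total_recursive\<close> fixes the values of a function on lists of the wrong length as well; here they
  are irrelevant. Reading \<open>0\<close> beyond the end of a list makes the shift \<open>nth_arg_tl\<close> under a binder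
  unconditional.
\<close>

definition recf :: "nat \<Rightarrow> (nat list \<Rightarrow> nat) \<Rightarrow> bool" where
  "recf n F \<longleftrightarrow> (\<exists>g. total_recursive n g \<and> (\<forall>xs. length xs = n \<longrightarrow> F xs = g xs))"

lemma nth_arg_Cons_0 [simp]: "nth_arg 0 (x # xs) = x"
  and nth_arg_Cons_Suc [simp]: "nth_arg (Suc i) (x # xs) = nth_arg i xs"
  by (simp_all add: nth_arg_def)

lemma nth_arg_tl [simp]: "nth_arg i (tl xs) = nth_arg (Suc i) xs"
  by (cases xs) (simp_all add: nth_arg_def)

lemma recf_cong:
  assumes "recf n F" "\<And>xs. length xs = n \<Longrightarrow> F xs = G xs"
  shows "recf n G"
  using assms unfolding recf_def by metis

lemma recf_comp:
  assumes "recf (length gs) F" "\<forall>g\<in>set gs. recf n g"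
  shows "recf n (\<lambda>xs. F (map (\<lambda>g. g xs) gs))"
proof -
  obtain f where f: "total_recursive (length gs) f" "\<And>xs. length xs = length gs \<Longrightarrow> F xs = f xs"
    using assms(1) unfolding recf_def by blast
  obtain h where h: "\<And>g. g \<in> set gs \<Longrightarrow> total_recursive n (h g) \<and> (\<forall>xs. length xs = n \<longrightarrow> g xs = h g xs)"
    using assms(2) unfolding recf_def by metis
  have "total_recursive n (\<lambda>xs. f (map (\<lambda>g. g xs) (map h gs)))"
    by (rule total_recursive.comp) (use f h in auto)
  moreover have "F (map (\<lambda>g. g xs) gs) = f (map (\<lambda>g. g xs) (map h gs))" if "length xs = n" for xs
  proof -
    have "map (\<lambda>g. g xs) gs = map (\<lambda>g. g xs) (map h gs)"
      using h that by simp
    thus ?thesis by (simp only: f(2) length_map)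
  qed
  ultimately show ?thesis unfolding recf_def by blast
qed

lemma recf_comp1:
  assumes "recf (Suc 0) (\<lambda>xs. h (nth_arg 0 xs))" "recf n f"
  shows "recf n (\<lambda>xs. h (f xs))"
  using recf_comp[of "[f]" "\<lambda>xs. h (nth_arg 0 xs)" n] assms by simp

lemma recf_comp2:
  assumes "recf (Suc (Suc 0)) (\<lambda>xs. h (nth_arg 0 xs) (nth_arg (Suc 0) xs))" "recf n f" "recf n g"
  shows "recf n (\<lambda>xs. h (f xs) (g xs))"
  using recf_comp[of "[f, g]" "\<lambda>xs. h (nth_arg 0 xs) (nth_arg (Suc 0) xs)" n] assms by simp

lemma recf_comp3:
  assumes "recf (Suc (Suc (Suc 0))) (\<lambda>xs. h (nth_arg 0 xs) (nth_arg (Suc 0) xs) (nth_arg (Suc (Suc 0)) xs))"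
    "recf n f" "recf n g" "recf n k"
  shows "recf n (\<lambda>xs. h (f xs) (g xs) (k xs))"
  using recf_comp[of "[f, g, k]" "\<lambda>xs. h (nth_arg 0 xs) (nth_arg (Suc 0) xs) (nth_arg (Suc (Suc 0)) xs)" n] assms by simp

lemma recf_zero: "recf n (\<lambda>xs. 0)"
  unfolding recf_def using total_recursive.zero by blast

lemma recf_arg: "recf n (nth_arg i)"
proof (cases "i < n")
  case True
  thus ?thesis unfolding recf_def nth_arg_def using total_recursive.proj by metis
next
  case False
  show ?thesis by (rule recf_cong[OF recf_zero]) (use False in \<open>simp add: nth_arg_def\<close>)
qed

lemma recf_args:
  "recf n (\<lambda>xs. nth_arg i xs)" "recf n (\<lambda>xs. nth_arg i (tl xs))" "recf n (\<lambda>xs. nth_arg i (tl (tl xs)))"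
  "recf n (\<lambda>xs. nth_arg i (tl (tl (tl xs))))" "recf n (\<lambda>xs. nth_arg i (tl (tl (tl (tl xs)))))"
  using recf_arg[of n] by simp_all

lemma recf_Suc: "recf n f \<Longrightarrow> recf n (\<lambda>xs. Suc (f xs))"
proof -
  have "recf (Suc 0) (\<lambda>xs. Suc (nth_arg 0 xs))"
    unfolding recf_def using total_recursive.succ by (intro exI[of _ "\<lambda>xs. Suc (xs ! 0)"]) (auto simp: nth_arg_def)
  thus "recf n f \<Longrightarrow> ?thesis" by (rule recf_comp1)
qed

lemma recf_const: "recf n (\<lambda>xs. c)"
  by (induction c) (auto intro: recf_zero recf_Suc)

text \<open>\<open>prec\<close> recurses on the first argument only. Prepending the bound
  \<open>b\<close> to a copy of the whole argument list turns a recursion up to a computed bound,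
  with access to all arguments, into an instance of it.\<close>

lemma recf_rec:
  assumes "recf n f" "recf (Suc (Suc n)) (\<lambda>ys. g (nth_arg 0 ys) (nth_arg (Suc 0) ys) (tl (tl ys)))" "recf n b"
  shows "recf n (\<lambda>xs. rec_nat (f xs) (\<lambda>y r. g y r xs) (b xs))"
proof -
  obtain f' where f': "total_recursive n f'" "\<And>xs. length xs = n \<Longrightarrow> f xs = f' xs"
    using assms(1) unfolding recf_def by blast
  obtain g' where g': "total_recursive (Suc (Suc n)) g'"
      "\<And>ys. length ys = Suc (Suc n) \<Longrightarrow> g (nth_arg 0 ys) (nth_arg (Suc 0) ys) (tl (tl ys)) = g' ys"
    using assms(2) unfolding recf_def by blast
  have 1: "recf (Suc n) (\<lambda>xs. rec_nat (f' (tl xs)) (\<lambda>y r. g' (y # r # tl xs)) (hd xs))"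
    using total_recursive.prec[OF f'(1) g'(1)] unfolding recf_def by blast
  let ?gs = "b # map nth_arg [0..<n]"
  have "recf n (\<lambda>xs. (\<lambda>xs. rec_nat (f' (tl xs)) (\<lambda>y r. g' (y # r # tl xs)) (hd xs)) (map (\<lambda>g. g xs) ?gs))"
    by (rule recf_comp) (use 1 assms(3) recf_arg in auto)
  moreover have "map (\<lambda>g. g xs) (map nth_arg [0..<n]) = xs" if "length xs = n" for xs
    using that by (intro nth_equalityI) (auto simp: nth_arg_def)
  ultimately show ?thesis
    by (elim recf_cong) (use f' g' in \<open>simp add: g'(2)[symmetric]\<close>)
qed

lemma recf_add: "recf n f \<Longrightarrow> recf n g \<Longrightarrow> recf n (\<lambda>xs. f xs + g xs)"
proof -
  assume "recf n f" "recf n g"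
  hence "recf n (\<lambda>xs. rec_nat (f xs) (\<lambda>y r. Suc r) (g xs))"
    by (intro recf_rec recf_Suc recf_args)
  moreover have "rec_nat x (\<lambda>y r. Suc r) z = x + z" for x z by (induction z) auto
  ultimately show ?thesis by simp
qed

text \<open>Proved for projections and then composed: inside the recursion \<open>f\<close> would
  have to be evaluated on a shifted list, whereas \<open>nth_arg\<close> shifts freely. Later
  closure lemmas follow the same pattern.\<close>

lemma recf_mult: "recf n f \<Longrightarrow> recf n g \<Longrightarrow> recf n (\<lambda>xs. f xs * g xs)"
proof -
  assume *: "recf n f" "recf n g"
  have "recf (Suc (Suc 0)) (\<lambda>xs. rec_nat 0 (\<lambda>y r. r + nth_arg 0 xs) (nth_arg (Suc 0) xs))"
    by (intro recf_rec recf_add recf_args recf_const)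
  moreover have "rec_nat 0 (\<lambda>y r. r + x) z = x * z" for x z :: nat by (induction z) auto
  ultimately have "recf (Suc (Suc 0)) (\<lambda>xs. nth_arg 0 xs * nth_arg (Suc 0) xs)" by (simp only:)
  thus ?thesis using * by (rule recf_comp2)
qed

lemma recf_minus: "recf n f \<Longrightarrow> recf n g \<Longrightarrow> recf n (\<lambda>xs. f xs - g xs)"
proof -
  assume *: "recf n f" "recf n g"
  have "recf (Suc 0) (\<lambda>xs. rec_nat 0 (\<lambda>y r. y) (nth_arg 0 xs))"
    by (intro recf_rec recf_args recf_const)
  moreover have "rec_nat 0 (\<lambda>y r. y) z = z - 1" for z :: nat by (cases z) auto
  ultimately have p: "recf m h \<Longrightarrow> recf m (\<lambda>xs. h xs - 1)" for m h
    by - (rule recf_comp1[of "\<lambda>x. x - 1"], auto)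
  have "recf (Suc (Suc 0)) (\<lambda>xs. rec_nat (nth_arg 0 xs) (\<lambda>y r. r - 1) (nth_arg (Suc 0) xs))"
    by (intro recf_rec p recf_args)
  moreover have "rec_nat x (\<lambda>y r. r - 1) z = x - z" for x z :: nat by (induction z) auto
  ultimately have "recf (Suc (Suc 0)) (\<lambda>xs. nth_arg 0 xs - nth_arg (Suc 0) xs)" by (simp only:)
  thus ?thesis using * by (rule recf_comp2)
qed

lemma recf_sum:
  assumes "recf n b" "recf (Suc n) (\<lambda>ys. F (nth_arg 0 ys) (tl ys))"
  shows "recf n (\<lambda>xs. \<Sum>y<b xs. F y xs)"
proof -
  \<comment> \<open>Selects from \<open>y # r # xs\<close> everything except the accumulator
    \<open>r\<close>.\<close>
  let ?gs = "nth_arg 0 # map (\<lambda>i. nth_arg (Suc (Suc i))) [0..<n]"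
  have *: "recf (Suc (Suc n)) (\<lambda>ys. (\<lambda>ys. F (nth_arg 0 ys) (tl ys)) (map (\<lambda>g. g ys) ?gs))"
    by (rule recf_comp) (use assms(2) recf_arg in auto)
  have "map (\<lambda>g. g ys) (map (\<lambda>i. nth_arg (Suc (Suc i))) [0..<n]) = tl (tl ys)"
    if "length ys = Suc (Suc n)" for ys
    using that by (intro nth_equalityI) (auto simp: nth_arg_def nth_tl)
  hence "recf (Suc (Suc n)) (\<lambda>ys. F (nth_arg 0 ys) (tl (tl ys)))"
    by (intro recf_cong[OF *]) auto
  hence "recf n (\<lambda>xs. rec_nat 0 (\<lambda>y r. r + F y xs) (b xs))"
    by (intro recf_rec recf_add recf_args recf_const assms(1))
  moreover have "rec_nat 0 (\<lambda>y r. r + F y xs) z = (\<Sum>y<z. F y xs)" for z xs by (induction z) auto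
  ultimately show ?thesis by simp
qed

lemma recf_not: "recf n (\<lambda>xs. of_bool (P xs)) \<Longrightarrow> recf n (\<lambda>xs. of_bool (\<not> P xs))"
proof -
  assume *: "recf n (\<lambda>xs. of_bool (P xs))"
  have "of_bool (\<not> P xs) = (1 - of_bool (P xs) :: nat)" for xs by simp
  thus ?thesis using * by (simp only:) (intro recf_minus recf_const)
qed

lemma recf_and: "recf n (\<lambda>xs. of_bool (P xs)) \<Longrightarrow> recf n (\<lambda>xs. of_bool (Q xs)) \<Longrightarrow>
    recf n (\<lambda>xs. of_bool (P xs \<and> Q xs))"
  using recf_mult[of n "\<lambda>xs. of_bool (P xs)" "\<lambda>xs. of_bool (Q xs)"] by (simp add: of_bool_conj)

lemma recf_or: "recf n (\<lambda>xs. of_bool (P xs)) \<Longrightarrow> recf n (\<lambda>xs. of_bool (Q xs)) \<Longrightarrow>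
    recf n (\<lambda>xs. of_bool (P xs \<or> Q xs))"
  using recf_not[OF recf_and[OF recf_not recf_not], of n P Q] by simp

lemma recf_le:
  assumes "recf n f" "recf n g" shows "recf n (\<lambda>xs. of_bool (f xs \<le> g xs))"
proof -
  have "of_bool (f xs \<le> g xs) = 1 - (f xs - g xs)" for xs by (auto simp: of_bool_def)
  thus ?thesis using assms by (simp only:) (intro recf_minus recf_const)
qed

lemma recf_less: "recf n f \<Longrightarrow> recf n g \<Longrightarrow> recf n (\<lambda>xs. of_bool (f xs < g xs))"
  unfolding less_eq_Suc_le by (intro recf_le recf_Suc)

lemma recf_eq: "recf n f \<Longrightarrow> recf n g \<Longrightarrow> recf n (\<lambda>xs. of_bool (f xs = g xs))"
  unfolding order_eq_iff by (intro recf_le recf_and)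

lemma recf_iff: "recf n (\<lambda>xs. of_bool (P xs)) \<Longrightarrow> recf n (\<lambda>xs. of_bool (Q xs)) \<Longrightarrow>
    recf n (\<lambda>xs. of_bool (P xs \<longleftrightarrow> Q xs))"
proof -
  assume *: "recf n (\<lambda>xs. of_bool (P xs))" "recf n (\<lambda>xs. of_bool (Q xs))"
  have "of_bool (P xs \<longleftrightarrow> Q xs) = (of_bool ((of_bool (P xs)::nat) = of_bool (Q xs)) :: nat)" for xs by auto
  thus ?thesis using * by (simp only:) (intro recf_eq)
qed

lemma recf_ex:
  assumes "recf n b" "recf (Suc n) (\<lambda>ys. of_bool (P (nth_arg 0 ys) (tl ys)))"
  shows "recf n (\<lambda>xs. of_bool (\<exists>y<b xs. P y xs))"
proof -
  have "of_bool (\<exists>y<b xs. P y xs) = (of_bool (0 < (\<Sum>y<b xs. of_bool (P y xs) :: nat)) :: nat)" for xs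
    by (intro arg_cong[of _ _ of_bool]) (auto simp: zero_less_iff_neq_zero simp del: sum_of_bool_eq neq0_conv)
  thus ?thesis by (simp only:) (intro recf_less recf_const recf_sum assms)
qed

lemma recf_all:
  assumes "recf n b" "recf (Suc n) (\<lambda>ys. of_bool (P (nth_arg 0 ys) (tl ys)))"
  shows "recf n (\<lambda>xs. of_bool (\<forall>y<b xs. P y xs))"
  using recf_not[OF recf_ex[OF assms(1), of "\<lambda>y xs. \<not> P y xs"]] recf_not[OF assms(2)] by simp

lemmas recf_basic = recf_args recf_const recf_Suc recf_add recf_mult recf_minus recf_sum
  recf_not recf_and recf_or recf_iff recf_le recf_less recf_eq recf_ex recf_all

lemma recf_div: "recf n f \<Longrightarrow> recf n g \<Longrightarrow> recf n (\<lambda>xs. f xs div g xs)"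
proof -
  assume *: "recf n f" "recf n g"
  \<comment> \<open>The quotient counts the positive multiples of \<open>y\<close> up to
    \<open>x\<close>; the leading factor restores \<open>x div 0 = 0\<close>.\<close>
  have "x div y = of_bool (0 < y) * (\<Sum>q<x. of_bool (Suc q * y \<le> x))" for x y :: nat
  proof (cases "y = 0")
    case False
    hence "{..<x} \<inter> {q. Suc q * y \<le> x} = {..<x div y}"
      by (auto simp: less_eq_div_iff_mult_less_eq Suc_le_eq[symmetric] simp del: mult_Suc)
        (metis le_trans mult_le_mono2 mult.right_neutral One_nat_def)
    thus ?thesis using False by (simp add: sum_of_bool_eq)
  qed auto
  moreover have "recf (Suc (Suc 0)) (\<lambda>xs. of_bool (0 < nth_arg (Suc 0) xs) *
      (\<Sum>q<nth_arg 0 xs. of_bool (Suc q * nth_arg (Suc 0) xs \<le> nth_arg 0 xs)))"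
    by (intro recf_basic)
  ultimately have "recf (Suc (Suc 0)) (\<lambda>xs. nth_arg 0 xs div nth_arg (Suc 0) xs)" by (simp only:)
  thus ?thesis using * by (rule recf_comp2)
qed

lemma recf_mod: "recf n f \<Longrightarrow> recf n g \<Longrightarrow> recf n (\<lambda>xs. f xs mod g xs)"
  unfolding minus_mult_div_eq_mod[symmetric] by (intro recf_minus recf_mult recf_div)

lemma recf_dvd: "recf n f \<Longrightarrow> recf n g \<Longrightarrow> recf n (\<lambda>xs. of_bool (f xs dvd g xs))"
  unfolding dvd_eq_mod_eq_0 by (intro recf_eq recf_mod recf_const)

text \<open>A bounded search: the gcd is the only common divisor that every common divisor divides,
  and the indicator sum extracts it. The bound \<open>x + y\<close> also covers a zero
  argument.\<close>

lemma recf_gcd: "recf n f \<Longrightarrow> recf n g \<Longrightarrow> recf n (\<lambda>xs. gcd (f xs) (g xs))"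
proof -
  assume *: "recf n f" "recf n g"
  have "gcd x y = (\<Sum>d<Suc (x + y). of_bool (d dvd x \<and> d dvd y \<and>
      (\<forall>e<Suc (x + y). \<not> (e dvd x \<and> e dvd y) \<or> e dvd d)) * d)" for x y :: nat
  proof -
    have le: "gcd x y < Suc (x + y)"
      by (cases "x = 0") (auto simp: less_Suc_eq_le intro: order_trans[OF gcd_le1_nat])
    have "d dvd x \<and> d dvd y \<and> (\<forall>e<Suc (x + y). \<not> (e dvd x \<and> e dvd y) \<or> e dvd d) \<longleftrightarrow> d = gcd x y" for d
    proof
      assume d: "d dvd x \<and> d dvd y \<and> (\<forall>e<Suc (x + y). \<not> (e dvd x \<and> e dvd y) \<or> e dvd d)"
      hence "gcd x y dvd d" using le by (metis gcd_dvd1 gcd_dvd2)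
      moreover have "d dvd gcd x y" using d by (intro gcd_greatest) auto
      ultimately show "d = gcd x y" by (rule dvd_antisym[rotated])
    next
      assume "d = gcd x y"
      thus "d dvd x \<and> d dvd y \<and> (\<forall>e<Suc (x + y). \<not> (e dvd x \<and> e dvd y) \<or> e dvd d)"
        using gcd_greatest by (metis gcd_dvd1 gcd_dvd2)
    qed
    hence "(\<Sum>d<Suc (x + y). of_bool (d dvd x \<and> d dvd y \<and>
      (\<forall>e<Suc (x + y). \<not> (e dvd x \<and> e dvd y) \<or> e dvd d)) * d) = (\<Sum>d<Suc (x + y). if d = gcd x y then gcd x y else 0)"
      by (intro sum.cong) simp_all
    also have "\<dots> = gcd x y" using le by (subst sum.delta) auto
    finally show ?thesis ..
  qed
  moreover have "recf (Suc (Suc 0)) (\<lambda>xs. \<Sum>d<Suc (nth_arg 0 xs + nth_arg (Suc 0) xs).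
      of_bool (d dvd nth_arg 0 xs \<and> d dvd nth_arg (Suc 0) xs \<and>
      (\<forall>e<Suc (nth_arg 0 xs + nth_arg (Suc 0) xs). \<not> (e dvd nth_arg 0 xs \<and> e dvd nth_arg (Suc 0) xs) \<or> e dvd d)) * d)"
    by (intro recf_basic recf_dvd)
  ultimately have "recf (Suc (Suc 0)) (\<lambda>xs. gcd (nth_arg 0 xs) (nth_arg (Suc 0) xs))" by (simp only:)
  thus ?thesis using * by (rule recf_comp2)
qed

lemma recf_totient: "recf n f \<Longrightarrow> recf n (\<lambda>xs. totient (f xs))"
proof -
  assume *: "recf n f"
  have "totient m = (\<Sum>i<m. of_bool (gcd (Suc i) m = 1))" for m
  proof -
    have "totatives m = {1..m} \<inter> {k. gcd k m = 1}"
      unfolding totatives_def coprime_iff_gcd_eq_1 by auto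
    hence "totient m = (\<Sum>k\<in>{1..m}. of_bool (gcd k m = 1))"
      unfolding totient_def by (simp only: sum_of_bool_eq finite_atLeastAtMost of_nat_id)
    also have "\<dots> = (\<Sum>i<m. of_bool (gcd (Suc i) m = 1))"
      by (intro sum.reindex_bij_witness[of _ Suc "\<lambda>i. i - 1"]) auto
    finally show ?thesis .
  qed
  moreover have "recf (Suc 0) (\<lambda>xs. \<Sum>i<nth_arg 0 xs. of_bool (gcd (Suc i) (nth_arg 0 xs) = 1))"
    by (intro recf_basic recf_gcd)
  ultimately have "recf (Suc 0) (\<lambda>xs. totient (nth_arg 0 xs))" by (simp only:)
  thus ?thesis using * by (rule recf_comp1)
qed

lemma recf_fact: "recf n f \<Longrightarrow> recf n (\<lambda>xs. fact (f xs))"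
proof -
  assume *: "recf n f"
  have "fact m = rec_nat 1 (\<lambda>y r. Suc y * r) m" for m :: nat by (induction m) auto
  moreover have "recf (Suc 0) (\<lambda>xs. rec_nat 1 (\<lambda>y r. Suc y * r) (nth_arg 0 xs))"
    by (intro recf_rec recf_basic)
  ultimately have "recf (Suc 0) (\<lambda>xs. fact (nth_arg 0 xs))" by (simp only:)
  thus ?thesis using * by (rule recf_comp1)
qed

lemma recf_prod_encode:
  "recf n f \<Longrightarrow> recf n g \<Longrightarrow> recf n (\<lambda>xs. prod_encode (f xs, g xs))"
  unfolding prod_encode_def triangle_def prod.case by (intro recf_basic recf_div)

text \<open>Decoding is exhaustive search over pairs, as neither component of a pair exceeds its
  code.\<close>

lemma recf_fst_decode: "recf n f \<Longrightarrow> recf n (\<lambda>xs. fst (prod_decode (f xs)))"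
  and recf_snd_decode: "recf n f \<Longrightarrow> recf n (\<lambda>xs. snd (prod_decode (f xs)))"
proof -
  assume *: "recf n f"
  have eq: "(\<Sum>a<Suc z. \<Sum>b<Suc z. of_bool (prod_encode (a, b) = z) * c a b) =
     c (fst (prod_decode z)) (snd (prod_decode z))" for z and c :: "nat \<Rightarrow> nat \<Rightarrow> nat"
  proof -
    obtain x y where xy: "prod_decode z = (x, y)" by fastforce
    hence z: "z = prod_encode (x, y)" by (metis prod_decode_inverse)
    have xz: "x < Suc z" "y < Suc z" using le_prod_encode_1[of x y] le_prod_encode_2[of y x] z by auto
    have "(\<Sum>a<Suc z. \<Sum>b<Suc z. of_bool (prod_encode (a, b) = z) * c a b) =
      (\<Sum>a<Suc z. \<Sum>b<Suc z. if b = y then (if a = x then c x y else 0) else 0)"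
      by (intro sum.cong refl) (auto simp: z)
    also have "\<dots> = c x y" using xz by (simp only: sum.delta finite_lessThan lessThan_iff if_True)
    finally show ?thesis using xy by simp
  qed
  have "recf (Suc 0) (\<lambda>xs. \<Sum>a<Suc (nth_arg 0 xs). \<Sum>b<Suc (nth_arg 0 xs). of_bool (prod_encode (a, b) = nth_arg 0 xs) * a)"
    "recf (Suc 0) (\<lambda>xs. \<Sum>a<Suc (nth_arg 0 xs). \<Sum>b<Suc (nth_arg 0 xs). of_bool (prod_encode (a, b) = nth_arg 0 xs) * b)"
    by (intro recf_basic recf_prod_encode)+
  thus "recf n (\<lambda>xs. fst (prod_decode (f xs)))" "recf n (\<lambda>xs. snd (prod_decode (f xs)))"
    unfolding eq using * 
    by - (rule recf_comp1[of "\<lambda>z. fst (prod_decode z)"] recf_comp1[of "\<lambda>z. snd (prod_decode z)"], auto)+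
qed

lemmas recf_intros = recf_basic recf_div recf_mod recf_dvd recf_gcd recf_totient recf_fact
  recf_fst_decode recf_snd_decode

section \<open>An algorithm for the constant\<close>
text \<open>
  For a prime \<open>p > 5\<close> of rank of apparition \<open>d\<close> and \<open>\<sigma> k \<longleftrightarrow> s\<^sub>k = 1\<close>, the condition \<open>adm \<sigma> d u k\<close> for
  some \<open>u > 0\<close> expresses that \<open>p\<close> divides \<open>L\<^sub>k + s\<^sub>k\<close>. The last conjunct selects between the two
  factorizations available for the parity of \<open>k\<close>.
\<close>

definition adm :: "(nat \<Rightarrow> bool) \<Rightarrow> nat \<Rightarrow> nat \<Rightarrow> nat \<Rightarrow> bool" where
  "adm \<sigma> d u k \<longleftrightarrow> 0 < k \<and>
     ((even k \<and> \<not> 3 dvd u \<and> 3 * k = d * u) \<or>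
      (odd k \<and> 3 dvd u \<and> (3 * k = d * u + 3 \<or> 3 * k + 3 = d * u))) \<and>
     (\<sigma> k \<longleftrightarrow> even (k div 2 + k + u))"

text \<open>The bounds on \<open>k\<close> keep the search finite. They lose nothing:
  \<open>adm\<close> forces \<open>3 * k \<le> d * u + 3\<close>, see
  \<open>first_mult_iff\<close>.\<close>

definition first_mult :: "(nat \<Rightarrow> bool) \<Rightarrow> nat \<Rightarrow> nat \<Rightarrow> bool" where
  "first_mult \<sigma> d u \<longleftrightarrow> 0 < u \<and> (\<exists>k<d * u + 2. adm \<sigma> d u k) \<and>
     (\<forall>v<u. \<not> (0 < v \<and> (\<exists>k<d * v + 2. adm \<sigma> d v k)))"

text \<open>
  Up to a factor depending only on \<open>M\<close>, this is the product of \<open>1 - 1/p\<close> over the common prime divisors of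
  \<open>r\<close> and \<open>M\<close>, to which the sum of \<open>\<phi>(d)\<close> over \<open>d \<equiv> r (mod M)\<close> is proportional.
\<close>

definition weight :: "nat \<Rightarrow> nat \<Rightarrow> nat" where
  "weight M r = totient (gcd r M) * (M div gcd r M)"

text \<open>
  The factor \<open>27 = 3 \<cdot> 9\<close> comes from \<open>\<Sum>\<^bsub>d \<le> x\<^esub> \<phi>(d) \<sim> 3x\<^sup>2/\<pi>\<^sup>2\<close> at \<open>x = 3n/u\<close>, and
  \<^term>\<open>fact M :: nat\<close> clears the denominators \<open>u \<le> M\<close>. The residue class of \<open>r\<close> is represented by \<open>r + M\<close>
  because the least multiplier of \<open>d = 0\<close> or \<open>d = 1\<close> may differ from that of the rest of its class.
\<close>

definition lcm_numerator :: "(nat \<Rightarrow> bool) \<Rightarrow> nat \<Rightarrow> nat" where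
  "lcm_numerator \<sigma> M = 27 * (\<Sum>r<M. \<Sum>u<Suc M. of_bool (first_mult \<sigma> (r + M) u) *
      (weight M r * (fact M div u * (fact M div u))))"

definition lcm_denominator :: "nat \<Rightarrow> nat" where
  "lcm_denominator M = fact M * fact M * (\<Sum>r<M. weight M r)"

text \<open>The code of a nonempty list is the successor of the code of the pair (head, code of the
  tail). The code 0 of the empty list is a fixed point of the step.\<close>

definition code_drop :: "nat \<Rightarrow> nat \<Rightarrow> nat" where
  "code_drop i c = rec_nat c (\<lambda>_ r. snd (prod_decode (r - 1))) i"

text \<open>Counts the \<open>i\<close> for which something is left after dropping \<open>i\<close>
  elements; a list is never longer than its code.\<close>

definition code_length :: "nat \<Rightarrow> nat" where
  "code_length c = (\<Sum>i<c. of_bool (0 < code_drop i c))"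

text \<open>The value 2 is \<open>int_encode 1\<close>, and the list starts with the sign of index
  1, hence \<open>k - 1\<close>.\<close>

definition code_sign :: "nat \<Rightarrow> nat \<Rightarrow> bool" where
  "code_sign c k \<longleftrightarrow> fst (prod_decode (code_drop ((k - 1) mod code_length c) c - 1)) = 2"

lemma code_drop_list_encode: "code_drop i (list_encode xs) = list_encode (drop i xs)"
  unfolding code_drop_def
proof (induction i arbitrary: xs)
  case (Suc i)
  have "prod_decode 0 = (0, 0)"
    using prod_encode_inverse[of "(0, 0)"] by (simp add: prod_encode_def)
  with Suc show ?case by (cases "drop i xs") (auto simp: drop_Suc drop_tl tl_drop[symmetric])
qed auto

lemma list_encode_pos_iff: "0 < list_encode xs \<longleftrightarrow> xs \<noteq> []"
  by (cases xs) auto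

lemma length_le_list_encode: "length xs \<le> list_encode xs"
proof (induction xs)
  case (Cons x xs)
  thus ?case using le_prod_encode_2[of "list_encode xs" x] by simp
qed auto

lemma code_length_list_encode: "code_length (list_encode xs) = length xs"
proof -
  have "{..<list_encode xs} \<inter> {i. 0 < code_drop i (list_encode xs)} = {..<length xs}"
    using length_le_list_encode[of xs] by (auto simp: code_drop_list_encode list_encode_pos_iff)
  thus ?thesis unfolding code_length_def by (simp add: sum_of_bool_eq)
qed

lemma code_nth_list_encode:
  assumes "i < length xs"
  shows "fst (prod_decode (code_drop i (list_encode xs) - 1)) = xs ! i"
  using assms by (simp add: code_drop_list_encode Cons_nth_drop_Suc[symmetric])

lemma has_period_mod:
  assumes "has_period s T" "k > 0"
  shows "s (Suc ((k - 1) mod T)) = s k"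
proof -
  have T: "T > 0" and per: "\<And>n. n \<ge> 1 \<Longrightarrow> s (n + T) = s n"
    using assms unfolding has_period_def by auto
  have "s (n + j * T) = s n" if "n \<ge> 1" for n j
  proof (induction j)
    case (Suc j)
    have "s (n + Suc j * T) = s (n + j * T + T)" by (simp add: algebra_simps)
    thus ?case using per[of "n + j * T"] that Suc by simp
  qed auto
  from this[of "Suc ((k - 1) mod T)" "(k - 1) div T"] show ?thesis
    using assms(2) by (simp add: add.commute)
qed

lemma code_length_period_code: "code_length (period_code s T) = T"
  by (simp add: period_code_def code_length_list_encode)

lemma code_sign_period_code:
  assumes "sign_sequence s" "has_period s T" "k > 0"
  shows "code_sign (period_code s T) k \<longleftrightarrow> s k = 1"
proof -
  let ?j = "(k - 1) mod T"
  have T: "T > 0" using assms unfolding has_period_def by auto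
  hence j: "?j < T" by simp
  have "fst (prod_decode (code_drop ?j (period_code s T) - 1)) = int_encode (s (Suc ?j))"
    unfolding period_code_def using j by (subst code_nth_list_encode) (auto simp: nth_append simp del: upt_Suc)
  also have "\<dots> = int_encode (s k)" using has_period_mod[OF assms(2,3)] by simp
  finally have "code_sign (period_code s T) k \<longleftrightarrow> int_encode (s k) = 2"
    by (simp add: code_sign_def code_length_period_code)
  moreover have "int_encode 1 = 2" by (simp add: int_encode_def sum_encode_def)
  ultimately show ?thesis by (metis int_encode_eq)
qed

text \<open>Since \<open>adm\<close> requires \<open>0 < k\<close>, the value at 0 has no influence,
  and the decoded signs may replace those of the sequence.\<close>

lemma first_mult_cong:
  assumes "\<And>k. k > 0 \<Longrightarrow> \<sigma> k \<longleftrightarrow> \<tau> k"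
  shows "first_mult \<sigma> = first_mult \<tau>"
proof -
  have "adm \<sigma> = adm \<tau>" using assms by (auto simp: adm_def fun_eq_iff)
  thus ?thesis by (simp add: first_mult_def[abs_def])
qed

lemma recf_weight: "recf n f \<Longrightarrow> recf n g \<Longrightarrow> recf n (\<lambda>xs. weight (f xs) (g xs))"
  unfolding weight_def by (intro recf_intros)

lemma recf_code_drop: "recf n f \<Longrightarrow> recf n g \<Longrightarrow> recf n (\<lambda>xs. code_drop (f xs) (g xs))"
  unfolding code_drop_def by (intro recf_rec recf_intros)

lemma recf_code_length: "recf n f \<Longrightarrow> recf n (\<lambda>xs. code_length (f xs))"
proof -
  assume "recf n f"
  have "recf (Suc 0) (\<lambda>xs. code_length (nth_arg 0 xs))"
    unfolding code_length_def by (intro recf_intros recf_code_drop)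
  thus ?thesis by (rule recf_comp1) fact
qed

lemma recf_code_sign: "recf n f \<Longrightarrow> recf n g \<Longrightarrow> recf n (\<lambda>xs. of_bool (code_sign (f xs) (g xs)))"
  unfolding code_sign_def by (intro recf_intros recf_code_drop recf_code_length)

lemma recf_adm:
  assumes "recf n c" "recf n d" "recf n u" "recf n k"
  shows "recf n (\<lambda>xs. of_bool (adm (code_sign (c xs)) (d xs) (u xs) (k xs)))"
  unfolding adm_def using assms by (intro recf_intros recf_code_sign)

lemma recf_first_mult:
  assumes "recf n c" "recf n d" "recf n u"
  shows "recf n (\<lambda>xs. of_bool (first_mult (code_sign (c xs)) (d xs) (u xs)))"
proof (rule recf_comp3[of "\<lambda>c d u. of_bool (first_mult (code_sign c) d u)", OF _ assms])
  show "recf (Suc (Suc (Suc 0))) (\<lambda>xs. of_bool (first_mult (code_sign (nth_arg 0 xs)) (nth_arg (Suc 0) xs) (nth_arg (Suc (Suc 0)) xs)))"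
    unfolding first_mult_def by (intro recf_intros recf_adm)
qed

lemma recf_lcm_numerator: "recf (Suc 0) (\<lambda>xs. lcm_numerator (code_sign (nth_arg 0 xs)) (12 * code_length (nth_arg 0 xs)))"
  unfolding lcm_numerator_def by (intro recf_intros recf_first_mult recf_weight recf_code_length)

lemma recf_lcm_denominator: "recf (Suc 0) (\<lambda>xs. lcm_denominator (12 * code_length (nth_arg 0 xs)))"
  unfolding lcm_denominator_def by (intro recf_intros recf_weight recf_code_length)

lemma computableI:
  assumes "recf (Suc 0) (\<lambda>xs. h (nth_arg 0 xs))"
  shows "computable h"
proof -
  obtain g where "total_recursive (Suc 0) g" "\<And>xs. length xs = Suc 0 \<Longrightarrow> h (nth_arg 0 xs) = g xs"
    using assms unfolding recf_def by blast
  thus ?thesis unfolding computable_def by (metis One_nat_def nth_arg_Cons_0 length_Cons list.size(3))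
qed

lemma quotient_of_of_nat_div:
  assumes "b > 0"
  shows "quotient_of (of_nat a / of_nat b) = (int (a div gcd a b), int (b div gcd a b))"
proof -
  have "(of_nat a / of_nat b :: rat) = Fract (int a) (int b)"
    by (simp add: Fract_of_int_quotient)
  thus ?thesis using assms by (simp add: quotient_of_Fract normalize_def zdiv_int gcd_int_int_eq Let_def)
qed

lemma effectively_computableI:
  assumes "\<And>s T. sign_sequence s \<Longrightarrow> has_period s T \<Longrightarrow>
    B s = of_nat (lcm_numerator (\<lambda>k. s k = 1) (12 * T)) / of_nat (lcm_denominator (12 * T))"
  assumes pos: "\<And>M. M > 0 \<Longrightarrow> lcm_denominator M > 0"
  shows "effectively_computable B"
proof -
  define N where "N = (\<lambda>c. lcm_numerator (code_sign c) (12 * code_length c))"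
  define D where "D = (\<lambda>c. lcm_denominator (12 * code_length c))"
  \<comment> \<open>\<open>int_encode\<close> maps a nonnegative \<open>m\<close> to
    \<open>2 * m\<close>; dividing by the gcd gives the lowest terms that \<open>quotient_of\<close>
    returns.\<close>
  define num where "num = (\<lambda>c. 2 * (N c div gcd (N c) (D c)))"
  define den where "den = (\<lambda>c. D c div gcd (N c) (D c))"
  have ND: "recf (Suc 0) (\<lambda>xs. N (nth_arg 0 xs))" "recf (Suc 0) (\<lambda>xs. D (nth_arg 0 xs))"
    unfolding N_def D_def by (rule recf_lcm_numerator recf_lcm_denominator)+
  have "computable num" "computable den"
    unfolding num_def den_def by (intro computableI recf_intros ND; fail)+
  moreover have "quotient_of (B s) = (int_decode (num (period_code s T)), int (den (period_code s T)))"
    if s: "sign_sequence s" "has_period s T" for s T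
  proof -
    let ?c = "period_code s T"
    have "first_mult (\<lambda>k. s k = 1) = first_mult (code_sign ?c)"
      using code_sign_period_code[OF s] by (intro first_mult_cong) simp
    hence "B s = of_nat (N ?c) / of_nat (D ?c)"
      using assms(1)[OF s] by (simp add: N_def D_def code_length_period_code lcm_numerator_def)
    moreover have "D ?c > 0"
      using pos s(2) by (simp add: D_def code_length_period_code has_period_def)
    moreover have "int_decode (2 * m) = int m" for m
      by (simp add: int_decode_def sum_decode_def)
    ultimately show ?thesis by (simp add: quotient_of_of_nat_div num_def den_def)
  qed
  ultimately show ?thesis unfolding effectively_computable_def by blast
qed

section \<open>Totient sums over residue classes\<close>
definition moebius_mu :: "nat \<Rightarrow> real" where
  "moebius_mu n = (if squarefree n then (-1) ^ card (prime_factors n) else 0)"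

lemma abs_moebius_mu_le: "\<bar>moebius_mu n\<bar> \<le> 1"
  by (simp add: moebius_mu_def power_abs)

lemma prod_prime_factors_squarefree:
  assumes "squarefree (n :: nat)"
  shows "\<Prod>(prime_factors n) = n"
proof -
  have n: "n \<noteq> 0" using assms not_squarefree_0[where 'a = nat] by metis
  have "(\<Prod>p\<in>prime_factors n. p ^ multiplicity p n) = \<Prod>(prime_factors n)"
    using assms n squarefree_factorial_semiring''[of n]
    by (intro prod.cong) (auto simp: prime_factors_multiplicity le_Suc_eq)
  thus ?thesis using prod_prime_factors[OF n] by simp
qed

lemma prime_factors_prod_primes:
  assumes "finite P" "\<And>p. p \<in> P \<Longrightarrow> prime (p :: nat)"
  shows "prime_factors (\<Prod>P) = P"
proof -
  have "0 \<notin> (\<lambda>p. p) ` P" using assms(2) by (auto dest: prime_gt_0_nat)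
  thus ?thesis using prime_factors_prod[of P "\<lambda>p. p"] assms by (auto simp: prime_prime_factors)
qed

lemma squarefree_prod_primes:
  assumes "finite P" "\<And>p. p \<in> P \<Longrightarrow> prime (p :: nat)"
  shows "squarefree (\<Prod>P)"
  using assms by (intro squarefree_prod_coprime) (auto simp: primes_coprime squarefree_prime)

text \<open>Expanding the product yields a sum over the subsets of \<open>P\<close>, and these
  correspond to squarefree numbers through their sets of prime factors.\<close>

lemma sum_moebius_mu_prod:
  fixes h :: "nat \<Rightarrow> real"
  assumes P: "finite P" "\<And>p. p \<in> P \<Longrightarrow> prime p"
  shows "(\<Sum>e | squarefree e \<and> prime_factors e \<subseteq> P. moebius_mu e * (\<Prod>p\<in>prime_factors e. h p)) = (\<Prod>p\<in>P. 1 - h p)"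
proof -
  have "(\<Prod>p\<in>P. 1 - h p) = (\<Prod>p\<in>P. - h p + 1)" by simp
  also have "\<dots> = (\<Sum>X\<in>Pow P. (\<Prod>p\<in>X. - h p))"
    using P(1) by (subst prod_add) auto
  also have "\<dots> = (\<Sum>e | squarefree e \<and> prime_factors e \<subseteq> P. moebius_mu e * (\<Prod>p\<in>prime_factors e. h p))"
  proof (rule sum.reindex_bij_witness[of _ prime_factors Prod])
    fix X assume X: "X \<in> Pow P"
    hence X': "finite X" "\<And>p. p \<in> X \<Longrightarrow> prime p" using P finite_subset by auto
    show "prime_factors (\<Prod>X) = X" using prime_factors_prod_primes[OF X'] .
    show "\<Prod>X \<in> {e. squarefree e \<and> prime_factors e \<subseteq> P}"
      using X prime_factors_prod_primes[OF X'] squarefree_prod_primes[OF X'] by simp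
    show "moebius_mu (\<Prod>X) * (\<Prod>p\<in>prime_factors (\<Prod>X). h p) = (\<Prod>p\<in>X. - h p)"
      using prime_factors_prod_primes[OF X'] squarefree_prod_primes[OF X'] by (simp add: moebius_mu_def prod_uminus)
  qed (auto simp: prod_prime_factors_squarefree)
  finally show ?thesis ..
qed

text \<open>Used with \<open>h\<close> constantly 1, which gives the basic identity of the Moebius
  function, and with \<open>h p = 1 / p\<close>, which gives the Euler product of the
  totient.\<close>

lemma sum_moebius_mu_divisors:
  fixes h :: "nat \<Rightarrow> real"
  assumes "n > 0"
  shows "(\<Sum>e | e dvd n \<and> coprime e M. moebius_mu e * (\<Prod>p\<in>prime_factors e. h p)) =
    (\<Prod>p | p \<in> prime_factors n \<and> \<not> p dvd M. 1 - h p)"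
proof -
  let ?P = "{p. p \<in> prime_factors n \<and> \<not> p dvd M}"
  have fin: "finite {e. e dvd n \<and> coprime e M}" using assms by (auto intro: finite_subset[OF _ finite_divisors_nat])
  have sub: "{e. squarefree e \<and> prime_factors e \<subseteq> ?P} \<subseteq> {e. e dvd n \<and> coprime e M}"
  proof clarify
    fix e :: nat assume e: "squarefree e" "prime_factors e \<subseteq> ?P"
    have e0: "e \<noteq> 0" using e(1) not_squarefree_0[where 'a = nat] by metis
    have "e = \<Prod>(prime_factors e)" using prod_prime_factors_squarefree[OF e(1)] by simp
    also have "\<dots> dvd \<Prod>(prime_factors n)" using e(2) by (intro prod_dvd_prod_subset) auto
    also have "\<dots> dvd (\<Prod>p\<in>prime_factors n. p ^ multiplicity p n)"
      by (intro prod_dvd_prod dvd_power) (auto simp: prime_factors_multiplicity)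
    also have "\<dots> = n" using assms prod_prime_factors[of n] by simp
    finally have "e dvd n" .
    moreover have "coprime e M"
    proof (rule ccontr)
      assume "\<not> coprime e M"
      then obtain p where "prime p" "p dvd e" "p dvd M"
        by (metis coprime_iff_gcd_eq_1 dvd_trans gcd_dvd1 gcd_dvd2 prime_factor_nat)
      thus False using e(2) e0 by (auto simp: in_prime_factors_iff)
    qed
    ultimately show "e dvd n \<and> coprime e M" by simp
  qed
  have "(\<Sum>e | e dvd n \<and> coprime e M. moebius_mu e * (\<Prod>p\<in>prime_factors e. h p)) =
    (\<Sum>e | squarefree e \<and> prime_factors e \<subseteq> ?P. moebius_mu e * (\<Prod>p\<in>prime_factors e. h p))"
  proof (rule sum.mono_neutral_right[OF fin sub], rule ballI)
    fix e assume e: "e \<in> {e. e dvd n \<and> coprime e M} - {e. squarefree e \<and> prime_factors e \<subseteq> ?P}"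
    have "squarefree e \<Longrightarrow> prime_factors e \<subseteq> ?P"
      using e assms by (auto simp: in_prime_factors_iff dest: dvd_trans)
        (meson coprime_common_divisor_nat not_prime_unit coprime_common_divisor)
    thus "moebius_mu e * (\<Prod>p\<in>prime_factors e. h p) = 0" using e by (auto simp: moebius_mu_def)
  qed
  also have "\<dots> = (\<Prod>p\<in>?P. 1 - h p)" by (rule sum_moebius_mu_prod) auto
  finally show ?thesis .
qed

lemma sum_moebius_mu_eq:
  assumes "n > 0"
  shows "(\<Sum>e | e dvd n. moebius_mu e) = of_bool (n = 1)"
proof -
  have "{p. p \<in> prime_factors n \<and> \<not> p dvd 1} = prime_factors n"
    by (auto simp: in_prime_factors_iff)
  hence *: "(\<Sum>e | e dvd n. moebius_mu e) = 0 ^ card (prime_factors n)"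
    using sum_moebius_mu_divisors[OF assms, where M = 1 and h = "\<lambda>_. 1"] by simp
  show ?thesis
  proof (cases "n = 1")
    case False
    then obtain p where "prime p" "p dvd n" using prime_factor_nat by blast
    hence "p \<in> prime_factors n" using assms by (simp add: in_prime_factors_iff)
    hence "prime_factors n \<noteq> {}" by blast
    thus ?thesis using * False by (simp add: card_gt_0_iff zero_power)
  qed (use * in simp)
qed

text \<open>The Euler product of the totient is split at the primes dividing \<open>M\<close>. Their
  part depends only on \<open>gcd n M\<close>, which is constant on a residue class modulo
  \<open>M\<close>; the rest involves only \<open>e\<close> coprime to \<open>M\<close>, to which
  the Chinese remainder theorem applies.\<close>

lemma totient_eq_sum_moebius_mu:
  assumes "n > 0" "M > 0"
  shows "real (totient n) = real (totient (gcd n M)) / real (gcd n M) *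
    (\<Sum>e | e dvd n \<and> coprime e M. moebius_mu e / real e * real n)"
proof -
  let ?g = "gcd n M"
  have g: "?g > 0" using assms by simp
  have h: "(\<Prod>p\<in>prime_factors e. 1 / real p) * moebius_mu e = moebius_mu e / real e" for e
    using prod_prime_factors_squarefree[of e] by (auto simp: moebius_mu_def prod_dividef simp flip: of_nat_prod)
  have "prime_factors n = prime_factors ?g \<union> {p. p \<in> prime_factors n \<and> \<not> p dvd M}"
    using assms by (auto simp: in_prime_factors_iff)
  hence "(\<Prod>p\<in>prime_factors n. 1 - 1 / real p) =
     (\<Prod>p\<in>prime_factors ?g \<union> {p. p \<in> prime_factors n \<and> \<not> p dvd M}. 1 - 1 / real p)" by simp
  also have "\<dots> = (\<Prod>p\<in>prime_factors ?g. 1 - 1 / real p) * (\<Prod>p | p \<in> prime_factors n \<and> \<not> p dvd M. 1 - 1 / real p)"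
    by (rule prod.union_disjoint) (auto simp: in_prime_factors_iff)
  also have "(\<Prod>p | p \<in> prime_factors n \<and> \<not> p dvd M. 1 - 1 / real p) = (\<Sum>e | e dvd n \<and> coprime e M. moebius_mu e / real e)"
    using sum_moebius_mu_divisors[OF assms(1), where M = M and h = "\<lambda>p. 1 / real p"] h by (simp add: mult.commute)
  also have "(\<Prod>p\<in>prime_factors ?g. 1 - 1 / real p) = real (totient ?g) / real ?g"
    using totient_formula2[of ?g] g by simp
  finally have "(\<Prod>p\<in>prime_factors n. 1 - 1 / real p) =
      real (totient ?g) / real ?g * (\<Sum>e | e dvd n \<and> coprime e M. moebius_mu e / real e)" .
  moreover have "(\<Sum>e | e dvd n \<and> coprime e M. moebius_mu e / real e * real n) =
      (\<Sum>e | e dvd n \<and> coprime e M. moebius_mu e / real e) * real n"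
    by (simp only: sum_distrib_right)
  ultimately show ?thesis unfolding totient_formula2[of n] by (simp only: mult_ac)
qed

text \<open>The error is uniform in \<open>q\<close>, which matters because \<open>q = e * M\<close>
  will occur for all \<open>e\<close> up to \<open>x\<close>.\<close>

lemma sum_Icc_mod_bound:
  assumes "c < q"
  shows "\<bar>real (\<Sum>n | n \<in> {1..x} \<and> n mod q = c. n) - (real x)\<^sup>2 / (2 * real q)\<bar> \<le> 2 * real x"
proof (cases "x < c")
  case True
  hence "{n. n \<in> {1..x} \<and> n mod q = c} = {}" using assms by (auto dest: less_le_trans)
  moreover have "(real x)\<^sup>2 / (2 * real q) \<le> 2 * real x"
  proof -
    have "(real x)\<^sup>2 \<le> real x * real q" using True assms by (simp add: power2_eq_square mult_left_mono)
    hence "(real x)\<^sup>2 \<le> 4 * (real x * real q)" by (rule order_trans) simp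
    thus ?thesis using assms by (simp add: field_simps)
  qed
  ultimately show ?thesis by (simp only: sum.empty of_nat_0 diff_0 abs_minus_cancel) simp
next
  case False
  \<comment> \<open>\<open>y\<close> is the largest element of the progression
    \<open>c + q * i\<close> not exceeding \<open>x\<close>.\<close>
  define m where "m = (x - c) div q"
  define y where "y = c + q * m"
  have q: "q > 0" using assms by simp
  have y1: "y \<le> x" using False by (simp add: y_def m_def) (metis add.commute add_le_cancel_right diff_add_inverse2 le_add_diff_inverse2 not_less times_div_less_eq_dividend)
  have y2: "x < y + q" using False q dividend_less_times_div[OF q, of "x - c"] by (simp add: y_def m_def algebra_simps)
  have "(\<Sum>n | n \<in> {1..x} \<and> n mod q = c. n) = (\<Sum>n | n \<in> {0..x} \<and> n mod q = c. n)"
    by (rule sum.mono_neutral_left) (auto simp: Suc_le_eq)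
  also have "\<dots> = (\<Sum>i\<le>m. c + q * i)"
  proof (rule sum.reindex_bij_witness[of _ "\<lambda>i. c + q * i" "\<lambda>n. n div q"])
    fix n assume n: "n \<in> {n. n \<in> {0..x} \<and> n mod q = c}"
    thus "c + q * (n div q) = n" by (metis (mono_tags, lifting) add.commute mem_Collect_eq mult_div_mod_eq)
    have "n - c = q * (n div q)" using n by (auto simp: minus_mod_eq_mult_div)
    moreover have "(n - c) div q \<le> m" using n unfolding m_def by (intro div_le_mono) auto
    ultimately show "n div q \<in> {..m}" using q by simp
    show "c + q * (n div q) = n" by fact
  next
    fix i assume i: "i \<in> {..m}"
    show "(c + q * i) div q = i" using assms by simp
    have "c + q * i \<le> y" using i by (simp add: y_def)
    thus "c + q * i \<in> {n. n \<in> {0..x} \<and> n mod q = c}" using assms y1 by simp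
  qed
  also have "2 * real \<dots> * real q = (real y)\<^sup>2 - (real c)\<^sup>2 + real q * (real y + real c)"
  proof -
    have "2 * (\<Sum>i\<le>m. real c + real q * real i) * real q =
      (real c + real q * real m)\<^sup>2 - (real c)\<^sup>2 + real q * ((real c + real q * real m) + real c)"
      by (induction m) (auto simp: power2_eq_square algebra_simps)
    thus ?thesis by (simp add: y_def)
  qed
  finally have eq: "2 * real q * real (\<Sum>n | n \<in> {1..x} \<and> n mod q = c. n) =
      (real y)\<^sup>2 - (real c)\<^sup>2 + real q * (real y + real c)" by (simp add: mult_ac)
  have cy: "c \<le> y" by (simp add: y_def)
  have b1: "(real c)\<^sup>2 \<le> real q * real x"
    using cy y1 assms unfolding power2_eq_square by (intro mult_mono) auto
  have b2: "(real x)\<^sup>2 - (real y)\<^sup>2 \<le> real q * (2 * real x)"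
  proof -
    have "(real x)\<^sup>2 - (real y)\<^sup>2 = (real x - real y) * (real x + real y)" by (simp add: power2_eq_square algebra_simps)
    also have "\<dots> \<le> real q * (2 * real x)" using y1 y2 by (intro mult_mono) auto
    finally show ?thesis .
  qed
  have b3: "(real y)\<^sup>2 \<le> (real x)\<^sup>2" using y1 by simp
  have b4: "real q * (real y + real c) \<le> real q * (2 * real x)"
    using y1 cy by (intro mult_left_mono) auto
  have b5: "0 \<le> real q * (real y + real c)" by simp
  have "\<bar>2 * real q * real (\<Sum>n | n \<in> {1..x} \<and> n mod q = c. n) - (real x)\<^sup>2\<bar> \<le> real q * (4 * real x)"
    unfolding eq abs_le_iff using b1 b2 b3 b4 b5 zero_le_power2[of "real c"] mult_nonneg_nonneg[of "real q" "real x"] by linarith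
  hence "2 * real q * \<bar>real (\<Sum>n | n \<in> {1..x} \<and> n mod q = c. n) - (real x)\<^sup>2 / (2 * real q)\<bar> \<le> real q * (4 * real x)"
    using q by (simp add: abs_mult[of "2 * real q", simplified, symmetric] right_diff_distrib) 
  thus ?thesis using q by (simp add: mult.assoc mult.left_commute[of _ "real q"])
qed

lemma sum_inverse_le_ln:
  assumes "x > 0"
  shows "(\<Sum>e=1..x. 1 / real e) \<le> 1 + ln (real x)"
  using assms
proof (induction x rule: nat_induct_non_zero)
  case (Suc x)
  have "ln (real x / real (Suc x)) \<le> real x / real (Suc x) - 1"
    using Suc by (intro ln_le_minus_one) auto
  also have "\<dots> = - (1 / real (Suc x))" by (simp add: field_simps)
  finally have "1 / real (Suc x) \<le> ln (real (Suc x)) - ln (real x)"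
    using Suc by (simp add: ln_div)
  thus ?case using Suc by simp
qed auto

definition totient_sum :: "nat \<Rightarrow> nat \<Rightarrow> nat \<Rightarrow> real" where
  "totient_sum M r x = (\<Sum>n | n \<in> {1..x} \<and> n mod M = r. real (totient n))"

text \<open>By coprimality both conditions amount to one residue class modulo
  \<open>e * M\<close>.\<close>

lemma sum_Icc_mod_dvd_bound:
  assumes "M > 0" "r < M" "coprime e M" "e > 0"
  shows "\<bar>real (\<Sum>n | n \<in> {1..x} \<and> n mod M = r \<and> e dvd n. n) - (real x)\<^sup>2 / (2 * real (e * M))\<bar> \<le> 2 * real x"
proof -
  obtain z where z: "[z = r] (mod M)" "[z = 0] (mod e)"
    using binary_chinese_remainder_nat[of M e r 0] assms(3) by (auto simp: coprime_commute)
  define c where "c = z mod (e * M)"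
  have c: "c < e * M" using assms by (simp add: c_def)
  have "[n = z] (mod e * M) \<longleftrightarrow> [n = z] (mod M) \<and> [n = z] (mod e)" for n
    using assms(3) by (metis cong_modulus_mult_nat coprime_cong_mult_nat mult.commute)
  hence "n mod M = r \<and> e dvd n \<longleftrightarrow> n mod (e * M) = c" for n
    using z assms(2) by (metis (no_types, opaque_lifting) c_def cong_def cong_0_iff cong_sym cong_trans mod_less)
  hence "{n. n \<in> {1..x} \<and> n mod M = r \<and> e dvd n} = {n. n \<in> {1..x} \<and> n mod (e * M) = c}" by blast
  thus ?thesis using sum_Icc_mod_bound[OF c, of x] by simp
qed

lemma totient_sum_bound:
  assumes M: "M > 0" "r < M" and x: "x > 0"
  defines "w \<equiv> real (totient (gcd r M)) / real (gcd r M)"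
  shows "\<bar>totient_sum M r x - w * ((real x)\<^sup>2 / (2 * real M) * (\<Sum>e=1..x. of_bool (coprime e M) * moebius_mu e / (real e)\<^sup>2))\<bar>
    \<le> 2 * real x * (1 + ln (real x))"
proof -
  define S where "S = (\<lambda>e. real (\<Sum>n | n \<in> {1..x} \<and> n mod M = r \<and> e dvd n. n))"
  define b where "b = (\<lambda>e. of_bool (coprime e M) * moebius_mu e / real e)"
  have w: "0 \<le> w" "w \<le> 1" using M unfolding w_def by (auto simp: divide_le_eq totient_le)
  have "totient_sum M r x = (\<Sum>n | n \<in> {1..x} \<and> n mod M = r. w * (\<Sum>e=1..x. of_bool (e dvd n) * (b e * real n)))"
    unfolding totient_sum_def
  proof (rule sum.cong)
    fix n assume n: "n \<in> {n. n \<in> {1..x} \<and> n mod M = r}"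
    have g: "gcd n M = gcd r M" using n by (metis (mono_tags) gcd.commute gcd_red_nat mem_Collect_eq)
    have "(\<Sum>e | e dvd n \<and> coprime e M. moebius_mu e / real e * real n) = (\<Sum>e=1..x. of_bool (e dvd n) * (b e * real n))"
      using n by (intro sum.mono_neutral_cong_left) (auto simp: b_def Suc_le_eq intro: dvd_imp_le[THEN order_trans] dvd_pos_nat)
    thus "real (totient n) = w * (\<Sum>e=1..x. of_bool (e dvd n) * (b e * real n))"
      using totient_eq_sum_moebius_mu[of n M] n M g by (simp add: w_def)
  qed simp
  also have "\<dots> = w * (\<Sum>e=1..x. \<Sum>n | n \<in> {1..x} \<and> n mod M = r. of_bool (e dvd n) * (b e * real n))"
    by (subst sum.swap) (simp add: sum_distrib_left)
  also have "(\<Sum>e=1..x. \<Sum>n | n \<in> {1..x} \<and> n mod M = r. of_bool (e dvd n) * (b e * real n)) = (\<Sum>e=1..x. b e * S e)"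
  proof (rule sum.cong[OF refl])
    fix e
    have "(\<Sum>n | n \<in> {1..x} \<and> n mod M = r. of_bool (e dvd n) * (b e * real n)) =
      (\<Sum>n | n \<in> {1..x} \<and> n mod M = r \<and> e dvd n. b e * real n)"
      by (rule sum.mono_neutral_cong_right) auto
    thus "(\<Sum>n | n \<in> {1..x} \<and> n mod M = r. of_bool (e dvd n) * (b e * real n)) = b e * S e"
      by (simp add: S_def sum_distrib_left)
  qed
  finally have 1: "totient_sum M r x = w * (\<Sum>e=1..x. b e * S e)" .
  have 2: "(real x)\<^sup>2 / (2 * real M) * (\<Sum>e=1..x. of_bool (coprime e M) * moebius_mu e / (real e)\<^sup>2) =
     (\<Sum>e=1..x. b e * ((real x)\<^sup>2 / (2 * real (e * M))))"
    unfolding sum_distrib_left by (intro sum.cong) (auto simp: b_def power2_eq_square field_simps)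
  have "\<bar>(\<Sum>e=1..x. b e * S e) - (\<Sum>e=1..x. b e * ((real x)\<^sup>2 / (2 * real (e * M))))\<bar> \<le>
     (\<Sum>e=1..x. \<bar>b e * (S e - (real x)\<^sup>2 / (2 * real (e * M)))\<bar>)"
    unfolding sum_subtractf[symmetric] right_diff_distrib[symmetric] by (rule sum_abs)
  also have "\<dots> \<le> (\<Sum>e=1..x. 2 * real x * (1 / real e))"
  proof (rule sum_mono)
    fix e assume e: "e \<in> {1..x}"
    show "\<bar>b e * (S e - (real x)\<^sup>2 / (2 * real (e * M)))\<bar> \<le> 2 * real x * (1 / real e)"
    proof (cases "coprime e M")
      case True
      have "\<bar>b e\<bar> \<le> 1 / real e" using abs_moebius_mu_le[of e] e by (simp add: b_def abs_mult divide_right_mono)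
      moreover have "\<bar>S e - (real x)\<^sup>2 / (2 * real (e * M))\<bar> \<le> 2 * real x"
        unfolding S_def using e by (intro sum_Icc_mod_dvd_bound M True) auto
      ultimately have "\<bar>b e\<bar> * \<bar>S e - (real x)\<^sup>2 / (2 * real (e * M))\<bar> \<le> 1 / real e * (2 * real x)"
        by (intro mult_mono) auto
      thus ?thesis by (simp add: abs_mult mult.commute)
    qed (simp add: b_def)
  qed
  also have "\<dots> \<le> 2 * real x * (1 + ln (real x))"
    unfolding sum_distrib_left[symmetric] using sum_inverse_le_ln[OF x] by (intro mult_left_mono) auto
  finally have 3: "\<bar>(\<Sum>e=1..x. b e * S e) - (\<Sum>e=1..x. b e * ((real x)\<^sup>2 / (2 * real (e * M))))\<bar>
      \<le> 2 * real x * (1 + ln (real x))" .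
  have "\<bar>w * ((\<Sum>e=1..x. b e * S e) - (\<Sum>e=1..x. b e * ((real x)\<^sup>2 / (2 * real (e * M)))))\<bar> 
      \<le> 1 * (2 * real x * (1 + ln (real x)))"
    unfolding abs_mult using w 3 by (intro mult_mono) auto
  thus ?thesis unfolding 1 2 by (simp add: right_diff_distrib)
qed

text \<open>The point is that \<open>K\<close> does not depend on \<open>r\<close>; it stays an
  unevaluated series until \<open>totient_sum_tendsto\<close>.\<close>

lemma totient_sum_tendsto_aux:
  assumes M: "M > 0" "r < M"
  defines "w \<equiv> real (totient (gcd r M)) / real (gcd r M)"
  defines "K \<equiv> (\<Sum>e. of_bool (coprime e M) * moebius_mu e / (real e)\<^sup>2) / (2 * real M)"
  shows "(\<lambda>x. totient_sum M r x / (real x)\<^sup>2) \<longlonglongrightarrow> w * K"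
proof -
  let ?f = "\<lambda>e. of_bool (coprime e M) * moebius_mu e / (real e)\<^sup>2"
  have "summable (\<lambda>n. 1 / (real n)\<^sup>2)" 
    using inverse_power_summable[of 2, where 'a = real] by (simp add: inverse_eq_divide)
  moreover have "norm (?f n) \<le> 1 / (real n)\<^sup>2" for n
  proof -
    have "\<bar>of_bool (coprime n M) * moebius_mu n\<bar> \<le> 1" using abs_moebius_mu_le[of n] by (cases "coprime n M") auto
    thus ?thesis by (simp add: divide_right_mono)
  qed
  ultimately have "summable ?f" by (intro summable_comparison_test'[where N = 0 and f = ?f])
  hence "?f sums (suminf ?f)" by (rule summable_sums)
  hence "(\<lambda>n. \<Sum>e<Suc n. ?f e) \<longlonglongrightarrow> suminf ?f"
    unfolding sums_def by (rule LIMSEQ_Suc)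
  also have "(\<lambda>n. \<Sum>e<Suc n. ?f e) = (\<lambda>n. \<Sum>e=1..n. ?f e)"
    by (intro ext sum.mono_neutral_right) (auto simp: not_less_eq_eq)
  finally have lim: "(\<lambda>n. w * ((\<Sum>e=1..n. ?f e) / (2 * real M))) \<longlonglongrightarrow> w * K"
    unfolding K_def using M by (intro tendsto_mult tendsto_divide tendsto_const) auto
  have "(\<lambda>x. totient_sum M r x / (real x)\<^sup>2 - w * ((\<Sum>e=1..x. ?f e) / (2 * real M))) \<longlonglongrightarrow> 0"
  proof (rule Lim_null_comparison)
    show "(\<lambda>x. 2 * (1 + ln (real x)) / real x) \<longlonglongrightarrow> 0" by real_asymp
    show "eventually (\<lambda>x. norm (totient_sum M r x / (real x)\<^sup>2 - w * ((\<Sum>e=1..x. ?f e) / (2 * real M))) \<le> 2 * (1 + ln (real x)) / real x) sequentially"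
      using eventually_gt_at_top[of 0]
    proof eventually_elim
      case (elim x)
      have "totient_sum M r x / (real x)\<^sup>2 - w * ((\<Sum>e=1..x. ?f e) / (2 * real M)) =
         (totient_sum M r x - w * ((real x)\<^sup>2 / (2 * real M) * (\<Sum>e=1..x. ?f e))) / (real x)\<^sup>2"
        using elim by (simp add: field_simps)
      also have "norm \<dots> \<le> (2 * real x * (1 + ln (real x))) / (real x)\<^sup>2"
        using totient_sum_bound[OF M elim, folded w_def] by (simp add: divide_right_mono)
      also have "\<dots> = 2 * (1 + ln (real x)) / real x" using elim by (simp add: power2_eq_square)
      finally show ?case .
    qed
  qed
  from tendsto_add[OF this lim] show ?thesis by simp
qed

lemma tendsto_div_nat:
  assumes "u > 0"
  shows "(\<lambda>n. real ((a * n + b) div u) / real n) \<longlonglongrightarrow> real a / real u"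
proof (rule tendsto_sandwich)
  show "(\<lambda>n. (real (a * n + b) / real u - 1) / real n) \<longlonglongrightarrow> real a / real u"
    using assms by (real_asymp, simp add: divide_inverse)
  show "(\<lambda>n. (real (a * n + b) / real u) / real n) \<longlonglongrightarrow> real a / real u"
    using assms by (real_asymp, simp add: divide_inverse)
  show "eventually (\<lambda>n. (real (a * n + b) / real u - 1) / real n \<le> real ((a * n + b) div u) / real n) sequentially"
  proof (intro always_eventually allI divide_right_mono)
    fix n
    let ?N = "a * n + b"
    have "?N \<le> u * (?N div u) + u" using mod_less_divisor[OF assms, of ?N] mult_div_mod_eq[of u ?N] by linarith
    hence "real ?N \<le> real u * real (?N div u) + real u" by (metis of_nat_add of_nat_le_iff of_nat_mult)
    thus "real ?N / real u - 1 \<le> real (?N div u)" using assms by (simp add: field_simps)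
  qed simp
  show "eventually (\<lambda>n. real ((a * n + b) div u) / real n \<le> (real (a * n + b) / real u) / real n) sequentially"
    by (intro always_eventually allI divide_right_mono of_nat_div_le_of_nat) auto
qed

lemma filterlim_div_nat:
  assumes "u > 0" "a > 0"
  shows "filterlim (\<lambda>n. (a * n + b) div u) at_top sequentially"
proof (rule filterlim_at_top[THEN iffD2], rule allI)
  fix Z :: nat
  have "Z \<le> (a * n + b) div u" if "n \<ge> Z * u" for n
  proof -
    have "Z * u \<le> a * n + b" using that assms by (metis le_add1 le_trans mult_le_mono1 nat_mult_1 Suc_leI One_nat_def)
    thus ?thesis using assms by (simp add: less_eq_div_iff_mult_less_eq)
  qed
  thus "eventually (\<lambda>n. Z \<le> (a * n + b) div u) sequentially"
    unfolding eventually_sequentially by blast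
qed

lemma tendsto_quadratic_div:
  assumes "(\<lambda>x. f x / (real x)\<^sup>2) \<longlonglongrightarrow> (c :: real)" "u > 0" "a > 0"
  shows "(\<lambda>n. f ((a * n + b) div u) / (real n)\<^sup>2) \<longlonglongrightarrow> c * (real a / real u)\<^sup>2"
proof -
  let ?g = "\<lambda>n. (a * n + b) div u"
  have "(\<lambda>n. f (?g n) / (real (?g n))\<^sup>2 * (real (?g n) / real n)\<^sup>2) \<longlonglongrightarrow> c * (real a / real u)\<^sup>2"
    by (intro tendsto_intros filterlim_compose[OF assms(1)] filterlim_div_nat tendsto_div_nat assms)
  moreover have "eventually (\<lambda>n. f (?g n) / (real (?g n))\<^sup>2 * (real (?g n) / real n)\<^sup>2 = f (?g n) / (real n)\<^sup>2) sequentially"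
    using filterlim_div_nat[OF assms(2,3), of b, unfolded filterlim_at_top, rule_format, of 1]
    by eventually_elim (auto simp: power_divide)
  ultimately show ?thesis by (rule Lim_transform_eventually)
qed

text \<open>The pairs (f, d) with \<open>d * f \<le> x\<close> are regrouped by the product
  \<open>n = d * f\<close>, and the totients of the divisors of \<open>n\<close> add up to
  \<open>n\<close>.\<close>

lemma sum_totient_sum: "(\<Sum>f=1..x. totient_sum 1 0 (x div f)) = real x * (real x + 1) / 2"
proof -
  have "(\<Sum>f=1..x. totient_sum 1 0 (x div f)) = (\<Sum>f=1..x. \<Sum>d=1..x. of_bool (d * f \<le> x) * real (totient d))"
  proof (rule sum.cong[OF refl])
    fix f assume f: "f \<in> {1..x}"
    show "totient_sum 1 0 (x div f) = (\<Sum>d=1..x. of_bool (d * f \<le> x) * real (totient d))"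
      unfolding totient_sum_def using f
      by (intro sum.mono_neutral_cong_left)
        (auto simp: less_eq_div_iff_mult_less_eq,
         metis le_trans mult_le_mono2 mult.right_neutral One_nat_def)
  qed
  also have "\<dots> = (\<Sum>(f, d) | f \<in> {1..x} \<and> d \<in> {1..x} \<and> d * f \<le> x. real (totient d))"
    unfolding sum.cartesian_product by (intro sum.mono_neutral_cong_right) auto
  also have "\<dots> = (\<Sum>(n, d)\<in>(SIGMA n:{1..x}. {d. d dvd n}). real (totient d))"
  proof (rule sum.reindex_bij_witness[of _ "\<lambda>(n, d). (n div d, d)" "\<lambda>(f, d). (d * f, d)"])
    fix p :: "nat \<times> nat" assume "p \<in> (SIGMA n:{1..x}. {d. d dvd n})"
    then obtain n d where p: "p = (n, d)" "n \<ge> 1" "n \<le> x" "d dvd n" by auto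
    hence "d \<ge> 1" "d \<le> n" "d * (n div d) = n" using dvd_imp_le[of d n] by (auto simp: Suc_le_eq intro: dvd_pos_nat)
    thus "(case p of (n, d) \<Rightarrow> (n div d, d)) \<in> {(f, d). f \<in> {1..x} \<and> d \<in> {1..x} \<and> d * f \<le> x}"
      using p by (auto simp: Suc_le_eq div_greater_zero_iff intro: order_trans[OF div_le_dividend])
    show "(case (case p of (n, d) \<Rightarrow> (n div d, d)) of (f, d) \<Rightarrow> (d * f, d)) = p"
      using p by auto
  qed auto
  also have "\<dots> = (\<Sum>n=1..x. real (\<Sum>d | d dvd n. totient d))"
    by (subst sum.Sigma[symmetric]) (auto intro: finite_divisors_nat)
  also have "\<dots> = (\<Sum>n=1..x. real n)" by (simp only: totient_divisor_sum)
  also have "\<dots> = real x * (real x + 1) / 2"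
    by (induction x) (auto simp: field_simps)
  finally show ?thesis .
qed

lemma totient_sum_le_square: "totient_sum M r x \<le> (real x)\<^sup>2"
proof -
  have "totient_sum M r x \<le> (\<Sum>n=1..x. real x)"
    unfolding totient_sum_def by (rule order_trans[OF sum_mono sum_mono2]) (auto intro: order_trans[OF totient_le])
  thus ?thesis by (simp add: power2_eq_square)
qed

text \<open>
  Summing \<open>n = \<Sum>\<^bsub>d | n\<^esub> \<phi>(d)\<close> over \<open>n \<le> x\<close> determines the limit \<open>L\<close> through
  \<open>L \<zeta>(2) = 1/2\<close>.
\<close>

lemma totient_sum_1_tendsto: "(\<lambda>x. totient_sum 1 0 x / (real x)\<^sup>2) \<longlonglongrightarrow> 3 / pi\<^sup>2"
proof -
  obtain L where L: "(\<lambda>x. totient_sum 1 0 x / (real x)\<^sup>2) \<longlonglongrightarrow> L"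
    using totient_sum_tendsto_aux[of 1 0] by auto
  \<comment> \<open>Extending by zero turns the finite sums into series dominated by
    \<open>1 / (k + 1)^2\<close>, so that Tannery's theorem permits the limit termwise.\<close>
  define a where "a = (\<lambda>k n. if k < n then totient_sum 1 0 (n div Suc k) / (real n)\<^sup>2 else 0)"
  have "((\<lambda>n. suminf (\<lambda>k. a k n)) \<longlonglongrightarrow> (\<Sum>k. L * (1 / real (Suc k))\<^sup>2))"
  proof (rule tannerys_theorem[THEN conjunct2, THEN conjunct2])
    fix k
    have "(\<lambda>n. totient_sum 1 0 ((1 * n + 0) div Suc k) / (real n)\<^sup>2) \<longlonglongrightarrow> L * (real 1 / real (Suc k))\<^sup>2"
      by (rule tendsto_quadratic_div[OF L]) auto
    moreover have "eventually (\<lambda>n. totient_sum 1 0 ((1 * n + 0) div Suc k) / (real n)\<^sup>2 = a k n) sequentially"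
      using eventually_gt_at_top[of k] by eventually_elim (auto simp: a_def)
    ultimately show "a k \<longlonglongrightarrow> L * (1 / real (Suc k))\<^sup>2"
      by (simp add: Lim_transform_eventually)
  next
    have "norm (a k n) \<le> 1 / (real k + 1)\<^sup>2" for k n
    proof (cases "k < n")
      case True
      have "0 \<le> totient_sum 1 0 (n div Suc k)" by (simp add: totient_sum_def sum_nonneg)
      hence "norm (a k n) = totient_sum 1 0 (n div Suc k) / (real n)\<^sup>2" using True by (simp add: a_def)
      also have "\<dots> \<le> (real (n div Suc k))\<^sup>2 / (real n)\<^sup>2"
        by (intro divide_right_mono totient_sum_le_square) auto
      also have "\<dots> \<le> (real n / real (Suc k))\<^sup>2 / (real n)\<^sup>2"
        by (intro divide_right_mono power_mono of_nat_div_le_of_nat) auto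
      also have "\<dots> = 1 / (real k + 1)\<^sup>2" using True by (simp add: power_divide add.commute)
      finally show ?thesis .
    qed (simp add: a_def)
    thus "eventually (\<lambda>(k, n). norm (a k n) \<le> 1 / (real k + 1)\<^sup>2) (at_top \<times>\<^sub>F sequentially)"
      by (intro always_eventually) auto
    show "summable (\<lambda>k. 1 / (real k + 1)\<^sup>2)" using sums_summable[OF inverse_squares_sums] by (simp add: add.commute)
  qed auto
  also have "(\<lambda>n. suminf (\<lambda>k. a k n)) = (\<lambda>n. (\<Sum>f=1..n. totient_sum 1 0 (n div f)) / (real n)\<^sup>2)"
  proof
    fix n
    have "suminf (\<lambda>k. a k n) = (\<Sum>k<n. a k n)"
      by (rule suminf_finite) (auto simp: a_def)
    also have "\<dots> = (\<Sum>f=1..n. totient_sum 1 0 (n div f) / (real n)\<^sup>2)"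
      by (rule sum.reindex_bij_witness[of _ "\<lambda>f. f - 1" Suc]) (auto simp: a_def)
    finally show "suminf (\<lambda>k. a k n) = (\<Sum>f=1..n. totient_sum 1 0 (n div f)) / (real n)\<^sup>2"
      by (simp add: sum_divide_distrib)
  qed
  also have "(\<Sum>k. L * (1 / real (Suc k))\<^sup>2) = L * (pi\<^sup>2 / 6)"
    using inverse_squares_sums by (subst suminf_mult) (auto simp: sums_iff power_divide add.commute)
  finally have "(\<lambda>n. real n * (real n + 1) / 2 / (real n)\<^sup>2) \<longlonglongrightarrow> L * (pi\<^sup>2 / 6)"
    by (simp only: sum_totient_sum)
  moreover have "(\<lambda>n. real n * (real n + 1) / 2 / (real n)\<^sup>2) \<longlonglongrightarrow> 1 / 2" by real_asymp
  ultimately have "L * (pi\<^sup>2 / 6) = 1 / 2" by (rule LIMSEQ_unique)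
  hence "L = 3 / pi\<^sup>2" by (simp add: field_simps)
  with L show ?thesis by simp
qed

text \<open>Summing over all \<open>r < M\<close> recovers the full totient sum, whose known limit
  determines the common factor \<open>K\<close>.\<close>

theorem totient_sum_tendsto:
  assumes M: "M > 0" "r < M"
  defines "w \<equiv> (\<lambda>r. real (totient (gcd r M)) / real (gcd r M))"
  shows "(\<lambda>x. totient_sum M r x / (real x)\<^sup>2) \<longlonglongrightarrow> 3 / pi\<^sup>2 * (w r / (\<Sum>r<M. w r))"
proof -
  obtain K where K: "\<And>r. r < M \<Longrightarrow> (\<lambda>x. totient_sum M r x / (real x)\<^sup>2) \<longlonglongrightarrow> w r * K"
    using totient_sum_tendsto_aux[OF M(1)] unfolding w_def by meson
  have "(\<lambda>x. \<Sum>r<M. totient_sum M r x / (real x)\<^sup>2) \<longlonglongrightarrow> (\<Sum>r<M. w r * K)"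
    by (intro tendsto_sum K) auto
  moreover have "(\<Sum>r<M. totient_sum M r x / (real x)\<^sup>2) = totient_sum 1 0 x / (real x)\<^sup>2" for x
  proof -
    have "(\<Sum>r<M. totient_sum M r x) = (\<Sum>r<M. \<Sum>n | n \<in> {1..x} \<and> n mod M = r. real (totient n))"
      by (simp add: totient_sum_def)
    also have "\<dots> = totient_sum 1 0 x"
      unfolding totient_sum_def using M sum.group[of "{1..x}" "{..<M}" "\<lambda>n. n mod M" "\<lambda>n. real (totient n)"]
      by (auto simp: image_subset_iff intro!: sum.cong)
    finally show ?thesis by (simp add: sum_divide_distrib[symmetric])
  qed
  ultimately have "(\<Sum>r<M. w r) * K = 3 / pi\<^sup>2"
    using totient_sum_1_tendsto LIMSEQ_unique by (fastforce simp: sum_distrib_right)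
  moreover have "(\<Sum>r<M. w r) > 0" using M by (intro sum_pos) (auto simp: w_def)
  ultimately have "K = 3 / pi\<^sup>2 / (\<Sum>r<M. w r)" by (simp add: field_simps)
  thus ?thesis using K[OF M(2)] by (simp add: mult.commute)
qed

section \<open>Prime divisors of Fibonacci numbers\<close>
text \<open>Writing F_{k-1} as F_{k+1} - F_k over the integers avoids the index \<open>k - 1\<close>
  and includes \<open>k = 0\<close>.\<close>

lemma fib_add_int:
  "int (fib (n + k)) = int (fib k) * int (fib (Suc n)) + int (fib (Suc k)) * int (fib n) - int (fib k) * int (fib n)"
proof (cases k)
  case (Suc j)
  have "fib (n + k) = fib k * fib (Suc n) + fib j * fib n" using fib_add[of n j] Suc by simp
  moreover have "fib (Suc k) = fib k + fib j" using Suc by simp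
  ultimately show ?thesis by (simp add: algebra_simps)
qed auto

lemma fib_add_Suc_int:
  "int (fib (Suc (n + k))) = int (fib (Suc k)) * int (fib (Suc n)) + int (fib k) * int (fib n)"
  using fib_add[of n k] by simp

text \<open>Read from right to left it replaces \<open>(-1) ^ m\<close> by a polynomial in F_m and
  F_{m+1}, so that the doubling and tripling formulas become ring identities.\<close>

lemma fib_cassini:
  "int (fib (Suc n)) ^ 2 - int (fib n) * int (fib (Suc n)) - int (fib n) ^ 2 = (-1) ^ n"
proof (induction n)
  case (Suc n)
  have *: "(y + x) ^ 2 - y * (y + x) - y ^ 2 = - (y ^ 2 - x * y - x ^ 2)" for x y :: int
    by (simp add: power2_eq_square algebra_simps)
  have 1: "int (fib (Suc (Suc n))) = int (fib (Suc n)) + int (fib n)" by simp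
  show ?case unfolding 1 * Suc by simp
qed simp

lemma lucas_eq_fib: "lucas n = 2 * int (fib (Suc n)) - int (fib n)"
  by (induction n rule: lucas.induct) auto

lemma fib_double: "int (fib (2 * m)) = int (fib m) * lucas m"
  unfolding mult_2 fib_add_int[of m m] lucas_eq_fib[of m] by (simp only: algebra_simps)

lemma fib_double_Suc: "int (fib (Suc (2 * m))) = int (fib m) ^ 2 + int (fib (Suc m)) ^ 2"
  using fib_add_Suc_int[of m m] by (simp add: mult_2 power2_eq_square)

lemma lucas_double: "lucas (2 * m) = lucas m ^ 2 - 2 * (-1) ^ m"
  unfolding fib_cassini[symmetric] lucas_eq_fib[of "2 * m"] fib_double fib_double_Suc lucas_eq_fib[of m]
  by (simp add: power2_eq_square algebra_simps)

lemma fib_triple: "int (fib (3 * m)) = int (fib m) * (lucas (2 * m) + (-1) ^ m)"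
proof -
  have "int (fib (3 * m)) = int (fib (2 * m + m))" by (simp add: algebra_simps)
  thus ?thesis
    unfolding fib_cassini[symmetric] lucas_eq_fib[of "2 * m"] fib_add_int[of "2 * m" m] fib_double fib_double_Suc lucas_eq_fib[of m]
    by (simp add: power2_eq_square algebra_simps)
qed

lemma lucas_triple: "lucas (3 * m) = lucas m * (lucas (2 * m) - (-1) ^ m)"
proof -
  have *: "int (fib (3 * m)) = int (fib (2 * m + m))" "int (fib (Suc (3 * m))) = int (fib (Suc (2 * m + m)))"
    by (simp_all add: algebra_simps)
  show ?thesis
    unfolding lucas_eq_fib[of "3 * m"] * 
    unfolding fib_cassini[symmetric] lucas_eq_fib[of "2 * m"] fib_add_int[of "2 * m" m] fib_add_Suc_int[of "2 * m" m]
      fib_double fib_double_Suc lucas_eq_fib[of m]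
    by (simp add: power2_eq_square algebra_simps)
qed

lemma lucas_odd:
  "lucas (Suc (2 * m)) + (-1) ^ m = lucas m * lucas (Suc m)"
  "lucas (Suc (2 * m)) - (-1) ^ m = 5 * int (fib m) * int (fib (Suc m))"
proof -
  have 1: "int (fib (Suc (Suc k))) = int (fib (Suc k)) + int (fib k)" for k by simp
  show "lucas (Suc (2 * m)) + (-1) ^ m = lucas m * lucas (Suc m)"
    "lucas (Suc (2 * m)) - (-1) ^ m = 5 * int (fib m) * int (fib (Suc m))"
    unfolding fib_cassini[symmetric] lucas_eq_fib[of "Suc (2 * m)"] 1 fib_double fib_double_Suc
      lucas_eq_fib[of m] lucas_eq_fib[of "Suc m"]
    by (simp_all only: power2_eq_square algebra_simps)
qed

text \<open>The primes whose rank of apparition is \<open>d\<close>. For \<open>d = 0\<close> these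
  would be all primes, whence the positivity assumptions below.\<close>

definition prim_primes :: "nat \<Rightarrow> nat set" where
  "prim_primes d = {p. prime p \<and> p dvd fib d \<and> (\<forall>m. 0 < m \<and> m < d \<longrightarrow> \<not> p dvd fib m)}"

lemma fib_dvd_fib: "m dvd n \<Longrightarrow> fib m dvd fib n"
proof -
  assume "m dvd n"
  hence "gcd m n = m" by (simp add: gcd_nat.absorb1)
  thus ?thesis using fib_gcd[of m n] gcd_dvd2[of "fib m" "fib n"] by simp
qed

text \<open>The gcd of F_d and F_n is the Fibonacci number of index \<open>gcd d n\<close>, and
  minimality of \<open>d\<close> forces that index to be \<open>d\<close>.\<close>

lemma prim_primes_dvd_fib_iff:
  assumes "p \<in> prim_primes d" "d > 0"
  shows "p dvd fib n \<longleftrightarrow> d dvd n"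
proof
  assume "p dvd fib n"
  hence "p dvd fib (gcd d n)" using assms by (simp add: fib_gcd prim_primes_def)
  moreover have "gcd d n > 0" "gcd d n \<le> d" using assms by (auto intro: gcd_le1_nat)
  moreover have "\<not> p dvd fib m" if "0 < m" "m < d" for m using assms(1) that unfolding prim_primes_def by blast
  ultimately have "gcd d n = d" using le_neq_implies_less by blast
  thus "d dvd n" by (metis gcd_dvd2)
next
  assume "d dvd n"
  hence "fib d dvd fib n" by (rule fib_dvd_fib)
  thus "p dvd fib n" using assms unfolding prim_primes_def by (auto intro: dvd_trans)
qed

lemma prim_primes_exists:
  assumes "prime p" "p dvd fib n" "n > 0"
  shows "\<exists>d>0. p \<in> prim_primes d"
proof -
  define d where "d = (LEAST d. 0 < d \<and> p dvd fib d)"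
  have "0 < d \<and> p dvd fib d" unfolding d_def by (rule LeastI[of "\<lambda>d. 0 < d \<and> p dvd fib d" n]) (use assms in simp)
  moreover have "\<not> (0 < m \<and> p dvd fib m)" if "m < d" for m
    using not_less_Least[of m] that unfolding d_def by blast
  ultimately have "p \<in> prim_primes d" using assms(1) unfolding prim_primes_def by blast
  with \<open>0 < d \<and> p dvd fib d\<close> show ?thesis by blast
qed

lemma prim_primes_unique:
  assumes "p \<in> prim_primes d" "p \<in> prim_primes e" "d > 0" "e > 0"
  shows "d = e"
  using assms unfolding prim_primes_def by (cases d e rule: linorder_cases) blast+

lemma finite_prim_primes: "d > 0 \<Longrightarrow> finite (prim_primes d)"
  by (rule finite_subset[of _ "prime_factors (fib d)"])
    (auto simp: prim_primes_def in_prime_factors_iff dest: fib_neq_0_nat)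

section \<open>Lifting the exponent for Fibonacci numbers\<close>

text \<open>The binomial expansion of the powers of the Fibonacci matrix, modulo the cube of \<^term>\<open>fib m\<close>.\<close>

lemma fib_mult_expansion:
  fixes m n :: nat
  defines "x \<equiv> int (fib m)" and "y \<equiv> int (fib (Suc m))"
  shows "x ^ 2 dvd int (fib (Suc (m * n))) - y ^ n"
    and "x ^ 3 dvd y ^ 2 * int (fib (m * n)) - int n * x * y ^ (n + 1) + int (n choose 2) * x ^ 2 * y ^ n"
proof (induction n)
  case 0
  case 1 show ?case by simp
  case 2 show ?case by (simp add: binomial_eq_0)
next
  case (Suc n)
  define X where "X = int (fib (m * n))"
  define Z where "Z = int (fib (Suc (m * n)))"
  have X': "int (fib (m * Suc n)) = x * Z + y * X - x * X"
    using fib_add_int[of "m * n" m] by (simp add: X_def Z_def x_def y_def add.commute)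
  have Z': "int (fib (Suc (m * Suc n))) = y * Z + x * X"
    using fib_add_Suc_int[of "m * n" m] by (simp add: X_def Z_def x_def y_def add.commute)
  have xX: "x dvd X" unfolding X_def x_def by (simp add: fib_dvd_fib)
  obtain a where a: "X = x * a" using xX by blast
  obtain b where "Z - y ^ n = x ^ 2 * b" using Suc(1) unfolding Z_def by (elim dvdE)
  hence b: "Z = y ^ n + x ^ 2 * b" by simp
  obtain c where "y ^ 2 * X - int n * x * y ^ (n + 1) + int (n choose 2) * x ^ 2 * y ^ n = x ^ 3 * c"
    using Suc(2) unfolding X_def by (elim dvdE)
  hence c: "y ^ 2 * X = int n * x * y ^ (n + 1) - int (n choose 2) * x ^ 2 * y ^ n + x ^ 3 * c" by simp
  case 1
  have "int (fib (Suc (m * Suc n))) - y ^ Suc n = x ^ 2 * (y * b + a)"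
    unfolding Z' a b by (simp add: algebra_simps power2_eq_square)
  thus ?case by simp
  case 2
  have ch: "int (Suc n choose 2) = int n + int (n choose 2)" by (simp add: numeral_2_eq_2)
  \<comment> \<open>The factor \<open>y ^ 2\<close> clears the exponents n-1 and n-2 that
    \<open>y\<close> has in the binomial expansion, which would be negative for small
    \<open>n\<close>.\<close>
  have "y ^ 2 * (x * Z + y * X - x * X) = x * y ^ 2 * Z + y * (y ^ 2 * X) - x * (y ^ 2 * X)"
    by (simp add: algebra_simps)
  also have "\<dots> - int (Suc n) * x * y ^ (Suc n + 1) + int (Suc n choose 2) * x ^ 2 * y ^ Suc n =
     x ^ 3 * (y ^ 2 * b + y * c + int (n choose 2) * y ^ n - x * c)"
    unfolding b c ch by (simp add: algebra_simps power2_eq_square power3_eq_cube)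
  finally show ?case unfolding X' by simp
qed

text \<open>These are the 12 pairs of consecutive residues in one period of the Lucas numbers modulo
  8; no entry is 0.\<close>

lemma lucas_mod_8:
  "(lucas n mod 8, lucas (Suc n) mod 8) \<in> {(2, 1), (1, 3), (3, 4), (4, 7), (7, 3), (3, 2),
     (2, 5), (5, 7), (7, 4), (4, 3), (3, 7), (7, 2)}"
proof (induction n)
  case (Suc n)
  define a b c where "a = lucas n mod 8" and "b = lucas (Suc n) mod 8" and "c = lucas (Suc (Suc n)) mod 8"
  have c: "c = (b + a) mod 8"
    unfolding a_def b_def c_def by (simp add: mod_add_eq)
  from Suc have "(a, b) \<in> {(2, 1), (1, 3), (3, 4), (4, 7), (7, 3), (3, 2),
     (2, 5), (5, 7), (7, 4), (4, 3), (3, 7), (7, 2)}" unfolding a_def b_def .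
  hence "(b, c) \<in> {(2, 1), (1, 3), (3, 4), (4, 7), (7, 3), (3, 2),
     (2, 5), (5, 7), (7, 4), (4, 3), (3, 7), (7, 2)}" by (elim insertE emptyE) (simp_all add: c)
  thus ?case unfolding b_def c_def .
qed simp

lemma lucas_not_dvd_8: "\<not> 8 dvd lucas n"
proof
  assume "8 dvd lucas n"
  hence "lucas n mod 8 = 0" by (rule dvd_imp_mod_0)
  thus False using lucas_mod_8[of n] by simp
qed

lemma prime_not_dvd_fib_Suc:
  assumes "prime p" "p dvd fib m"
  shows "\<not> int p dvd int (fib (Suc m))"
proof
  assume "int p dvd int (fib (Suc m))"
  hence "p dvd fib (Suc m)" by (rule int_dvd_int_iff[THEN iffD1])
  hence "p dvd 1" by (rule coprime_common_divisor[OF coprime_fib_Suc_nat assms(2)])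
  thus False using assms(1) not_prime_unit by blast
qed

text \<open>With c = F_{mn} / F_m and y = F_{m+1}, the expansion gives y^2 c = n y^(n+1) modulo
  \<open>p\<close>, where \<open>p\<close> divides neither \<open>n\<close> nor y.\<close>

lemma multiplicity_fib_mult_coprime:
  assumes p: "prime p" "p dvd fib m" and "\<not> p dvd n" and n: "n > 0" "m > 0"
  shows "multiplicity p (fib (m * n)) = multiplicity p (fib m)"
proof -
  obtain c where c: "fib (m * n) = fib m * c" using fib_dvd_fib[OF dvd_triv_left] by (rule dvdE)
  have pos: "fib m > 0" "c > 0" using fib_neq_0_nat[of m] fib_neq_0_nat[of "m * n"] n c by auto
  have "int (fib m) ^ 3 dvd int (fib (Suc m)) ^ 2 * int (fib (m * n)) - int n * int (fib m) * int (fib (Suc m)) ^ (n + 1)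
     + int (n choose 2) * int (fib m) ^ 2 * int (fib (Suc m)) ^ n" by (rule fib_mult_expansion)
  hence "int (fib m) * int (fib m) ^ 2 dvd int (fib m) * (int (fib (Suc m)) ^ 2 * int c - int n * int (fib (Suc m)) ^ (n + 1)
     + int (n choose 2) * int (fib m) * int (fib (Suc m)) ^ n)"
    by (simp add: c algebra_simps power2_eq_square power3_eq_cube)
  hence "int (fib m) ^ 2 dvd (int (fib (Suc m)) ^ 2 * int c - int n * int (fib (Suc m)) ^ (n + 1)
     + int (n choose 2) * int (fib m) * int (fib (Suc m)) ^ n)" using pos by (simp only: dvd_mult_cancel_left) simp
  moreover have "int p dvd int (fib m) ^ 2" "int p dvd int (n choose 2) * int (fib m) * int (fib (Suc m)) ^ n"
    using p by (auto simp: power2_eq_square)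
  ultimately have d: "int p dvd int (fib (Suc m)) ^ 2 * int c - int n * int (fib (Suc m)) ^ (n + 1)"
    by (meson dvd_add_left_iff dvd_trans)
  have "\<not> p dvd c"
  proof
    assume "p dvd c"
    hence "int p dvd int (fib (Suc m)) ^ 2 * int c" by auto
    with d have "int p dvd int n * int (fib (Suc m)) ^ (n + 1)" by (metis dvd_diff_right_iff)
    moreover have pi: "prime (int p)" using p(1) by simp
    ultimately have "int p dvd int n \<or> int p dvd int (fib (Suc m))"
      using prime_dvd_power[OF pi] prime_dvd_multD[OF pi] by blast
    thus False using prime_not_dvd_fib_Suc[OF p] assms(3) by simp
  qed
  thus ?thesis unfolding c using p pos by (simp add: prime_elem_multiplicity_mult_distrib not_dvd_imp_multiplicity_0)
qed

text \<open>For odd \<open>p\<close>, \<open>p\<close> divides \<open>p choose 2\<close>, so the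
  quotient is congruent to \<open>p\<close> times a unit modulo p^2. For \<open>p = 2\<close> the
  quotient is L_m, not divisible by 8; here the increase 2 does occur, from F_3 = 2 to F_6 =
  8.\<close>

lemma multiplicity_fib_mult_prime:
  assumes p: "prime p" "p dvd fib m" and m: "m > 0"
  shows "multiplicity p (fib (m * p)) \<le> multiplicity p (fib m) + 2"
proof -
  obtain c where c: "fib (m * p) = fib m * c" using fib_dvd_fib[OF dvd_triv_left] by (rule dvdE)
  have pos: "fib m > 0" "c > 0" using fib_neq_0_nat[of m] fib_neq_0_nat[of "m * p"] m c prime_gt_0_nat[OF p(1)] by auto
  have "\<not> p ^ 3 dvd c"
  proof (cases "p = 2")
    case True
    have "int (fib m) * int c = int (fib m) * lucas m"
      using c fib_double[of m] True by (simp add: mult.commute)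
    hence "int c = lucas m" using pos by simp
    hence "\<not> int 8 dvd int c" using lucas_not_dvd_8[of m] by simp
    hence "\<not> 8 dvd c" by (subst (asm) int_dvd_int_iff)
    thus ?thesis using True by simp
  next
    case False
    hence "p > 2" using prime_ge_2_nat[OF p(1)] by simp
    hence "odd p" using p(1) prime_odd_nat by blast
    then obtain k where "p = 2 * k + 1" by (elim oddE)
    hence "p choose 2 = p * k" by (simp add: choose_two)
    hence pc: "p dvd (p choose 2)" by simp
    have "int (fib m) ^ 3 dvd int (fib (Suc m)) ^ 2 * int (fib (m * p)) - int p * int (fib m) * int (fib (Suc m)) ^ (p + 1)
       + int (p choose 2) * int (fib m) ^ 2 * int (fib (Suc m)) ^ p" by (rule fib_mult_expansion)
    hence "int (fib m) * int (fib m) ^ 2 dvd int (fib m) * (int (fib (Suc m)) ^ 2 * int c - int p * int (fib (Suc m)) ^ (p + 1)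
       + int (p choose 2) * int (fib m) * int (fib (Suc m)) ^ p)"
      by (simp add: c algebra_simps power2_eq_square power3_eq_cube)
    hence "int (fib m) ^ 2 dvd (int (fib (Suc m)) ^ 2 * int c - int p * int (fib (Suc m)) ^ (p + 1)
       + int (p choose 2) * int (fib m) * int (fib (Suc m)) ^ p)" using pos by (simp only: dvd_mult_cancel_left) simp
    moreover have "int p ^ 2 dvd int (fib m) ^ 2" using p(2) by (intro dvd_power_same) simp
    moreover have "int p ^ 2 dvd int (p choose 2) * int (fib m) * int (fib (Suc m)) ^ p"
      unfolding power2_eq_square using pc p(2) by (intro dvd_mult2 mult_dvd_mono) auto
    ultimately have d: "int p ^ 2 dvd int (fib (Suc m)) ^ 2 * int c - int p * int (fib (Suc m)) ^ (p + 1)"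
      by (meson dvd_add_left_iff dvd_trans)
    show ?thesis
    proof
      assume "p ^ 3 dvd c"
      hence "p ^ 2 dvd c" by (rule dvd_trans[rotated]) (simp add: le_imp_power_dvd)
      hence "int p ^ 2 dvd int (fib (Suc m)) ^ 2 * int c" by (metis dvd_mult int_dvd_int_iff of_nat_power)
      with d have "int p ^ 2 dvd int p * int (fib (Suc m)) ^ (p + 1)" by (metis dvd_diff_right_iff)
      hence "int p dvd int (fib (Suc m)) ^ (p + 1)" using p(1) by (simp add: power2_eq_square prime_gt_0_nat)
      thus False using prime_not_dvd_fib_Suc[OF p] p(1) by (meson prime_dvd_power prime_nat_int_transfer)
    qed
  qed
  have "multiplicity p c < 3"
  proof (rule ccontr)
    assume "\<not> multiplicity p c < 3"
    hence "3 \<le> multiplicity p c" by (simp only: not_less)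
    hence "p ^ 3 dvd c" by (rule multiplicity_dvd')
    with \<open>\<not> p ^ 3 dvd c\<close> show False by (rule notE)
  qed
  moreover have "multiplicity p (fib m * c) = multiplicity p (fib m) + multiplicity p c"
    using p(1) pos by (intro prime_elem_multiplicity_mult_distrib) auto
  ultimately show ?thesis unfolding c by linarith
qed

lemma multiplicity_fib_mult:
  assumes p: "prime p" "p dvd fib m" and "n > 0" "m > 0"
  shows "multiplicity p (fib (m * n)) \<le> multiplicity p (fib m) + 2 * multiplicity p n"
  using assms(3)
proof (induction n rule: less_induct)
  case (less n)
  show ?case
  proof (cases "p dvd n")
    case False
    thus ?thesis using multiplicity_fib_mult_coprime[OF p False] less assms by simp
  next
    case True
    then obtain k where k: "n = p * k" by blast
    have k0: "k > 0" "k < n" using less.prems k prime_gt_1_nat[OF p(1)] by auto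
    have "fib m dvd fib (m * k)" by (simp add: fib_dvd_fib)
    hence "p dvd fib (m * k)" using p(2) dvd_trans by blast
    hence "multiplicity p (fib (m * k * p)) \<le> multiplicity p (fib (m * k)) + 2"
      using assms k0 by (intro multiplicity_fib_mult_prime) auto
    also have "\<dots> \<le> multiplicity p (fib m) + 2 * multiplicity p k + 2" using less.IH[OF k0(2) k0(1)] by simp
    also have "\<dots> = multiplicity p (fib m) + 2 * multiplicity p n"
      using k0 p(1) by (simp add: k prime_elem_multiplicity_mult_distrib prime_gt_0_nat)
    finally show ?thesis by (simp add: k mult_ac)
  qed
qed

section \<open>Primitive parts of Fibonacci numbers\<close>
definition log_prim :: "nat \<Rightarrow> real" where
  "log_prim d = (\<Sum>p\<in>prim_primes d. real (multiplicity p (fib d)) * ln (real p))"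

lemma ln_eq_sum_prime_factors:
  assumes "n > 0"
  shows "ln (real n) = (\<Sum>p\<in>prime_factors n. real (multiplicity p n) * ln (real p))"
proof -
  have "real n = (\<Prod>p\<in>prime_factors n. real p ^ multiplicity p n)"
    using prod_prime_factors[of n] assms by (simp flip: of_nat_power of_nat_prod)
  hence "ln (real n) = ln (\<Prod>p\<in>prime_factors n. real p ^ multiplicity p n)" by (rule arg_cong)
  also have "\<dots> = (\<Sum>p\<in>prime_factors n. ln (real p ^ multiplicity p n))"
    by (rule ln_prod) (auto dest!: in_prime_factors_imp_prime prime_gt_0_nat)
  finally show ?thesis by (simp add: ln_realpow)
qed

lemma sum_multiplicity_le_ln:
  assumes "n > 0" "finite P" "\<And>p. p \<in> P \<Longrightarrow> prime p"
  shows "(\<Sum>p\<in>P. real (multiplicity p n) * ln (real p)) \<le> ln (real n)"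
proof -
  have "(\<Sum>p\<in>P. real (multiplicity p n) * ln (real p)) =
      (\<Sum>p\<in>P \<inter> prime_factors n. real (multiplicity p n) * ln (real p))"
    using assms by (intro sum.mono_neutral_right) (auto simp: prime_factors_multiplicity)
  also have "\<dots> \<le> (\<Sum>p\<in>prime_factors n. real (multiplicity p n) * ln (real p))"
    by (intro sum_mono2) (auto dest!: in_prime_factors_imp_prime prime_ge_1_nat)
  finally show ?thesis using ln_eq_sum_prime_factors[OF assms(1)] by simp
qed

text \<open>The prime factors of F_n are grouped by their rank, a divisor \<open>d\<close> of
  \<open>n\<close>. The multiplicities in F_n and F_d differ by at most twice the multiplicity in
  \<open>n\<close>, and these excesses total at most \<open>2 * ln n\<close>.\<close>

lemma sum_log_prim_divisors:
  assumes "n > 0"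
  shows "(\<Sum>d | d dvd n. log_prim d) \<le> ln (real (fib n))"
    and "ln (real (fib n)) \<le> (\<Sum>d | d dvd n. log_prim d) + 2 * ln (real n)"
proof -
  have fin: "finite {d. d dvd n}" using assms by simp
  have pos: "d > 0" if "d dvd n" for d using that assms by (auto intro: dvd_pos_nat)
  have fpos: "fib n > 0" using assms fib_neq_0_nat by simp
  let ?U = "\<Union>d\<in>{d. d dvd n}. prim_primes d"
  have U: "prime_factors (fib n) = ?U"
  proof (intro equalityI subsetI)
    fix p assume "p \<in> prime_factors (fib n)"
    hence p: "prime p" "p dvd fib n" by auto
    then obtain d where d: "d > 0" "p \<in> prim_primes d" using prim_primes_exists assms by blast
    with p have "d dvd n" using prim_primes_dvd_fib_iff by blast
    with d show "p \<in> ?U" by blast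
  next
    fix p assume "p \<in> ?U"
    then obtain d where d: "d dvd n" "p \<in> prim_primes d" by blast
    hence "p dvd fib n" using prim_primes_dvd_fib_iff[OF d(2) pos] by blast
    thus "p \<in> prime_factors (fib n)" using d(2) fpos by (simp add: in_prime_factors_iff prim_primes_def)
  qed
  have sumU: "(\<Sum>p\<in>?U. f p) = (\<Sum>d | d dvd n. \<Sum>p\<in>prim_primes d. f p)" for f :: "nat \<Rightarrow> real"
    using fin pos finite_prim_primes prim_primes_unique
    by (intro sum.UNION_disjoint) blast+
  have ln: "ln (real (fib n)) = (\<Sum>d | d dvd n. \<Sum>p\<in>prim_primes d. real (multiplicity p (fib n)) * ln (real p))"
    using ln_eq_sum_prime_factors[OF fpos] unfolding U sumU .
  show "(\<Sum>d | d dvd n. log_prim d) \<le> ln (real (fib n))"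
    unfolding ln log_prim_def
  proof (intro sum_mono mult_right_mono)
    fix d p assume d: "d \<in> {d. d dvd n}" "p \<in> prim_primes d"
    have "fib d dvd fib n" using d fib_dvd_fib by simp
    thus "real (multiplicity p (fib d)) \<le> real (multiplicity p (fib n))"
      using fpos by (simp add: dvd_imp_multiplicity_le)
    show "0 \<le> ln (real p)" using d(2) by (auto simp: prim_primes_def dest: prime_ge_1_nat)
  qed
  have "ln (real (fib n)) \<le> (\<Sum>d | d dvd n. \<Sum>p\<in>prim_primes d.
      real (multiplicity p (fib d)) * ln (real p) + 2 * (real (multiplicity p n) * ln (real p)))"
    unfolding ln
  proof (intro sum_mono)
    fix d p assume d: "d \<in> {d. d dvd n}" "p \<in> prim_primes d"
    then obtain k where k: "n = d * k" by auto
    have p: "prime p" "p dvd fib d" using d(2) by (auto simp: prim_primes_def)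
    have kd: "k > 0" "d > 0" using assms k by auto
    have "multiplicity p (fib n) \<le> multiplicity p (fib d) + 2 * multiplicity p k"
      using multiplicity_fib_mult[OF p kd] k by simp
    also have "multiplicity p k \<le> multiplicity p n"
      using k assms by (intro dvd_imp_multiplicity_le) auto
    finally have "real (multiplicity p (fib n)) \<le> real (multiplicity p (fib d)) + 2 * real (multiplicity p n)" by linarith
    hence "real (multiplicity p (fib n)) * ln (real p) \<le> (real (multiplicity p (fib d)) + 2 * real (multiplicity p n)) * ln (real p)"
      using p prime_ge_1_nat by (intro mult_right_mono) auto
    thus "real (multiplicity p (fib n)) * ln (real p) \<le>
       real (multiplicity p (fib d)) * ln (real p) + 2 * (real (multiplicity p n) * ln (real p))"
      by (simp add: algebra_simps)
  qed
  also have "\<dots> = (\<Sum>d | d dvd n. log_prim d) + 2 * (\<Sum>p\<in>?U. real (multiplicity p n) * ln (real p))"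
    unfolding sumU log_prim_def by (simp add: sum.distrib sum_distrib_left)
  also have "(\<Sum>p\<in>?U. real (multiplicity p n) * ln (real p)) \<le> ln (real n)"
    unfolding U[symmetric] by (rule sum_multiplicity_le_ln) (use assms in auto)
  finally show "ln (real (fib n)) \<le> (\<Sum>d | d dvd n. log_prim d) + 2 * ln (real n)" by simp
qed

section \<open>The size of Fibonacci numbers and of their primitive parts\<close>

lemma golden_ratio_gt_1: "golden_ratio > 1"
proof -
  have "sqrt 1 < sqrt 5" by (subst real_sqrt_less_iff) simp
  thus ?thesis by (simp add: golden_ratio_def)
qed

lemma golden_ratio_square: "golden_ratio\<^sup>2 = golden_ratio + 1"
proof -
  have "(1 + sqrt 5)\<^sup>2 = 6 + 2 * sqrt 5" by (simp add: power2_sum)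
  thus ?thesis by (simp add: golden_ratio_def power_divide field_simps)
qed

text \<open>Each estimate is stated at two consecutive indices so that the second-order recurrence
  carries the induction.\<close>

lemma golden_ratio_power_fib:
  "real (fib n) \<le> golden_ratio ^ n \<and> real (fib (Suc n)) \<le> golden_ratio ^ Suc n \<and>
   golden_ratio ^ Suc n \<le> golden_ratio\<^sup>2 * real (fib (Suc n)) \<and>
   golden_ratio ^ Suc (Suc n) \<le> golden_ratio\<^sup>2 * real (fib (Suc (Suc n)))"
proof (induction n)
  case 0
  show ?case using golden_ratio_gt_1 by (simp add: power2_eq_square)
next
  case (Suc n)
  have rec: "golden_ratio ^ Suc (Suc k) = golden_ratio ^ Suc k + golden_ratio ^ k" for k
  proof -
    have "golden_ratio ^ Suc (Suc k) = golden_ratio\<^sup>2 * golden_ratio ^ k" by (simp add: power2_eq_square)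
    also have "\<dots> = golden_ratio ^ Suc k + golden_ratio ^ k"
      unfolding golden_ratio_square by (simp add: algebra_simps)
    finally show ?thesis .
  qed
  have f: "real (fib (Suc (Suc k))) = real (fib (Suc k)) + real (fib k)" for k by simp
  show ?case
  proof (intro conjI)
    show "real (fib (Suc (Suc n))) \<le> golden_ratio ^ Suc (Suc n)"
      unfolding rec[of n] f[of n] using Suc by linarith
    show "golden_ratio ^ Suc (Suc (Suc n)) \<le> golden_ratio\<^sup>2 * real (fib (Suc (Suc (Suc n))))"
      unfolding rec[of "Suc n"] f[of "Suc n"] distrib_left using Suc by linarith
  qed (use Suc in auto)
qed

lemma ln_golden_ratio: "0 < ln golden_ratio" "ln golden_ratio \<le> 1"
proof -
  show "0 < ln golden_ratio" using golden_ratio_gt_1 by simp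
  have "sqrt 5 \<le> sqrt 9" by (subst real_sqrt_le_iff) simp
  also have "sqrt 9 = 3" using real_sqrt_abs[of 3] by simp
  finally have "golden_ratio \<le> 2" by (simp add: golden_ratio_def)
  thus "ln golden_ratio \<le> 1" using ln_le_minus_one[of golden_ratio] golden_ratio_gt_1 by linarith
qed

lemma ln_fib_bound:
  assumes "n > 0"
  shows "\<bar>ln (real (fib n)) - real n * ln golden_ratio\<bar> \<le> 2"
proof -
  obtain m where m: "n = Suc m" using assms by (cases n) auto
  have pos: "real (fib n) > 0" "golden_ratio > 0" using assms fib_neq_0_nat[of n] golden_ratio_gt_1 by auto
  have "ln (real (fib n)) \<le> ln (golden_ratio ^ n)"
    using golden_ratio_power_fib[of m] pos unfolding m by (intro ln_mono) auto
  moreover have "ln (golden_ratio ^ n) \<le> ln (golden_ratio\<^sup>2 * real (fib n))"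
    using golden_ratio_power_fib[of m] pos unfolding m by (intro ln_mono) auto
  ultimately show ?thesis
    using pos ln_golden_ratio by (simp add: ln_mult ln_realpow)
qed

lemma moebius_inversion:
  fixes h :: "nat \<Rightarrow> real"
  assumes "n > 0"
  shows "(\<Sum>d | d dvd n. moebius_mu d * (\<Sum>e | e dvd n div d. h e)) = h n"
proof -
  have fin: "finite {d. d dvd n}" using assms by simp
  have "(\<Sum>d | d dvd n. moebius_mu d * (\<Sum>e | e dvd n div d. h e)) =
    (\<Sum>d | d dvd n. \<Sum>e | e dvd n. of_bool (d * e dvd n) * (moebius_mu d * h e))"
  proof (rule sum.cong[OF refl])
    fix d assume d: "d \<in> {d. d dvd n}"
    hence d0: "d > 0" using assms by (auto intro: dvd_pos_nat)
    have iff: "e dvd n div d \<longleftrightarrow> d * e dvd n" for e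
      using d d0 by (auto simp: dvd_div_iff_mult mult.commute)
    have "(\<Sum>e | e dvd n div d. moebius_mu d * h e) = (\<Sum>e | e dvd n. of_bool (d * e dvd n) * (moebius_mu d * h e))"
      unfolding iff using fin by (intro sum.mono_neutral_cong_left) (auto intro: dvd_mult_right)
    thus "moebius_mu d * (\<Sum>e | e dvd n div d. h e) = (\<Sum>e | e dvd n. of_bool (d * e dvd n) * (moebius_mu d * h e))"
      by (simp add: sum_distrib_left)
  qed
  also have "\<dots> = (\<Sum>e | e dvd n. h e * (\<Sum>d | d dvd n. of_bool (d * e dvd n) * moebius_mu d))"
    by (subst sum.swap) (simp add: sum_distrib_left mult_ac)
  also have "\<dots> = (\<Sum>e | e dvd n. if e = n then h n else 0)"
  proof (rule sum.cong[OF refl])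
    fix e assume e: "e \<in> {d. d dvd n}"
    hence e0: "e > 0" "n div e > 0" "e dvd n" using assms by (auto intro: dvd_pos_nat simp: dvd_div_eq_0_iff)
    have iff: "d dvd n div e \<longleftrightarrow> d * e dvd n" for d
      using e e0 by (auto simp: dvd_div_iff_mult)
    have "(\<Sum>d | d dvd n. of_bool (d * e dvd n) * moebius_mu d) = (\<Sum>d | d dvd n div e. moebius_mu d)"
      unfolding iff using fin by (intro sum.mono_neutral_cong_right) (auto intro: dvd_mult_left)
    also have "\<dots> = of_bool (n div e = 1)" using e0 by (intro sum_moebius_mu_eq) auto
    also have "n div e = 1 \<longleftrightarrow> e = n" using e0 assms by (auto elim: dvdE)
    finally show "h e * (\<Sum>d | d dvd n. of_bool (d * e dvd n) * moebius_mu d) = (if e = n then h n else 0)" by simp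
  qed
  also have "\<dots> = h n" using fin by (simp add: sum.delta)
  finally show ?thesis .
qed

text \<open>The totients of the divisors of \<open>m\<close> sum to \<open>m\<close>, so the divisor
  sums of the difference \<open>h\<close> compare ln F_m with \<open>m * ln golden_ratio\<close> and
  are at most \<open>2 + 2 * ln m\<close>. Moebius inversion recovers \<open>h n\<close> from one
  such sum per divisor.\<close>

lemma log_prim_bound:
  assumes "n > 0"
  shows "\<bar>log_prim n - real (totient n) * ln golden_ratio\<bar> \<le> real (card {d. d dvd n}) * (2 + 2 * ln (real n))"
proof -
  define h where "h = (\<lambda>d. log_prim d - real (totient d) * ln golden_ratio)"
  have H: "\<bar>\<Sum>d | d dvd m. h d\<bar> \<le> 2 + 2 * ln (real m)" if "m > 0" for m
  proof -
    have "(\<Sum>d | d dvd m. h d) = (\<Sum>d | d dvd m. log_prim d) - real (\<Sum>d | d dvd m. totient d) * ln golden_ratio"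
      by (simp add: h_def sum_subtractf sum_distrib_right)
    also have "(\<Sum>d | d dvd m. totient d) = m" by (rule totient_divisor_sum)
    finally show ?thesis using sum_log_prim_divisors[OF that] ln_fib_bound[OF that] that by (simp add: abs_le_iff)
  qed
  have "\<bar>h n\<bar> = \<bar>\<Sum>d | d dvd n. moebius_mu d * (\<Sum>e | e dvd n div d. h e)\<bar>"
    using moebius_inversion[OF assms, of h] by simp
  also have "\<dots> \<le> (\<Sum>d | d dvd n. \<bar>moebius_mu d * (\<Sum>e | e dvd n div d. h e)\<bar>)" by (rule sum_abs)
  also have "\<dots> \<le> (\<Sum>d | d dvd n. 2 + 2 * ln (real n))"
  proof (rule sum_mono)
    fix d assume d: "d \<in> {d. d dvd n}"
    hence nd: "n div d > 0" using assms by (auto simp: dvd_div_eq_0_iff)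
    have "\<bar>moebius_mu d\<bar> * \<bar>\<Sum>e | e dvd n div d. h e\<bar> \<le> 1 * (2 + 2 * ln (real (n div d)))"
      using H[OF nd] abs_moebius_mu_le by (intro mult_mono) auto
    also have "\<dots> \<le> 2 + 2 * ln (real n)"
      using nd by (simp add: ln_mono)
    finally show "\<bar>moebius_mu d * (\<Sum>e | e dvd n div d. h e)\<bar> \<le> 2 + 2 * ln (real n)" by (simp add: abs_mult)
  qed
  finally show ?thesis by (simp add: h_def)
qed

lemma sum_card_divisors_le:
  assumes "N > 0"
  shows "(\<Sum>n=1..N. real (card {d. d dvd n})) \<le> real N * (1 + ln (real N))"
proof -
  have "(\<Sum>n=1..N. real (card {d. d dvd n})) = (\<Sum>n=1..N. \<Sum>d=1..N. of_bool (d dvd n))"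
  proof (rule sum.cong[OF refl])
    fix n assume n: "n \<in> {1..N}"
    hence "{d. d dvd n} = {1..N} \<inter> {d. d dvd n}"
      by (auto simp: Suc_le_eq intro: dvd_pos_nat dvd_imp_le[THEN order_trans])
    thus "real (card {d. d dvd n}) = (\<Sum>d=1..N. of_bool (d dvd n))" by (simp add: sum_of_bool_eq)
  qed
  also have "\<dots> = (\<Sum>d=1..N. \<Sum>n=1..N. of_bool (d dvd n))" by (rule sum.swap)
  also have "\<dots> \<le> (\<Sum>d=1..N. real N * (1 / real d))"
  proof (rule sum_mono)
    fix d assume d: "d \<in> {1..N}"
    have "card ({1..N} \<inter> {n. d dvd n}) \<le> card {1..N div d}"
    proof (rule card_inj_on_le[of "\<lambda>n. n div d"])
      show "inj_on (\<lambda>n. n div d) ({1..N} \<inter> {n. d dvd n})" using d by (auto simp: inj_on_def elim!: dvdE)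
      show "(\<lambda>n. n div d) ` ({1..N} \<inter> {n. d dvd n}) \<subseteq> {1..N div d}"
        using d by (auto simp: Suc_le_eq div_greater_zero_iff intro: dvd_imp_le div_le_mono)
    qed auto
    hence "real (card ({1..N} \<inter> {n. d dvd n})) \<le> real (N div d)" by simp
    also have "\<dots> \<le> real N / real d" by (rule of_nat_div_le_of_nat)
    finally show "(\<Sum>n=1..N. of_bool (d dvd n)) \<le> real N * (1 / real d)" by (simp add: sum_of_bool_eq)
  qed
  also have "\<dots> \<le> real N * (1 + ln (real N))"
    unfolding sum_distrib_left[symmetric] using sum_inverse_le_ln[OF assms] by (intro mult_left_mono) auto
  finally show ?thesis .
qed

text \<open>The pointwise errors are majorized over all of \<open>1..N\<close>, where the divisor
  function is logarithmic on average. The bound is thus uniform in \<open>D\<close>, and of the set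
  of admissible ranks only an upper bound for its elements will matter.\<close>

lemma sum_log_prim_bound:
  assumes "N > 0" "D \<subseteq> {1..N}"
  shows "\<bar>(\<Sum>d\<in>D. log_prim d) - ln golden_ratio * (\<Sum>d\<in>D. real (totient d))\<bar> \<le> 2 * real N * (1 + ln (real N))\<^sup>2"
proof -
  have "\<bar>(\<Sum>d\<in>D. log_prim d) - ln golden_ratio * (\<Sum>d\<in>D. real (totient d))\<bar> =
     \<bar>\<Sum>d\<in>D. (log_prim d - real (totient d) * ln golden_ratio)\<bar>"
    by (simp add: sum_subtractf sum_distrib_left mult.commute)
  also have "\<dots> \<le> (\<Sum>d\<in>D. \<bar>log_prim d - real (totient d) * ln golden_ratio\<bar>)" by (rule sum_abs)
  also have "\<dots> \<le> (\<Sum>d=1..N. \<bar>log_prim d - real (totient d) * ln golden_ratio\<bar>)"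
    using assms by (intro sum_mono2) auto
  also have "\<dots> \<le> (\<Sum>d=1..N. real (card {e. e dvd d}) * (2 + 2 * ln (real N)))"
  proof (rule sum_mono)
    fix d assume d: "d \<in> {1..N}"
    have "\<bar>log_prim d - real (totient d) * ln golden_ratio\<bar> \<le> real (card {e. e dvd d}) * (2 + 2 * ln (real d))"
      using d by (intro log_prim_bound) auto
    also have "\<dots> \<le> real (card {e. e dvd d}) * (2 + 2 * ln (real N))"
      using d by (intro mult_left_mono) (auto simp: ln_mono)
    finally show "\<bar>log_prim d - real (totient d) * ln golden_ratio\<bar> \<le> real (card {e. e dvd d}) * (2 + 2 * ln (real N))" .
  qed
  also have "\<dots> \<le> (real N * (1 + ln (real N))) * (2 + 2 * ln (real N))"
    unfolding sum_distrib_right[symmetric] using sum_card_divisors_le[OF assms(1)] assms(1)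
    by (intro mult_right_mono) (auto simp: add_nonneg_nonneg)
  also have "\<dots> = 2 * real N * (1 + ln (real N))\<^sup>2" by (simp add: power2_eq_square algebra_simps)
  finally show ?thesis .
qed

section \<open>Prime divisors of shifted Lucas numbers\<close>
definition lucas_nat :: "nat \<Rightarrow> nat" where
  "lucas_nat m = nat (lucas m)"

lemma int_lucas_nat: "int (lucas_nat m) = lucas m"
  using fib_Suc_mono[of m] by (simp add: lucas_nat_def lucas_eq_fib)

lemma lucas_pos: "0 < lucas n"
  by (induction n rule: lucas.induct) auto

lemma lucas_ge_3: "n \<ge> 2 \<Longrightarrow> lucas n \<ge> 3"
proof (induction n rule: nat_induct_at_least)
  case base
  show ?case by (simp add: numeral_2_eq_2)
next
  case (Suc n)
  obtain m where m: "n = Suc m" using Suc by (cases n) auto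
  show ?case using Suc lucas_pos[of m] unfolding m by simp
qed

lemma fib_double_nat: "fib (2 * m) = fib m * lucas_nat m"
  using fib_double[of m] by (simp only: int_lucas_nat[symmetric] of_nat_mult[symmetric] of_nat_eq_iff)

lemma prim_primes_gt_5_iff:
  assumes "p \<in> prim_primes d" "d > 0"
  shows "p > 5 \<longleftrightarrow> d \<ge> 6"
proof
  have p: "prime p" "p dvd fib d" using assms by (auto simp: prim_primes_def)
  have small: "fib 3 = 2" "fib 4 = 3" "fib 5 = 5" by (simp_all add: eval_nat_numeral)
  {
    assume p5: "p > 5"
    show "d \<ge> 6"
    proof (rule ccontr)
      assume "\<not> d \<ge> 6"
      hence "fib d \<le> 5" using fib_mono[of d 5] small by simp
      moreover have "p \<le> fib d" using p assms(2) fib_neq_0_nat by (intro dvd_imp_le) auto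
      ultimately show False using p5 by simp
    qed
  next
    assume d: "d \<ge> 6"
    have nd: "\<not> p dvd fib m" if "0 < m" "m < 6" for m
      using assms(1) d that unfolding prim_primes_def by simp
    show "p > 5"
    proof (rule ccontr)
      assume "\<not> p > 5"
      hence "p = 2 \<or> p = 3 \<or> p = 4 \<or> p = 5" using prime_ge_2_nat[OF p(1)] by linarith
      moreover have "p \<noteq> 4" using p(1) by (auto simp: prime_nat_iff dest: spec[of _ 2])
      ultimately show False using nd[of 3] nd[of 4] nd[of 5] small by auto
    qed
  }
qed

text \<open>F_{2m} = F_m L_m, and the two factors share no odd prime: their sum is 2 F_{m+1}, while
  F_m and F_{m+1} are coprime.\<close>

lemma prime_dvd_lucas_iff:
  assumes "p \<in> prim_primes d" "d > 0" "p > 2"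
  shows "p dvd lucas_nat m \<longleftrightarrow> d dvd 2 * m \<and> \<not> d dvd m"
    and "p dvd lucas_nat m \<Longrightarrow> m > 0 \<Longrightarrow> multiplicity p (lucas_nat m) = multiplicity p (fib (2 * m))"
proof -
  have p: "prime p" using assms by (simp add: prim_primes_def)
  have not_both: "\<not> (p dvd lucas_nat m \<and> p dvd fib m)"
  proof
    assume *: "p dvd lucas_nat m \<and> p dvd fib m"
    have "lucas_nat m + fib m = 2 * fib (Suc m)"
      using int_lucas_nat[of m] lucas_eq_fib[of m] by linarith
    hence "p dvd 2 * fib (Suc m)" using * by (metis dvd_add)
    hence "p dvd 2 \<or> p dvd fib (Suc m)" using p by (simp only: prime_dvd_mult_iff)
    moreover have "\<not> p dvd 2" using assms(3) by (auto dest: dvd_imp_le)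
    moreover have "\<not> p dvd fib (Suc m)" using prime_not_dvd_fib_Suc[OF p, of m] * by simp
    ultimately show False by simp
  qed
  note rank = prim_primes_dvd_fib_iff[OF assms(1,2)]
  show "p dvd lucas_nat m \<longleftrightarrow> d dvd 2 * m \<and> \<not> d dvd m"
    using not_both p rank[of "2 * m"] rank[of m] by (auto simp: fib_double_nat prime_dvd_mult_iff)
  show "multiplicity p (lucas_nat m) = multiplicity p (fib (2 * m))" if "p dvd lucas_nat m" "m > 0"
  proof -
    have "fib m \<noteq> 0" "lucas_nat m \<noteq> 0" using that fib_neq_0_nat[of m] lucas_pos[of m] by (auto simp: lucas_nat_def)
    thus ?thesis using not_both that p
      by (simp add: fib_double_nat prime_elem_multiplicity_mult_distrib not_dvd_imp_multiplicity_0)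
  qed
qed

definition shifted_lucas :: "(nat \<Rightarrow> int) \<Rightarrow> nat \<Rightarrow> nat" where
  "shifted_lucas s k = nat (lucas k + s k)"

lemma int_shifted_lucas:
  assumes "sign_sequence s" "k > 0"
  shows "int (shifted_lucas s k) = lucas k + s k"
proof -
  have "s k \<in> {-1, 1}" using assms unfolding sign_sequence_def by simp
  thus ?thesis using lucas_pos[of k] by (auto simp: shifted_lucas_def)
qed

lemma adm_even:
  assumes "m > 0"
  shows "adm \<sigma> d u (2 * m) \<longleftrightarrow> \<not> 3 dvd u \<and> 6 * m = d * u \<and> (\<sigma> (2 * m) \<longleftrightarrow> even (m + u))"
  using assms by (auto simp: adm_def)

text \<open>With \<open>u = 3 * t\<close> the factor 3 cancels, leaving the indices of the factors
  with subscripts \<open>m\<close> and \<open>m + 1\<close>.\<close>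

lemma adm_odd:
  "adm \<sigma> d u (Suc (2 * m)) \<longleftrightarrow>
    (\<exists>t. u = 3 * t \<and> (2 * m = d * t \<or> 2 * m + 2 = d * t) \<and> (\<sigma> (Suc (2 * m)) \<longleftrightarrow> odd (m + t)))"
proof -
  have *: "adm \<sigma> d (3 * t) (Suc (2 * m)) \<longleftrightarrow>
      (2 * m = d * t \<or> 2 * m + 2 = d * t) \<and> (\<sigma> (Suc (2 * m)) \<longleftrightarrow> odd (m + t))" for t
  proof -
    have "(3 * Suc (2 * m) = 3 * x + 3 \<longleftrightarrow> 2 * m = x) \<and> (3 * Suc (2 * m) + 3 = 3 * x \<longleftrightarrow> 2 * m + 2 = x)" for x
      by presburger
    hence "3 * Suc (2 * m) = d * (3 * t) + 3 \<longleftrightarrow> 2 * m = d * t"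
      "3 * Suc (2 * m) + 3 = d * (3 * t) \<longleftrightarrow> 2 * m + 2 = d * t"
      unfolding mult.left_commute[of d 3 t] by blast+
    moreover have "even (m + Suc (2 * m) + 3 * t) \<longleftrightarrow> odd (m + t)" by presburger
    moreover have "Suc (2 * m) div 2 = m" by simp
    ultimately show ?thesis unfolding adm_def by simp
  qed
  show ?thesis
  proof
    assume adm: "adm \<sigma> d u (Suc (2 * m))"
    hence "3 dvd u" by (simp add: adm_def)
    then obtain t where "u = 3 * t" by blast
    thus "\<exists>t. u = 3 * t \<and> (2 * m = d * t \<or> 2 * m + 2 = d * t) \<and> (\<sigma> (Suc (2 * m)) \<longleftrightarrow> odd (m + t))"
      using adm * by blast
  qed (use * in blast)
qed

lemma nat_mult_cancel_scaled:
  assumes "(d :: nat) > 0" "c * (d * i) = d * u"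
  shows "u = c * i"
proof -
  have "d * u = d * (c * i)" unfolding assms(2)[symmetric] by (rule mult.left_commute)
  thus ?thesis using assms(1) by simp
qed

lemma minus_one_power_eq_1_iff: "(-1) ^ m = (1 :: int) \<longleftrightarrow> even m"
  by (cases "even m") auto

text \<open>Four cases, by the parity of \<open>k\<close> and by whether the sign is
  \<open>(-1) ^ m\<close> for \<open>m = k div 2\<close>, match the four factorizations. The second
  claim trades the term for a Fibonacci number of index at most \<open>3 * k\<close>, to which
  lifting the exponent applies.\<close>

lemma prime_dvd_shifted_lucas:
  assumes s: "sign_sequence s" and k: "k > 0" and nz: "shifted_lucas s k \<noteq> 0"
    and p: "p \<in> prim_primes d" "p > 5" and d: "d > 0"
  shows "p dvd shifted_lucas s k \<longleftrightarrow> (\<exists>u>0. adm (\<lambda>k. s k = 1) d u k)" (is ?A)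
    and "p dvd shifted_lucas s k \<Longrightarrow> \<exists>N>0. N \<le> 3 * k \<and> d dvd N \<and>
      multiplicity p (shifted_lucas s k) = multiplicity p (fib N)" (is "_ \<Longrightarrow> ?B")
proof -
  define a where "a = shifted_lucas s k"
  have a: "int a = lucas k + s k" using int_shifted_lucas[OF s k] by (simp add: a_def)
  have "s k \<in> {-1, 1}" using s k unfolding sign_sequence_def by simp
  hence sk: "s k = 1 \<or> s k = -1" by blast
  have pr: "prime p" using p by (simp add: prim_primes_def)
  have p2: "p > 2" using p by simp
  have ndvd: "\<not> p dvd q" if "0 < q" "q \<le> 5" for q using that p(2) by (auto dest: dvd_imp_le)
  note rank = prim_primes_dvd_fib_iff[OF p(1) d]
  note lrank = prime_dvd_lucas_iff[OF p(1) d p2]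
  have a0: "a > 0" using nz by (simp add: a_def)
  define S where "S \<longleftrightarrow> (\<exists>u>0. adm (\<lambda>k. s k = 1) d u k)"
  have "(p dvd a \<longleftrightarrow> S) \<and> (p dvd a \<longrightarrow> (\<exists>N>0. N \<le> 3 * k \<and> d dvd N \<and> multiplicity p a = multiplicity p (fib N)))"
  proof (cases "even k")
    case True
    then obtain m where m: "k = 2 * m" by blast
    have m0: "m > 0" using k m by simp
    have S: "S \<longleftrightarrow> (\<exists>u>0. \<not> 3 dvd u \<and> 6 * m = d * u \<and> (s k = 1 \<longleftrightarrow> even (m + u)))"
      unfolding S_def m adm_even[OF m0] by simp
    show ?thesis
    proof (cases "s k = (-1) ^ m")
      case True
      have "int (fib (3 * m)) = int (fib m * a)"
        using fib_triple[of m] a True m by simp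
      hence fa: "fib (3 * m) = fib m * a" by (simp only: of_nat_eq_iff)
      have fm: "fib m \<noteq> 0" using fib_neq_0_nat[of m] m0 by simp
      \<comment> \<open>Multiplying the index \<open>m\<close> by 3 does not change the multiplicity
        of \<open>p\<close>, because \<open>p\<close> differs from 3; nothing is left for the
        cofactor \<open>a\<close>.\<close>
      have e1: "\<not> p dvd a" if "p dvd fib m"
      proof
        assume "p dvd a"
        have "multiplicity p (fib (m * 3)) = multiplicity p (fib m)"
          using pr that m0 ndvd[of 3] by (intro multiplicity_fib_mult_coprime) auto
        moreover have "multiplicity p (fib (3 * m)) = multiplicity p (fib m) + multiplicity p a"
          unfolding fa using pr fm a0 by (intro prime_elem_multiplicity_mult_distrib) auto
        ultimately have "multiplicity p a = 0" by (simp add: mult.commute)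
        thus False using \<open>p dvd a\<close> a0 pr by (simp add: prime_multiplicity_gt_zero_iff[symmetric])
      qed
      hence e2: "p dvd a \<longleftrightarrow> d dvd 3 * m \<and> \<not> d dvd m"
        using rank[of "3 * m"] rank[of m] pr unfolding fa prime_dvd_mult_iff[OF pr] by blast
      have "S \<longleftrightarrow> (\<exists>u>0. \<not> 3 dvd u \<and> 6 * m = d * u \<and> even u)"
        unfolding S True minus_one_power_eq_1_iff by auto
      also have "\<dots> \<longleftrightarrow> d dvd 3 * m \<and> \<not> d dvd m"
      proof
        assume "\<exists>u>0. \<not> 3 dvd u \<and> 6 * m = d * u \<and> even u"
        then obtain u j where u: "u = 2 * j" "\<not> 3 dvd u" "6 * m = d * u" by blast
        hence 3: "3 * m = d * j" by simp
        have "\<not> d dvd m"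
        proof
          assume "d dvd m"
          then obtain i where "m = d * i" by blast
          with 3 d have "j = 3 * i" by simp
          thus False using u by simp
        qed
        thus "d dvd 3 * m \<and> \<not> d dvd m" using 3 by simp
      next
        assume *: "d dvd 3 * m \<and> \<not> d dvd m"
        then obtain j where j: "3 * m = d * j" by blast
        have "\<not> 3 dvd j" 
        proof
          assume "3 dvd j"
          then obtain i where "j = 3 * i" by blast
          hence "m = d * i" using j by simp
          thus False using * by simp
        qed
        moreover have "3 dvd 2 * j \<longleftrightarrow> 3 dvd j" by presburger
        ultimately show "\<exists>u>0. \<not> 3 dvd u \<and> 6 * m = d * u \<and> even u"
          using j m0 by (intro exI[of _ "2 * j"]) (auto intro: gr0I)
      qed
      finally have "p dvd a \<longleftrightarrow> S" using e2 by simp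
      moreover have "multiplicity p a = multiplicity p (fib (3 * m))" if "p dvd a"
      proof -
        have "\<not> p dvd fib m" using e1 that by blast
        thus ?thesis unfolding fa using pr fm a0 by (simp add: prime_elem_multiplicity_mult_distrib not_dvd_imp_multiplicity_0)
      qed
      ultimately show ?thesis using e2 m0 m by (auto intro!: exI[of _ "3 * m"])
    next
      case False
      have sm: "s k = - ((-1) ^ m)" using sk False by (cases "even m") simp_all
      have "int (lucas_nat (3 * m)) = int (lucas_nat m * a)"
        using lucas_triple[of m] a sm m by (simp add: int_lucas_nat)
      hence la: "lucas_nat (3 * m) = lucas_nat m * a" by (simp only: of_nat_eq_iff)
      have lm: "lucas_nat m \<noteq> 0" using lucas_pos[of m] by (simp add: lucas_nat_def)
      \<comment> \<open>L_m^2 and \<open>a\<close> differ by 3 up to sign, so a common prime would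
        be 3.\<close>
      have e1: "\<not> p dvd lucas_nat m" if "p dvd a"
      proof
        assume l: "p dvd lucas_nat m"
        have "int a = int (lucas_nat m) ^ 2 - 3 * (-1) ^ m"
          using a sm m lucas_double[of m] by (simp add: int_lucas_nat)
        hence "3 * (-1) ^ m = int (lucas_nat m) ^ 2 - int a" by simp
        moreover have "int p dvd int (lucas_nat m) ^ 2 - int a"
          using that l by (auto simp: power2_eq_square)
        ultimately have "int p dvd 3 * (-1) ^ m" by simp
        hence "int p dvd int 3" by (cases "even m") auto
        hence "p dvd 3" by (rule int_dvd_int_iff[THEN iffD1])
        thus False using ndvd[of 3] by simp
      qed
      have "S \<longleftrightarrow> (\<exists>u>0. \<not> 3 dvd u \<and> 6 * m = d * u \<and> odd u)"
        unfolding S sm by (cases "even m") auto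
      also have "\<dots> \<longleftrightarrow> d dvd 2 * (3 * m) \<and> \<not> d dvd 3 * m \<and> \<not> d dvd 2 * m"
      proof
        assume "\<exists>u>0. \<not> 3 dvd u \<and> 6 * m = d * u \<and> odd u"
        then obtain u where u: "\<not> 3 dvd u" "6 * m = d * u" "odd u" by blast
        have "\<not> d dvd 3 * m"
        proof
          assume "d dvd 3 * m"
          then obtain i where "3 * m = d * i" by blast
          hence "2 * (d * i) = d * u" using u by linarith
          hence "u = 2 * i" by (rule nat_mult_cancel_scaled[OF d])
          thus False using u by simp
        qed
        moreover have "\<not> d dvd 2 * m"
        proof
          assume "d dvd 2 * m"
          then obtain i where "2 * m = d * i" by blast
          hence "3 * (d * i) = d * u" using u by linarith
          hence "u = 3 * i" by (rule nat_mult_cancel_scaled[OF d])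
          thus False using u by simp
        qed
        ultimately show "d dvd 2 * (3 * m) \<and> \<not> d dvd 3 * m \<and> \<not> d dvd 2 * m" using u(2) by simp
      next
        assume *: "d dvd 2 * (3 * m) \<and> \<not> d dvd 3 * m \<and> \<not> d dvd 2 * m"
        hence "d dvd 6 * m" by (simp add: mult.assoc[symmetric])
        then obtain u where u: "6 * m = d * u" by blast
        have "odd u"
        proof
          assume "even u"
          then obtain i where "u = 2 * i" by blast
          hence "3 * m = d * i" using u by simp
          thus False using * by simp
        qed
        moreover have "\<not> 3 dvd u"
        proof
          assume "3 dvd u"
          then obtain i where "u = 3 * i" by blast
          hence "2 * m = d * i" using u by simp
          thus False using * by simp
        qed
        ultimately show "\<exists>u>0. \<not> 3 dvd u \<and> 6 * m = d * u \<and> odd u"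
          using u by (intro exI[of _ u]) (auto intro: gr0I)
      qed
      finally have S2: "S \<longleftrightarrow> d dvd 2 * (3 * m) \<and> \<not> d dvd 3 * m \<and> \<not> d dvd 2 * m" .
      have "p dvd lucas_nat (3 * m) \<longleftrightarrow> p dvd lucas_nat m \<or> p dvd a"
        unfolding la using pr by (simp add: prime_dvd_mult_iff)
      moreover have "p dvd lucas_nat m \<longleftrightarrow> d dvd 2 * m" if "\<not> d dvd 3 * m"
        using lrank(1)[of m] that dvd_mult[of d m 3] by blast
      ultimately have e2: "p dvd a \<longleftrightarrow> S" unfolding S2 using e1 lrank(1)[of "3 * m"] by blast
      moreover have "multiplicity p a = multiplicity p (fib (2 * (3 * m)))" if "p dvd a"
      proof -
        have "p dvd lucas_nat (3 * m)" using that la by simp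
        hence "multiplicity p (lucas_nat (3 * m)) = multiplicity p (fib (2 * (3 * m)))"
          using m0 by (intro lrank(2)) auto
        thus ?thesis unfolding la using pr lm a0 e1[OF that]
          by (simp add: prime_elem_multiplicity_mult_distrib not_dvd_imp_multiplicity_0)
      qed
      ultimately show ?thesis using S2 m0 m by (auto intro!: exI[of _ "2 * (3 * m)"])
    qed
  next
    case False
    then obtain m where m: "k = Suc (2 * m)" by (auto elim: oddE)
    have S: "S \<longleftrightarrow> (\<exists>t>0. (2 * m = d * t \<or> 2 * m + 2 = d * t) \<and> (s k = 1 \<longleftrightarrow> odd (m + t)))"
    proof -
      have "(\<exists>u>0. \<exists>t. u = 3 * t \<and> P t) \<longleftrightarrow> (\<exists>t>0. P t)" for P :: "nat \<Rightarrow> bool"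
      proof
        assume "\<exists>t>0. P t"
        then obtain t where "t > 0" "P t" by blast
        thus "\<exists>u>0. \<exists>t. u = 3 * t \<and> P t" by (intro exI[of _ "3 * t"]) simp
      qed auto
      thus ?thesis unfolding S_def m adm_odd .
    qed
    show ?thesis
    proof (cases "s k = (-1) ^ m")
      case True
      have "int a = int (lucas_nat m * lucas_nat (Suc m))"
        using lucas_odd(1)[of m] a True m by (simp add: int_lucas_nat)
      hence la: "a = lucas_nat m * lucas_nat (Suc m)" by (simp only: of_nat_eq_iff)
      \<comment> \<open>An odd cofactor \<open>t\<close> expresses exactly the condition under which
        \<open>p\<close> divides L_x.\<close>
      have odd_iff: "(\<exists>t. odd t \<and> 2 * x = d * t) \<longleftrightarrow> d dvd 2 * x \<and> \<not> d dvd x" for x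
      proof
        assume "\<exists>t. odd t \<and> 2 * x = d * t"
        then obtain t where t: "odd t" "2 * x = d * t" by blast
        have "\<not> d dvd x"
        proof
          assume "d dvd x"
          then obtain i where "x = d * i" by blast
          hence "2 * (d * i) = d * t" using t by linarith
          hence "t = 2 * i" by (rule nat_mult_cancel_scaled[OF d])
          thus False using t by simp
        qed
        thus "d dvd 2 * x \<and> \<not> d dvd x" using t by simp
      next
        assume *: "d dvd 2 * x \<and> \<not> d dvd x"
        then obtain t where t: "2 * x = d * t" by blast
        have "odd t"
        proof
          assume "even t"
          then obtain i where "t = 2 * i" by blast
          hence "x = d * i" using t by simp
          thus False using * by simp
        qed
        thus "\<exists>t. odd t \<and> 2 * x = d * t" using t by blast
      qed
      have "S \<longleftrightarrow> (\<exists>t. odd t \<and> 2 * m = d * t) \<or> (\<exists>t. odd t \<and> 2 * Suc m = d * t)"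
        unfolding S True minus_one_power_eq_1_iff by (auto intro: odd_pos)
      also have "\<dots> \<longleftrightarrow> p dvd lucas_nat m \<or> p dvd lucas_nat (Suc m)"
        unfolding odd_iff lrank(1) ..
      also have "\<dots> \<longleftrightarrow> p dvd a" unfolding la using pr by (simp add: prime_dvd_mult_iff)
      finally have "p dvd a \<longleftrightarrow> S" by blast
      moreover have "\<exists>N>0. N \<le> 3 * k \<and> d dvd N \<and> multiplicity p a = multiplicity p (fib N)" if "p dvd a"
      proof -
        have lm: "lucas_nat m \<noteq> 0" "lucas_nat (Suc m) \<noteq> 0" using a0 la by auto
        have not_both: "\<not> (p dvd lucas_nat m \<and> p dvd lucas_nat (Suc m))"
        proof
          assume "p dvd lucas_nat m \<and> p dvd lucas_nat (Suc m)"
          hence "d dvd 2 * m" "d dvd 2 * Suc m" using lrank(1) by blast+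
          hence "d dvd 2 * Suc m - 2 * m" by (rule dvd_diff_nat[rotated])
          hence "d dvd 2" by simp
          hence "d \<le> 2" by (rule dvd_imp_le) simp
          thus False using prim_primes_gt_5_iff[OF p(1) d] p(2) by simp
        qed
        have "multiplicity p a = multiplicity p (lucas_nat m) + multiplicity p (lucas_nat (Suc m))"
          unfolding la using pr lm by (intro prime_elem_multiplicity_mult_distrib) auto
        moreover consider "p dvd lucas_nat m" "\<not> p dvd lucas_nat (Suc m)" | "p dvd lucas_nat (Suc m)" "\<not> p dvd lucas_nat m"
          using \<open>p dvd a\<close> not_both pr unfolding la by (auto simp: prime_dvd_mult_iff)
        hence "\<exists>x>0. x \<le> Suc m \<and> d dvd 2 * x \<and> multiplicity p (lucas_nat m) + multiplicity p (lucas_nat (Suc m)) = multiplicity p (fib (2 * x))"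
        proof cases
          case 1
          have m0: "m > 0"
          proof (rule gr0I)
            assume "m = 0"
            thus False using 1 lrank(1)[of m] by simp
          qed
          have "multiplicity p (lucas_nat m) = multiplicity p (fib (2 * m))" by (rule lrank(2)[OF 1(1) m0])
          thus ?thesis using 1 m0 lrank(1)[of m] by (intro exI[of _ m]) (simp add: not_dvd_imp_multiplicity_0)
        next
          case 2
          have "multiplicity p (lucas_nat (Suc m)) = multiplicity p (fib (2 * Suc m))" by (rule lrank(2)[OF 2(1)]) simp
          thus ?thesis using 2 lrank(1)[of "Suc m"] by (intro exI[of _ "Suc m"]) (simp add: not_dvd_imp_multiplicity_0)
        qed
        then obtain x where "x > 0" "x \<le> Suc m" "d dvd 2 * x"
            "multiplicity p (lucas_nat m) + multiplicity p (lucas_nat (Suc m)) = multiplicity p (fib (2 * x))" by blast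
        ultimately show ?thesis using m by (intro exI[of _ "2 * x"]) auto
      qed
      ultimately show ?thesis by blast
    next
      case False
      have sm: "s k = - ((-1) ^ m)" using sk False by (cases "even m") simp_all
      have "int a = int (5 * (fib m * fib (Suc m)))"
        using lucas_odd(2)[of m] a sm m by simp
      hence fa: "a = 5 * (fib m * fib (Suc m))" by (simp only: of_nat_eq_iff)
      \<comment> \<open>\<open>m = 0\<close> is the term L_1 - 1 = 0, which the nonvanishing
        assumption excludes.\<close>
      have m0: "m > 0" using a0 fa by (intro gr0I) auto
      have even_iff: "(\<exists>t>0. even t \<and> 2 * x = d * t) \<longleftrightarrow> d dvd x" if "x > 0" for x
      proof
        assume "\<exists>t>0. even t \<and> 2 * x = d * t"
        then obtain i where "2 * x = d * (2 * i)" by blast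
        hence "x = d * i" by simp
        thus "d dvd x" by simp
      next
        assume "d dvd x"
        then obtain i where i: "x = d * i" by blast
        thus "\<exists>t>0. even t \<and> 2 * x = d * t" using that by (intro exI[of _ "2 * i"]) (auto intro: gr0I)
      qed
      have "S \<longleftrightarrow> (\<exists>t>0. even t \<and> 2 * m = d * t) \<or> (\<exists>t>0. even t \<and> 2 * Suc m = d * t)"
        unfolding S sm by (cases "even m") auto
      also have "\<dots> \<longleftrightarrow> p dvd fib m \<or> p dvd fib (Suc m)"
        unfolding even_iff[OF m0] even_iff[OF zero_less_Suc] rank ..
      also have "\<dots> \<longleftrightarrow> p dvd a" unfolding fa using pr ndvd[of 5] by (simp add: prime_dvd_mult_iff)
      finally have "p dvd a \<longleftrightarrow> S" by blast
      moreover have "\<exists>N>0. N \<le> 3 * k \<and> d dvd N \<and> multiplicity p a = multiplicity p (fib N)" if "p dvd a"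
      proof -
        have fm: "fib m \<noteq> 0" "fib (Suc m) \<noteq> 0" using a0 fa by auto
        have not_both: "\<not> (p dvd fib m \<and> p dvd fib (Suc m))" using prime_not_dvd_fib_Suc[OF pr, of m] by auto
        have "multiplicity p a = multiplicity p 5 + (multiplicity p (fib m) + multiplicity p (fib (Suc m)))"
          unfolding fa using pr fm by (simp add: prime_elem_multiplicity_mult_distrib)
        moreover have "multiplicity p 5 = 0" using ndvd[of 5] by (intro not_dvd_imp_multiplicity_0) simp
        moreover consider "p dvd fib m" "\<not> p dvd fib (Suc m)" | "p dvd fib (Suc m)" "\<not> p dvd fib m"
          using \<open>p dvd a\<close> not_both pr ndvd[of 5] unfolding fa by (auto simp: prime_dvd_mult_iff)
        hence "\<exists>x>0. x \<le> Suc m \<and> d dvd x \<and> multiplicity p (fib m) + multiplicity p (fib (Suc m)) = multiplicity p (fib x)"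
        proof cases
          case 1
          thus ?thesis using m0 rank[of m] by (intro exI[of _ m]) (simp add: not_dvd_imp_multiplicity_0)
        next
          case 2
          thus ?thesis using rank[of "Suc m"] by (intro exI[of _ "Suc m"]) (simp add: not_dvd_imp_multiplicity_0)
        qed
        then obtain x where "x > 0" "x \<le> Suc m" "d dvd x"
            "multiplicity p (fib m) + multiplicity p (fib (Suc m)) = multiplicity p (fib x)" by blast
        ultimately show ?thesis using m by (intro exI[of _ x]) auto
      qed
      ultimately show ?thesis by blast
    qed
  qed
  thus ?A "p dvd shifted_lucas s k \<Longrightarrow> ?B" unfolding S_def a_def by blast+
qed

section \<open>The least common multiple in terms of totients\<close>
text \<open>The primes \<open>2\<close>, \<open>3\<close>, \<open>5\<close> have ranks \<open>3\<close>, \<open>4\<close>, \<open>5\<close>, so \<open>6 \<le> d\<close> excludes exactly the primes up to \<open>5\<close>.\<close>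

definition adm_set :: "(nat \<Rightarrow> bool) \<Rightarrow> nat \<Rightarrow> nat set" where
  "adm_set \<sigma> n = {d. 6 \<le> d \<and> (\<exists>k\<le>n. \<exists>u>0. adm \<sigma> d u k)}"

lemma adm_mult_le: "adm \<sigma> d u k \<Longrightarrow> d * u \<le> 3 * k + 3"
  by (auto simp: adm_def)

lemma adm_le_mult: "adm \<sigma> d u k \<Longrightarrow> 3 * k \<le> d * u + 3"
  by (auto simp: adm_def)

lemma adm_set_subset: "adm_set \<sigma> n \<subseteq> {1..3 * n + 3}"
proof
  fix d assume "d \<in> adm_set \<sigma> n"
  then obtain k u where *: "d \<ge> 6" "k \<le> n" "u > 0" "adm \<sigma> d u k" by (auto simp: adm_set_def)
  have "d * 1 \<le> d * u" using * by (intro mult_le_mono2) simp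
  also have "\<dots> \<le> 3 * k + 3" using * by (intro adm_mult_le)
  finally show "d \<in> {1..3 * n + 3}" using * by simp
qed

lemma finite_adm_set: "finite (adm_set \<sigma> n)"
  using adm_set_subset by (rule finite_subset) simp

lemma multiplicity_Lcm_nat:
  assumes "finite S" "S \<noteq> {}" "0 \<notin> S" "prime (p :: nat)"
  shows "\<exists>a\<in>S. multiplicity p (Lcm S) = multiplicity p a"
  using assms(1-3)
proof (induction S rule: finite_ne_induct)
  case (insert x F)
  have "Lcm F \<noteq> 0" using insert by (subst Lcm_0_iff) auto
  hence "multiplicity p (lcm x (Lcm F)) = max (multiplicity p x) (multiplicity p (Lcm F))"
    using insert assms(4) by (intro multiplicity_lcm) auto
  moreover obtain a where "a \<in> F" "multiplicity p (Lcm F) = multiplicity p a" using insert by auto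
  ultimately show ?case by (auto simp: max_def)
qed simp

definition shifted_terms :: "(nat \<Rightarrow> int) \<Rightarrow> nat \<Rightarrow> nat set" where
  "shifted_terms s n = shifted_lucas s ` {1..n} - {0}"

lemma shifted_lucas_lcm_eq:
  assumes "sign_sequence s"
  shows "shifted_lucas_lcm s n = int (Lcm (shifted_terms s n))"
proof -
  have "(\<lambda>k. lucas k + s k) ` {1..n} = int ` shifted_lucas s ` {1..n}"
    unfolding image_image using int_shifted_lucas[OF assms] by (intro image_cong) auto
  hence "(\<lambda>k. lucas k + s k) ` {1..n} - {0} = int ` shifted_terms s n"
    unfolding shifted_terms_def by auto
  thus ?thesis unfolding shifted_lucas_lcm_def by simp
qed

lemma Lcm_shifted_terms_pos: "Lcm (shifted_terms s n) > 0"
proof -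
  have "finite (shifted_terms s n)" "0 \<notin> shifted_terms s n" by (simp_all add: shifted_terms_def)
  hence "Lcm (shifted_terms s n) \<noteq> 0" by (subst Lcm_0_iff) auto
  thus ?thesis by simp
qed

lemma shifted_lucas_nonzero:
  assumes "sign_sequence s" "k \<ge> 2"
  shows "shifted_lucas s k \<noteq> 0"
proof -
  have "int (shifted_lucas s k) = lucas k + s k" using assms by (intro int_shifted_lucas) auto
  moreover have "s k \<in> {-1, 1}" using assms unfolding sign_sequence_def by simp
  ultimately show ?thesis using lucas_ge_3[OF assms(2)] by auto
qed

text \<open>A crude bound suffices: it only limits the contribution of the primes 2, 3, 5 to
  O(n).\<close>

lemma shifted_lucas_le:
  assumes "sign_sequence s" "k > 0"
  shows "shifted_lucas s k \<le> 2 ^ (k + 3)"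
proof -
  have fib: "fib m \<le> 2 ^ m" for m
    by (induction m rule: fib.induct) auto
  have "s k \<in> {-1, 1}" using assms unfolding sign_sequence_def by simp
  hence "s k = -1 \<or> s k = 1" by blast
  hence "int (shifted_lucas s k) \<le> 2 * int (fib (Suc k)) + 1"
    using int_shifted_lucas[OF assms] lucas_eq_fib[of k] by linarith
  hence "shifted_lucas s k \<le> 2 * fib (Suc k) + 1" by linarith
  also have "\<dots> \<le> 2 * 2 ^ Suc k + 1" by (intro add_right_mono mult_left_mono fib) simp
  also have "\<dots> = 4 * 2 ^ k + 1" by simp
  also have "\<dots> \<le> 8 * 2 ^ k" using one_le_power[of "2 :: nat" k] by linarith
  finally show ?thesis by (simp add: power_add)
qed

lemma sum_prim_primes_Sigma:
  assumes "\<And>d. d \<in> D \<Longrightarrow> d > 0" "finite D"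
  shows "(\<Sum>d\<in>D. log_prim d) = (\<Sum>(d, p)\<in>Sigma D prim_primes. real (multiplicity p (fib d)) * ln (real p))"
  unfolding log_prim_def using assms finite_prim_primes by (intro sum.Sigma) auto

text \<open>Every prime of an admissible rank \<open>d\<close> divides some term to at least its
  power in F_d, since \<open>d\<close> divides the index \<open>N\<close> attached to that term.
  Different ranks have disjoint sets of primes, so the contributions add up.\<close>

lemma ln_lcm_lower:
  assumes s: "sign_sequence s"
  shows "(\<Sum>d\<in>adm_set (\<lambda>k. s k = 1) n. log_prim d) \<le> ln (real (Lcm (shifted_terms s n)))"
proof -
  let ?D = "adm_set (\<lambda>k. s k = 1) n" and ?L = "Lcm (shifted_terms s n)"
  have D0: "d > 0" if "d \<in> ?D" for d using that by (simp add: adm_set_def)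
  have inj: "inj_on snd (Sigma ?D prim_primes)"
    using D0 prim_primes_unique by (auto simp: inj_on_def)
  have "(\<Sum>d\<in>?D. log_prim d) = (\<Sum>(d, p)\<in>Sigma ?D prim_primes. real (multiplicity p (fib d)) * ln (real p))"
    by (rule sum_prim_primes_Sigma[OF D0 finite_adm_set])
  also have "\<dots> \<le> (\<Sum>x\<in>Sigma ?D prim_primes. real (multiplicity (snd x) ?L) * ln (real (snd x)))"
  proof (rule sum_mono, clarify)
    fix d p assume d: "d \<in> ?D" and p: "p \<in> prim_primes d"
    obtain k u where k: "k \<le> n" "u > 0" "adm (\<lambda>k. s k = 1) d u k" and d6: "d \<ge> 6" using d by (auto simp: adm_set_def)
    have pr: "prime p" using p by (simp add: prim_primes_def)
    have k0: "k > 0" using k by (simp add: adm_def)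
    have "6 * 1 \<le> d * u" using d6 k by (intro mult_le_mono) auto
    also have "\<dots> \<le> 3 * k + 3" using k by (intro adm_mult_le)
    finally have "k = 1 \<or> k \<ge> 2" using k0 by linarith
    \<comment> \<open>The term with \<open>k = 1\<close> may vanish, but \<open>k = 1\<close> would
      need 3 to divide \<open>u\<close> and \<open>d * u \<le> 6\<close>, whereas
      \<open>d \<ge> 6\<close> gives \<open>d * u \<ge> 18\<close>.\<close>
    hence nz: "shifted_lucas s k \<noteq> 0"
    proof
      assume k1: "k = 1"
      with k(3) have "3 dvd u" "3 = d * u + 3 \<or> 6 = d * u" by (auto simp: adm_def)
      moreover have "6 * 3 \<le> d * u" using d6 k(2) \<open>3 dvd u\<close> by (intro mult_le_mono) (auto dest: dvd_imp_le)
      ultimately show ?thesis by linarith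
    qed (rule shifted_lucas_nonzero[OF s])
    have p5: "p > 5" using prim_primes_gt_5_iff[OF p D0[OF d]] d6 by simp
    note pd = prime_dvd_shifted_lucas[OF s k0 nz p p5 D0[OF d]]
    have "p dvd shifted_lucas s k" using pd(1) k by blast
    then obtain N where N: "N > 0" "d dvd N" "multiplicity p (shifted_lucas s k) = multiplicity p (fib N)"
      using pd(2) by blast
    have "multiplicity p (fib d) \<le> multiplicity p (fib N)"
      using N fib_dvd_fib[of d N] fib_neq_0_nat[of N] by (intro dvd_imp_multiplicity_le) auto
    also have "\<dots> \<le> multiplicity p ?L"
      unfolding N(3)[symmetric] using nz k k0 Lcm_shifted_terms_pos
      by (intro dvd_imp_multiplicity_le dvd_Lcm) (auto simp: shifted_terms_def)
    finally show "real (multiplicity p (fib d)) * ln (real p) \<le> real (multiplicity (snd (d, p)) ?L) * ln (real (snd (d, p)))"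
      using prime_ge_1_nat[OF pr] by (simp add: mult_right_mono)
  qed
  also have "\<dots> = (\<Sum>p\<in>snd ` Sigma ?D prim_primes. real (multiplicity p ?L) * ln (real p))"
    by (simp add: sum.reindex[OF inj])
  also have "\<dots> \<le> ln (real ?L)"
  proof (rule sum_multiplicity_le_ln[OF Lcm_shifted_terms_pos])
    show "finite (snd ` Sigma ?D prim_primes)"
      using finite_adm_set finite_prim_primes D0 by (intro finite_imageI finite_SigmaI) auto
  qed (auto simp: prim_primes_def)
  finally show ?thesis .
qed

lemma ln_prime_nonneg: "prime (p :: nat) \<Longrightarrow> 0 \<le> ln (real p)"
  using prime_ge_1_nat[of p] by simp

text \<open>Two consecutive pairs of residues coincide by the pigeonhole principle, and running the
  recurrence backwards moves the coincidence to index 0, where F_0 = 0.\<close>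

lemma dvd_fib_exists:
  assumes "q > 0"
  shows "\<exists>j>0. q dvd fib j"
proof -
  let ?f = "\<lambda>n. (fib n mod q, fib (Suc n) mod q)"
  have "range ?f \<subseteq> {..<q} \<times> {..<q}" using assms by auto
  hence "finite (range ?f)" by (rule finite_subset) simp
  hence "\<not> inj ?f" using range_inj_infinite by blast
  then obtain n m where nm: "n \<noteq> m" "?f n = ?f m" unfolding inj_def by blast
  have shift: "q dvd fib k" if "[fib n = fib (n + k)] (mod q)" "[fib (Suc n) = fib (Suc (n + k))] (mod q)" for n k
    using that
  proof (induction n)
    case 0
    hence "[fib k = 0] (mod q)" by (simp add: cong_sym)
    thus ?case by (simp add: cong_0_iff)
  next
    case (Suc n)
    have "[fib (Suc n) + fib n = fib (Suc (n + k)) + fib (n + k)] (mod q)"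
      using Suc.prems(2) by simp
    hence "[fib n = fib (n + k)] (mod q)"
      using Suc.prems(1) by (metis add_Suc cong_add_lcancel_nat cong_add_rcancel_nat cong_trans cong_sym cong_add cong_refl)
    thus ?case using Suc by simp
  qed
  have "\<exists>j>0. q dvd fib j" if "n < m" "?f n = ?f m" for n m
    using shift[of n "m - n"] that by (intro exI[of _ "m - n"]) (simp add: cong_def)
  thus ?thesis using nm by (metis linorder_neqE_nat)
qed

lemma multiplicity_mult_ln_le:
  assumes "N > 0" "prime p"
  shows "real (multiplicity p N) * ln (real p) \<le> ln (real N)"
  using sum_multiplicity_le_ln[OF assms(1), of "{p}"] assms(2) by simp

text \<open>The term \<open>6 * (n + 3)\<close> pays for the primes up to 5, at most
  \<open>n + 3\<close> each. The last term pays \<open>2 * ln (3 * n)\<close> for each prime up to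
  \<open>3 * n\<close>, where the multiplicity may exceed that in F_d.\<close>

lemma ln_lcm_upper:
  assumes s: "sign_sequence s" and n: "n > 0"
  shows "ln (real (Lcm (shifted_terms s n))) \<le> (\<Sum>d\<in>adm_set (\<lambda>k. s k = 1) n. log_prim d)
    + 6 * (real n + 3) + 6 * real n * ln (3 * real n)"
proof -
  let ?D = "adm_set (\<lambda>k. s k = 1) n" and ?L = "Lcm (shifted_terms s n)"
  have D0: "d > 0" if "d \<in> ?D" for d using that by (simp add: adm_set_def)
  define P where "P = prime_factors ?L"
  have finP: "finite P" by (simp add: P_def)
  have ex: "\<exists>k. k > 0 \<and> k \<le> n \<and> shifted_lucas s k \<noteq> 0 \<and> multiplicity p ?L = multiplicity p (shifted_lucas s k)" if "p \<in> P" for p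
  proof -
    have p: "prime p" "p dvd ?L" using that by (auto simp: P_def)
    have "shifted_terms s n \<noteq> {}" using p by (auto simp: Lcm_empty)
    moreover have "finite (shifted_terms s n)" "0 \<notin> shifted_terms s n" by (simp_all add: shifted_terms_def)
    ultimately obtain a where a: "a \<in> shifted_terms s n" "multiplicity p ?L = multiplicity p a"
      using multiplicity_Lcm_nat p(1) by blast
    then obtain k where "k \<in> {1..n}" "a = shifted_lucas s k" "a \<noteq> 0" unfolding shifted_terms_def by blast
    thus ?thesis using a(2) by (intro exI[of _ k]) simp
  qed
  have ln0: "ln (real p) \<ge> 0" if "p \<in> P" for p
    using that by (auto simp: P_def dest!: in_prime_factors_imp_prime prime_ge_1_nat)
  have small: "real (multiplicity p ?L) * ln (real p) \<le> real n + 3" if pP: "p \<in> P" for p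
  proof -
    obtain k where k: "k > 0" "k \<le> n" "shifted_lucas s k \<noteq> 0" "multiplicity p ?L = multiplicity p (shifted_lucas s k)"
      using ex[OF pP] by blast
    have "real (multiplicity p ?L) * ln (real p) \<le> ln (real (shifted_lucas s k))"
      unfolding k(4) using k pP by (intro multiplicity_mult_ln_le) (auto simp: P_def)
    also have "real (shifted_lucas s k) \<le> real (2 ^ (k + 3))"
      using shifted_lucas_le[OF s k(1)] by (simp only: of_nat_le_iff)
    hence "ln (real (shifted_lucas s k)) \<le> ln (real (2 ^ (k + 3)))" using k by (intro ln_mono) auto
    also have "\<dots> = real (k + 3) * ln 2" by (simp add: ln_realpow del: power_add)
    also have "\<dots> \<le> real (k + 3) * 1" using ln_2_less_1 by (intro mult_left_mono) auto
    also have "\<dots> \<le> real n + 3" using k by simp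
    finally show ?thesis .
  qed
  \<comment> \<open>Bounds the excess allowed by lifting the exponent; it vanishes for
    \<open>p > 3 * n\<close>, which cannot divide the index \<open>N \<le> 3 * n\<close>.\<close>
  define c where "c = (\<lambda>p. if p \<le> 3 * n then 2 * ln (3 * real n) else 0)"
  have big: "\<exists>d. d \<in> ?D \<and> p \<in> prim_primes d \<and> real (multiplicity p ?L) * ln (real p) \<le> real (multiplicity p (fib d)) * ln (real p) + c p"
    if p: "p \<in> P" "p > 5" for p
  proof -
    have pr: "prime p" using p by (auto simp: P_def)
    obtain k where k: "k > 0" "k \<le> n" "shifted_lucas s k \<noteq> 0" "multiplicity p ?L = multiplicity p (shifted_lucas s k)"
      using ex[OF p(1)] by blast
    have "multiplicity p ?L > 0" using p Lcm_shifted_terms_pos by (auto simp: P_def prime_factors_multiplicity)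
    hence pdvd: "p dvd shifted_lucas s k" using k pr by (simp add: prime_multiplicity_gt_zero_iff)
    obtain d where d: "d > 0" "p \<in> prim_primes d"
    proof -
      have "\<exists>j>0. p dvd fib j" by (rule dvd_fib_exists[OF prime_gt_0_nat[OF pr]])
      thus ?thesis using prim_primes_exists[OF pr] that by blast
    qed
    note pd = prime_dvd_shifted_lucas[OF s k(1,3) d(2) p(2) d(1)]
    have d6: "d \<ge> 6" using prim_primes_gt_5_iff[OF d(2,1)] p by simp
    have dD: "d \<in> ?D" using pd(1) pdvd k d6 by (auto simp: adm_set_def)
    obtain N where N: "N > 0" "N \<le> 3 * k" "d dvd N" "multiplicity p (shifted_lucas s k) = multiplicity p (fib N)"
      using pd(2) pdvd by blast
    obtain i where i: "N = d * i" using N by blast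
    have pf: "p dvd fib d" using d by (simp add: prim_primes_def)
    have "multiplicity p (fib N) \<le> multiplicity p (fib d) + 2 * multiplicity p i"
      unfolding i using N i by (intro multiplicity_fib_mult pr pf d) auto
    also have "multiplicity p i \<le> multiplicity p N" using N i by (intro dvd_imp_multiplicity_le) auto
    finally have "real (multiplicity p ?L) \<le> real (multiplicity p (fib d)) + 2 * real (multiplicity p N)"
      unfolding k(4) N(4) by linarith
    hence "real (multiplicity p ?L) * ln (real p) \<le> (real (multiplicity p (fib d)) + 2 * real (multiplicity p N)) * ln (real p)"
      using ln0[OF p(1)] by (rule mult_right_mono)
    also have "\<dots> = real (multiplicity p (fib d)) * ln (real p) + 2 * (real (multiplicity p N) * ln (real p))"
      by (simp add: algebra_simps)
    also have "2 * (real (multiplicity p N) * ln (real p)) \<le> c p"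
    proof (cases "p \<le> 3 * n")
      case True
      have "real (multiplicity p N) * ln (real p) \<le> ln (real N)" by (rule multiplicity_mult_ln_le[OF N(1) pr])
      also have "\<dots> \<le> ln (3 * real n)" using N k n by (intro ln_mono) auto
      finally show ?thesis using True by (simp add: c_def)
    next
      case False
      hence "\<not> p dvd N" using N k by (auto dest: dvd_imp_le)
      thus ?thesis using False by (simp add: c_def not_dvd_imp_multiplicity_0)
    qed
    finally show ?thesis using d dD by auto
  qed
  then obtain \<delta> where \<delta>: "\<And>p. p \<in> P \<Longrightarrow> p > 5 \<Longrightarrow> \<delta> p \<in> ?D \<and> p \<in> prim_primes (\<delta> p) \<and>
      real (multiplicity p ?L) * ln (real p) \<le> real (multiplicity p (fib (\<delta> p))) * ln (real p) + c p"
    by metis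
  define P1 where "P1 = {p\<in>P. p \<le> 5}"
  define P2 where "P2 = {p\<in>P. p > 5}"
  have P12: "P = P1 \<union> P2" "P1 \<inter> P2 = {}" "finite P1" "finite P2" using finP by (auto simp: P1_def P2_def)
  have "ln (real ?L) = (\<Sum>p\<in>P. real (multiplicity p ?L) * ln (real p))"
    unfolding P_def by (rule ln_eq_sum_prime_factors[OF Lcm_shifted_terms_pos])
  also have "\<dots> = (\<Sum>p\<in>P1. real (multiplicity p ?L) * ln (real p)) + (\<Sum>p\<in>P2. real (multiplicity p ?L) * ln (real p))"
    unfolding P12(1) using P12 by (intro sum.union_disjoint)
  also have "(\<Sum>p\<in>P1. real (multiplicity p ?L) * ln (real p)) \<le> (\<Sum>p\<in>P1. real n + 3)"
    by (intro sum_mono small) (simp add: P1_def)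
  also have "\<dots> = real (card P1) * (real n + 3)" by simp
  also have "\<dots> \<le> 6 * (real n + 3)"
  proof -
    have "P1 \<subseteq> {..5}" by (auto simp: P1_def)
    hence "card P1 \<le> card {..5 :: nat}" by (intro card_mono) auto
    thus ?thesis by (intro mult_right_mono) auto
  qed
  also have "(\<Sum>p\<in>P2. real (multiplicity p ?L) * ln (real p)) \<le> (\<Sum>p\<in>P2. real (multiplicity p (fib (\<delta> p))) * ln (real p) + c p)"
    using \<delta> by (intro sum_mono) (auto simp: P2_def)
  also have "\<dots> = (\<Sum>p\<in>P2. real (multiplicity p (fib (\<delta> p))) * ln (real p)) + (\<Sum>p\<in>P2. c p)" by (rule sum.distrib)
  also have "(\<Sum>p\<in>P2. real (multiplicity p (fib (\<delta> p))) * ln (real p)) =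
      (\<Sum>(d, p)\<in>(\<lambda>p. (\<delta> p, p)) ` P2. real (multiplicity p (fib d)) * ln (real p))"
    by (subst sum.reindex) (auto simp: inj_on_def)
  also have "\<dots> \<le> (\<Sum>(d, p)\<in>Sigma ?D prim_primes. real (multiplicity p (fib d)) * ln (real p))"
  proof (rule sum_mono2)
    show "finite (Sigma ?D prim_primes)"
      using finite_adm_set finite_prim_primes D0 by (intro finite_SigmaI) auto
    show "(\<lambda>p. (\<delta> p, p)) ` P2 \<subseteq> Sigma ?D prim_primes" using \<delta> by (auto simp: P2_def)
  qed (auto simp: prim_primes_def intro!: mult_nonneg_nonneg ln_prime_nonneg)
  also have "\<dots> = (\<Sum>d\<in>?D. log_prim d)"
    by (rule sum_prim_primes_Sigma[OF D0 finite_adm_set, symmetric])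
  also have "(\<Sum>p\<in>P2. c p) = (\<Sum>p\<in>P2 \<inter> {1..3 * n}. c p)"
    by (rule sum.mono_neutral_right) (auto simp: c_def P2_def finP)
  also have "\<dots> = (\<Sum>p\<in>P2 \<inter> {1..3 * n}. 2 * ln (3 * real n))"
    by (rule sum.cong) (auto simp: c_def)
  also have "\<dots> = real (card (P2 \<inter> {1..3 * n})) * (2 * ln (3 * real n))" by simp
  also have "\<dots> \<le> real (3 * n) * (2 * ln (3 * real n))"
  proof -
    have "card (P2 \<inter> {1..3 * n}) \<le> card {1..3 * n}" by (intro card_mono) auto
    thus ?thesis using n by (intro mult_right_mono) auto
  qed
  finally show ?thesis by simp
qed

lemma ln_lcm_asymptotics:
  assumes s: "sign_sequence s"
  shows "(\<lambda>n. (ln (real_of_int (shifted_lucas_lcm s n)) -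
      ln golden_ratio * (\<Sum>d\<in>adm_set (\<lambda>k. s k = 1) n. real (totient d))) / (real n)\<^sup>2) \<longlonglongrightarrow> 0"
proof (rule Lim_null_comparison)
  let ?E = "\<lambda>n. 2 * (3 * real n + 3) * (1 + ln (3 * real n + 3))\<^sup>2 + 6 * (real n + 3) + 6 * real n * ln (3 * real n)"
  show "(\<lambda>n. ?E n / (real n)\<^sup>2) \<longlonglongrightarrow> 0" by real_asymp
  show "\<forall>\<^sub>F n in sequentially. norm ((ln (real_of_int (shifted_lucas_lcm s n)) -
      ln golden_ratio * (\<Sum>d\<in>adm_set (\<lambda>k. s k = 1) n. real (totient d))) / (real n)\<^sup>2) \<le> ?E n / (real n)\<^sup>2"
    using eventually_gt_at_top[of 0]
  proof eventually_elim
    case (elim n)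
    let ?D = "adm_set (\<lambda>k. s k = 1) n" and ?L = "ln (real (Lcm (shifted_terms s n)))"
    have "\<bar>(\<Sum>d\<in>?D. log_prim d) - ln golden_ratio * (\<Sum>d\<in>?D. real (totient d))\<bar>
       \<le> 2 * real (3 * n + 3) * (1 + ln (real (3 * n + 3)))\<^sup>2"
      by (rule sum_log_prim_bound[OF _ adm_set_subset]) simp
    hence 1: "\<bar>(\<Sum>d\<in>?D. log_prim d) - ln golden_ratio * (\<Sum>d\<in>?D. real (totient d))\<bar>
       \<le> 2 * (3 * real n + 3) * (1 + ln (3 * real n + 3))\<^sup>2" by (simp add: add.commute)
    have "0 \<le> 6 * real n * ln (3 * real n)" using elim by simp
    hence "\<bar>?L - (\<Sum>d\<in>?D. log_prim d)\<bar> \<le> 6 * (real n + 3) + 6 * real n * ln (3 * real n)"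
      using ln_lcm_lower[OF s, of n] ln_lcm_upper[OF s elim] by linarith
    with 1 have "\<bar>?L - ln golden_ratio * (\<Sum>d\<in>?D. real (totient d))\<bar> \<le> ?E n" by linarith
    moreover have "real_of_int (shifted_lucas_lcm s n) = real (Lcm (shifted_terms s n))"
      by (simp add: shifted_lucas_lcm_eq[OF s])
    ultimately show ?case by (simp add: divide_right_mono)
  qed
qed

section \<open>Asymptotics for periodic signs\<close>
definition ex_adm :: "(nat \<Rightarrow> bool) \<Rightarrow> nat \<Rightarrow> nat \<Rightarrow> bool" where
  "ex_adm \<sigma> d u \<longleftrightarrow> (\<exists>k. adm \<sigma> d u k)"

lemma first_mult_iff:
  "first_mult \<sigma> d u \<longleftrightarrow> 0 < u \<and> ex_adm \<sigma> d u \<and> (\<forall>v<u. 0 < v \<longrightarrow> \<not> ex_adm \<sigma> d v)"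
proof -
  have "k < d * u + 2" if "adm \<sigma> d u k" for u k
    using adm_le_mult[OF that] by linarith
  hence "(\<exists>k<d * u + 2. adm \<sigma> d u k) \<longleftrightarrow> ex_adm \<sigma> d u" for u
    unfolding ex_adm_def by blast
  thus ?thesis unfolding first_mult_def by auto
qed

lemma first_mult_unique: "first_mult \<sigma> d u \<Longrightarrow> first_mult \<sigma> d v \<Longrightarrow> u = v"
  unfolding first_mult_iff by (metis linorder_neqE_nat)

lemma first_mult_exists:
  assumes "ex_adm \<sigma> d u" "u > 0"
  shows "\<exists>v\<le>u. first_mult \<sigma> d v"
proof -
  define v where "v = (LEAST v. 0 < v \<and> ex_adm \<sigma> d v)"
  have v: "0 < v \<and> ex_adm \<sigma> d v" unfolding v_def by (rule LeastI[of "\<lambda>v. 0 < v \<and> ex_adm \<sigma> d v" u]) (use assms in simp)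
  have "v \<le> u" unfolding v_def by (rule Least_le) (use assms in simp)
  moreover have "\<not> (0 < w \<and> ex_adm \<sigma> d w)" if "w < v" for w
    using not_less_Least[of w "\<lambda>v. 0 < v \<and> ex_adm \<sigma> d v"] that unfolding v_def by blast
  ultimately show ?thesis using v unfolding first_mult_iff by blast
qed

locale periodic_signs =
  fixes \<sigma> :: "nat \<Rightarrow> bool" and T :: nat
  assumes period_pos: "T > 0"
    and period: "\<And>k. k > 0 \<Longrightarrow> \<sigma> (k + T) = \<sigma> k"
begin

lemma period_mult: "k > 0 \<Longrightarrow> \<sigma> (k + j * T) = \<sigma> k"
proof (induction j)
  case (Suc j)
  have "\<sigma> (k + Suc j * T) = \<sigma> (k + j * T + T)" by (simp add: algebra_simps)
  thus ?case using period[of "k + j * T"] Suc by simp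
qed simp

text \<open>Adding \<open>4 * T * c\<close> to \<open>k\<close> preserves its sign value and its
  parity, and changes \<open>k div 2\<close> by an even number. One statement serves both
  periodicities: in \<open>d\<close> (with \<open>c = u\<close>) and in \<open>u\<close> (with
  \<open>c = d\<close>).\<close>

lemma adm_shift:
  assumes "k > 0" "d' * u' = d * u + 12 * T * c" "3 dvd u' \<longleftrightarrow> 3 dvd u" "even u' \<longleftrightarrow> even u"
  shows "adm \<sigma> d' u' (k + 4 * T * c) \<longleftrightarrow> adm \<sigma> d u k"
proof -
  have 1: "\<sigma> (k + 4 * T * c) = \<sigma> k" using period_mult[OF assms(1), of "4 * c"] by (simp add: mult_ac)
  have 2: "even (k + 4 * T * c) \<longleftrightarrow> even k" by simp
  have 3: "(k + 4 * T * c) div 2 = k div 2 + 2 * T * c"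
  proof -
    have "k + 4 * T * c = k + (2 * T * c) * 2" by simp
    thus ?thesis by (simp only: div_mult_self1)
  qed
  have 4: "even ((k + 4 * T * c) div 2 + (k + 4 * T * c) + u') \<longleftrightarrow> even (k div 2 + k + u)"
    unfolding 3 using assms(4) by simp
  have 5: "3 * (k + 4 * T * c) = d' * u' \<longleftrightarrow> 3 * k = d * u"
    "3 * (k + 4 * T * c) = d' * u' + 3 \<longleftrightarrow> 3 * k = d * u + 3"
    "3 * (k + 4 * T * c) + 3 = d' * u' \<longleftrightarrow> 3 * k + 3 = d * u"
    unfolding assms(2) by (simp_all add: algebra_simps)
  show ?thesis unfolding adm_def 1 2 4 5 using assms(1,3) by simp
qed

lemma ex_adm_add_period:
  assumes "d \<ge> 2" "u > 0"
  shows "ex_adm \<sigma> (d + 12 * T) u \<longleftrightarrow> ex_adm \<sigma> d u"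
proof
  assume "ex_adm \<sigma> d u"
  then obtain k where "adm \<sigma> d u k" by (auto simp: ex_adm_def)
  hence "adm \<sigma> (d + 12 * T) u (k + 4 * T * u)"
    by (subst adm_shift) (auto simp: adm_def algebra_simps)
  thus "ex_adm \<sigma> (d + 12 * T) u" by (auto simp: ex_adm_def)
next
  assume "ex_adm \<sigma> (d + 12 * T) u"
  then obtain k where k: "adm \<sigma> (d + 12 * T) u k" by (auto simp: ex_adm_def)
  have eq: "(d + 12 * T) * u = d * u + 12 * T * u" by (simp add: algebra_simps)
  \<comment> \<open>Here \<open>d \<ge> 2\<close> is what keeps the shifted index
    \<open>k - 4 * T * u\<close> positive, also when \<open>3 * k + 3 = d * u\<close>.\<close>
  have "2 * 1 \<le> d * u" using assms by (intro mult_le_mono) auto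
  moreover have "6 \<le> d * u" if "3 dvd u"
  proof -
    have "2 * 3 \<le> d * u" using assms that by (intro mult_le_mono) (auto dest: dvd_imp_le)
    thus ?thesis by simp
  qed
  ultimately have "k > 4 * T * u" using k unfolding adm_def eq by linarith
  hence "adm \<sigma> d u (k - 4 * T * u)"
    using adm_shift[of "k - 4 * T * u" "d + 12 * T" u d u u] k eq by simp
  thus "ex_adm \<sigma> d u" by (auto simp: ex_adm_def)
qed

lemma ex_adm_mod:
  assumes "d \<ge> 2" "u > 0"
  shows "ex_adm \<sigma> (d mod (12 * T) + 12 * T) u \<longleftrightarrow> ex_adm \<sigma> d u"
proof -
  have *: "ex_adm \<sigma> (e + j * (12 * T)) u \<longleftrightarrow> ex_adm \<sigma> e u" if "e \<ge> 2" for e j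
  proof (induction j)
    case (Suc j)
    have "e + Suc j * (12 * T) = e + j * (12 * T) + 12 * T" by (simp add: algebra_simps)
    moreover have "ex_adm \<sigma> (e + j * (12 * T) + 12 * T) u \<longleftrightarrow> ex_adm \<sigma> (e + j * (12 * T)) u"
      using that assms(2) by (intro ex_adm_add_period) auto
    ultimately show ?case using Suc by (simp only:)
  qed simp
  show ?thesis
  proof (cases "d < 12 * T")
    case True
    thus ?thesis using ex_adm_add_period[OF assms] by simp
  next
    case False
    define e where "e = d mod (12 * T) + 12 * T"
    have "d div (12 * T) > 0" using False period_pos by (simp add: div_greater_zero_iff)
    then obtain j where j: "d div (12 * T) = Suc j" by (cases "d div (12 * T)") auto
    have "d = d div (12 * T) * (12 * T) + d mod (12 * T)" by (rule div_mult_mod_eq[symmetric])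
    also have "\<dots> = e + j * (12 * T)" unfolding j e_def by (simp add: algebra_simps)
    finally have "d = e + j * (12 * T)" .
    moreover have "e \<ge> 2" unfolding e_def using period_pos by simp
    ultimately show ?thesis using *[of e j] unfolding e_def[symmetric] by simp
  qed
qed

text \<open>Multipliers can be lowered by \<open>12 * T\<close> as well, so searching
  \<open>u\<close> up to \<open>12 * T\<close>, as \<open>lcm_numerator\<close> does, finds the
  least one whenever one exists.\<close>

lemma ex_adm_mult_le:
  assumes "d \<ge> 4" "u > 0" "ex_adm \<sigma> d u"
  shows "\<exists>v>0. v \<le> 12 * T \<and> ex_adm \<sigma> d v"
  using assms(2,3)
proof (induction u rule: less_induct)
  case (less u)
  show ?case
  proof (cases "u \<le> 12 * T")
    case False
    define v where "v = u - 12 * T"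
    have v: "v > 0" "v < u" "u = v + 12 * T" using False period_pos by (auto simp: v_def)
    obtain k where k: "adm \<sigma> d u k" using less by (auto simp: ex_adm_def)
    have eq: "d * u = d * v + 12 * T * d" unfolding v(3) by (simp add: algebra_simps)
    have "4 * 1 \<le> d * v" using assms(1) v by (intro mult_le_mono) auto
    hence "k > 4 * T * d" using k eq unfolding adm_def by linarith
    moreover have "3 dvd u \<longleftrightarrow> 3 dvd v" "even u \<longleftrightarrow> even v" unfolding v(3) by presburger+
    ultimately have "adm \<sigma> d v (k - 4 * T * d)"
      using adm_shift[of "k - 4 * T * d" d u d v d] k eq by simp
    thus ?thesis using less.IH[of v] v by (auto simp: ex_adm_def)
  qed (use less.prems in blast)
qed

text \<open>Secures positivity of the constant: whatever the signs, ranks divisible by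
  \<open>12 * T\<close> are admissible. The witness \<open>k = 12 * T * t + 1\<close> has the sign
  of index 1, and the parity of \<open>t\<close> is adapted to that sign.\<close>

lemma ex_adm_zero_class: "ex_adm \<sigma> (12 * T) (if \<sigma> 1 then 3 else 6)"
proof -
  define t where "t = (if \<sigma> 1 then 1 else 2 :: nat)"
  have "\<sigma> (12 * T * t + 1) = \<sigma> 1" using period_mult[of 1 "12 * t"] by (simp add: mult_ac)
  moreover have "(12 * T * t + 1) div 2 = 6 * T * t" by simp
  ultimately have "adm \<sigma> (12 * T) (3 * t) (12 * T * t + 1)"
    by (auto simp: adm_def t_def)
  moreover have "3 * t = (if \<sigma> 1 then 3 else 6)" by (simp add: t_def)
  ultimately show ?thesis unfolding ex_adm_def by metis
qed

section \<open>Admissible ranks in one residue class\<close>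

definition class_sum :: "nat \<Rightarrow> nat \<Rightarrow> real" where
  "class_sum r n = (\<Sum>d | d \<in> adm_set \<sigma> n \<and> d mod (12 * T) = r. real (totient d))"

text \<open>An admissible multiplier \<open>v\<close> of \<open>d\<close> also serves the
  representative of its class, so \<open>u \<le> v\<close> and
  \<open>d * u \<le> d * v \<le> 3 * n + 3\<close>.\<close>

lemma class_sum_upper:
  assumes "first_mult \<sigma> (r + 12 * T) u"
  shows "class_sum r n \<le> totient_sum (12 * T) r ((3 * n + 3) div u)"
  unfolding class_sum_def totient_sum_def
proof (rule sum_mono2)
  show "{d. d \<in> adm_set \<sigma> n \<and> d mod (12 * T) = r} \<subseteq> {d. d \<in> {1..(3 * n + 3) div u} \<and> d mod (12 * T) = r}"
  proof clarify
    fix d assume d: "d \<in> adm_set \<sigma> n" "r = d mod (12 * T)"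
    then obtain k v where kv: "k \<le> n" "v > 0" "adm \<sigma> d v k" "d \<ge> 6" by (auto simp: adm_set_def)
    have "ex_adm \<sigma> (r + 12 * T) v"
      using ex_adm_mod[of d v] kv d by (auto simp: ex_adm_def)
    hence "u \<le> v" using assms kv unfolding first_mult_iff by (meson not_le)
    hence "d * u \<le> d * v" by simp
    also have "\<dots> \<le> 3 * n + 3" using adm_mult_le[OF kv(3)] kv by linarith
    finally have "d \<le> (3 * n + 3) div u" using assms by (simp add: first_mult_iff less_eq_div_iff_mult_less_eq)
    thus "d \<in> {1..(3 * n + 3) div u} \<and> d mod (12 * T) = d mod (12 * T)" using kv by simp
  qed
qed auto

text \<open>Conversely \<open>d * u \<le> 3 * (n - 1)\<close> yields \<open>k \<le> n\<close>,
  because \<open>3 * k \<le> d * u + 3\<close>. The 36 pays for the six values \<open>d < 6\<close>,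
  whose totients are at most 6.\<close>

lemma class_sum_lower:
  assumes "first_mult \<sigma> (r + 12 * T) u"
  shows "totient_sum (12 * T) r ((3 * (n - 1)) div u) - 36 \<le> class_sum r n"
proof -
  let ?A = "{d. d \<in> {1..(3 * (n - 1)) div u} \<and> d mod (12 * T) = r}"
  have u: "u > 0" using assms by (simp add: first_mult_iff)
  have "totient_sum (12 * T) r ((3 * (n - 1)) div u) \<le> (\<Sum>d\<in>{..<6} \<union> {d \<in> ?A. d \<ge> 6}. real (totient d))"
    unfolding totient_sum_def by (rule sum_mono2) auto
  also have "\<dots> = (\<Sum>d<6. real (totient d)) + (\<Sum>d | d \<in> ?A \<and> d \<ge> 6. real (totient d))"
    by (subst sum.union_disjoint) auto
  also have "(\<Sum>d<6. real (totient d)) \<le> (\<Sum>d<6::nat. 6)"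
    by (intro sum_mono) (auto intro: order_trans[OF totient_le])
  also have "(\<Sum>d | d \<in> ?A \<and> d \<ge> 6. real (totient d)) \<le> class_sum r n"
    unfolding class_sum_def
  proof (rule sum_mono2)
    show "finite {d. d \<in> adm_set \<sigma> n \<and> d mod (12 * T) = r}"
      by (rule finite_subset[OF _ finite_adm_set]) auto
    show "{d. d \<in> ?A \<and> d \<ge> 6} \<subseteq> {d. d \<in> adm_set \<sigma> n \<and> d mod (12 * T) = r}"
    proof clarify
      fix d assume d: "d \<in> {1..3 * (n - 1) div u}" "6 \<le> d" "r = d mod (12 * T)"
      have "ex_adm \<sigma> d u" using ex_adm_mod[of d u] d u assms by (simp add: first_mult_iff)
      then obtain k where k: "adm \<sigma> d u k" by (auto simp: ex_adm_def)
      have "d * u \<le> 3 * (n - 1)" using d u by (simp add: less_eq_div_iff_mult_less_eq)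
      moreover have "d * u > 0" using d u by simp
      ultimately have "k \<le> n" using adm_le_mult[OF k] by linarith
      thus "d \<in> adm_set \<sigma> n \<and> d mod (12 * T) = d mod (12 * T)" using k u d by (auto simp: adm_set_def)
    qed
  qed auto
  finally show ?thesis by simp
qed

lemma class_sum_eq_0:
  assumes "r < 12 * T" "\<And>u. u \<le> 12 * T \<Longrightarrow> \<not> first_mult \<sigma> (r + 12 * T) u"
  shows "class_sum r n = 0"
proof -
  have False if d: "d \<in> adm_set \<sigma> n" "d mod (12 * T) = r" for d
  proof -
    obtain k v where kv: "k \<le> n" "v > 0" "adm \<sigma> d v k" "d \<ge> 6" using d by (auto simp: adm_set_def)
    have "ex_adm \<sigma> (r + 12 * T) v"
      using ex_adm_mod[of d v] kv d by (auto simp: ex_adm_def)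
    then obtain w where "w > 0" "w \<le> 12 * T" "ex_adm \<sigma> (r + 12 * T) w"
      using ex_adm_mult_le[of "r + 12 * T" v] kv period_pos by auto
    thus False using first_mult_exists[of \<sigma> "r + 12 * T" w] assms(2) order_trans by blast
  qed
  hence "{d. d \<in> adm_set \<sigma> n \<and> d mod (12 * T) = r} = {}" by blast
  thus ?thesis by (simp only: class_sum_def sum.empty)
qed

lemma class_sum_tendsto:
  assumes r: "r < 12 * T" and c: "(\<lambda>x. totient_sum (12 * T) r x / (real x)\<^sup>2) \<longlonglongrightarrow> c"
  shows "(\<lambda>n. class_sum r n / (real n)\<^sup>2) \<longlonglongrightarrow>
    (\<Sum>u<Suc (12 * T). of_bool (first_mult \<sigma> (r + 12 * T) u) * (c * (3 / real u)\<^sup>2))"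
proof (cases "\<exists>u\<le>12 * T. first_mult \<sigma> (r + 12 * T) u")
  case False
  hence "class_sum r n = 0" for n using class_sum_eq_0[OF r] by blast
  moreover have "(\<Sum>u<Suc (12 * T). of_bool (first_mult \<sigma> (r + 12 * T) u) * (c * (3 / real u)\<^sup>2)) = 0"
    using False by (intro sum.neutral) auto
  ultimately show ?thesis by simp
next
  case True
  then obtain u where u: "u \<le> 12 * T" "first_mult \<sigma> (r + 12 * T) u" by blast
  have u0: "u > 0" using u by (simp add: first_mult_iff)
  let ?L = "c * (real 3 / real u)\<^sup>2"
  have "(\<Sum>v<Suc (12 * T). of_bool (first_mult \<sigma> (r + 12 * T) v) * (c * (3 / real v)\<^sup>2)) =
    (\<Sum>v<Suc (12 * T). if v = u then ?L else 0)"
    using u first_mult_unique by (intro sum.cong) (auto simp: of_bool_def)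
  also have "\<dots> = ?L" using u(1) by (subst sum.delta) auto
  finally have lim: "(\<Sum>v<Suc (12 * T). of_bool (first_mult \<sigma> (r + 12 * T) v) * (c * (3 / real v)\<^sup>2)) = ?L" .
  have up: "(\<lambda>n. totient_sum (12 * T) r ((3 * n + 3) div u) / (real n)\<^sup>2) \<longlonglongrightarrow> ?L"
    by (rule tendsto_quadratic_div[OF c u0]) simp
  \<comment> \<open>The lower bound is treated along \<open>Suc n\<close>, where the truncated
    \<open>n - 1\<close> becomes \<open>n\<close>.\<close>
  have "(\<lambda>n. totient_sum (12 * T) r ((3 * n + 0) div u) / (real n)\<^sup>2) \<longlonglongrightarrow> ?L"
    by (rule tendsto_quadratic_div[OF c u0]) simp
  moreover have "(\<lambda>n. (real n / real (Suc n))\<^sup>2) \<longlonglongrightarrow> 1" by real_asymp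
  moreover have "(\<lambda>n. 36 / (real (Suc n))\<^sup>2) \<longlonglongrightarrow> 0" by real_asymp
  ultimately have "(\<lambda>n. totient_sum (12 * T) r ((3 * n + 0) div u) / (real n)\<^sup>2 * (real n / real (Suc n))\<^sup>2 - 36 / (real (Suc n))\<^sup>2) \<longlonglongrightarrow> ?L * 1 - 0"
    by (intro tendsto_intros)
  moreover have "\<forall>\<^sub>F n in sequentially. totient_sum (12 * T) r ((3 * n + 0) div u) / (real n)\<^sup>2 * (real n / real (Suc n))\<^sup>2 - 36 / (real (Suc n))\<^sup>2
     = (totient_sum (12 * T) r ((3 * (Suc n - 1)) div u) - 36) / (real (Suc n))\<^sup>2"
    using eventually_gt_at_top[of 0] by eventually_elim (simp add: power_divide diff_divide_distrib)
  ultimately have "(\<lambda>n. (totient_sum (12 * T) r ((3 * (Suc n - 1)) div u) - 36) / (real (Suc n))\<^sup>2) \<longlonglongrightarrow> ?L * 1 - 0"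
    by (rule Lim_transform_eventually)
  hence lo: "(\<lambda>n. (totient_sum (12 * T) r ((3 * (n - 1)) div u) - 36) / (real n)\<^sup>2) \<longlonglongrightarrow> ?L"
    by (subst (asm) filterlim_sequentially_Suc) simp
  show ?thesis unfolding lim
    by (rule tendsto_sandwich[OF _ _ lo up]; intro always_eventually allI divide_right_mono)
      (use class_sum_lower[OF u(2)] class_sum_upper[OF u(2)] in auto)
qed

lemma adm_set_sum_eq: "(\<Sum>d\<in>adm_set \<sigma> n. real (totient d)) = (\<Sum>r<12 * T. class_sum r n)"
  unfolding class_sum_def
  using sum.group[of "adm_set \<sigma> n" "{..<12 * T}" "\<lambda>d. d mod (12 * T)" "\<lambda>d. real (totient d)"]
    finite_adm_set period_pos by (auto simp: image_subset_iff)

end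

section \<open>The value and positivity of the constant\<close>

lemma weight_eq:
  assumes "M > 0"
  shows "real (weight M r) = real M * (real (totient (gcd r M)) / real (gcd r M))"
proof -
  have "real (M div gcd r M) = real M / real (gcd r M)" by (simp add: real_of_nat_div)
  thus ?thesis by (simp add: weight_def)
qed

lemma weight_pos: "M > 0 \<Longrightarrow> weight M r > 0"
  using gcd_le2_nat[of M r] by (simp add: weight_def div_greater_zero_iff)

lemma lcm_denominator_pos: "M > 0 \<Longrightarrow> lcm_denominator M > 0"
  by (auto simp: lcm_denominator_def intro!: sum_pos weight_pos)

lemma totient_sum_tendsto_weight:
  assumes "M > 0" "r < M"
  shows "(\<lambda>x. totient_sum M r x / (real x)\<^sup>2) \<longlonglongrightarrow> 3 / pi\<^sup>2 * (real (weight M r) / real (\<Sum>r<M. weight M r))"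
proof -
  have "real (weight M r) / real (\<Sum>r<M. weight M r) =
     (real (totient (gcd r M)) / real (gcd r M)) / (\<Sum>r<M. real (totient (gcd r M)) / real (gcd r M))"
    unfolding of_nat_sum weight_eq[OF assms(1)] sum_distrib_left[symmetric] using assms(1) by simp
  thus ?thesis using totient_sum_tendsto[OF assms] by simp
qed

text \<open>Numerator and denominator share the factor \<open>F * F * W\<close>, and
  \<open>pi\<^sup>2\<close> cancels the one in the density of the totients; what is left is
  rational.\<close>

lemma lcm_quotient_eq:
  assumes "M > 0"
  shows "real (lcm_numerator \<sigma> M) / real (lcm_denominator M) = pi\<^sup>2 *
    (\<Sum>r<M. \<Sum>u<Suc M. of_bool (first_mult \<sigma> (r + M) u) *
      (3 / pi\<^sup>2 * (real (weight M r) / real (\<Sum>r<M. weight M r)) * (3 / real u)\<^sup>2))"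
proof -
  define W where "W = real (\<Sum>r<M. weight M r)"
  have W: "W > 0" unfolding W_def using weight_pos assms by (auto intro!: sum_pos simp: Suc_le_eq)
  define F where "F = real (fact M)"
  have F: "F > 0" by (simp add: F_def)
  have fd: "real (fact M div u) = F / real u" if "first_mult \<sigma> d u" "u < Suc M" for d u
  proof -
    have "u dvd fact M" using that by (intro dvd_fact) (auto simp: first_mult_iff)
    thus ?thesis by (simp add: real_of_nat_div F_def)
  qed
  let ?g = "\<lambda>r u. of_bool (first_mult \<sigma> (r + M) u) * (3 / pi\<^sup>2 * (real (weight M r) / W) * (3 / real u)\<^sup>2)"
  have summand: "27 * real (of_bool (first_mult \<sigma> (r + M) u) * (weight M r * (fact M div u * (fact M div u)))) =
      F * F * W * (pi\<^sup>2 * ?g r u)" if "u < Suc M" for r u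
  proof (cases "first_mult \<sigma> (r + M) u")
    case True
    have "W * (pi\<^sup>2 * (3 / pi\<^sup>2 * (w / W) * q)) = 3 * w * q" for w q using W by simp
    hence "F * F * W * (pi\<^sup>2 * ?g r u) = F * F * (3 * real (weight M r) * (3 / real u)\<^sup>2)"
      using True by (simp only: mult.assoc of_bool_eq mult_1_left)
    also have "\<dots> = 27 * (real (weight M r) * (F / real u * (F / real u)))"
      by (simp add: power2_eq_square)
    finally show ?thesis using True fd[OF True that] by simp
  qed simp
  have "real (lcm_numerator \<sigma> M) = (\<Sum>r<M. \<Sum>u<Suc M. 27 *
      real (of_bool (first_mult \<sigma> (r + M) u) * (weight M r * (fact M div u * (fact M div u)))))"
    unfolding lcm_numerator_def of_nat_mult[of 27] of_nat_sum sum_distrib_left of_nat_numeral ..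
  also have "\<dots> = (\<Sum>r<M. \<Sum>u<Suc M. F * F * W * (pi\<^sup>2 * ?g r u))"
    by (intro sum.cong refl summand) simp
  also have "\<dots> = F * F * W * (pi\<^sup>2 * (\<Sum>r<M. \<Sum>u<Suc M. ?g r u))"
    by (simp only: sum_distrib_left)
  finally have num: "real (lcm_numerator \<sigma> M) = F * F * W * (pi\<^sup>2 * (\<Sum>r<M. \<Sum>u<Suc M. ?g r u))" .
  have "real (lcm_denominator M) = F * F * W"
    by (simp add: lcm_denominator_def F_def W_def)
  moreover have "F * F * W * x / (F * F * W) = x" for x using W F by simp
  ultimately show ?thesis unfolding num W_def[symmetric] by (simp only:)
qed

lemma ln_lcm_tendsto:
  assumes s: "sign_sequence s" and T: "has_period s T"
  shows "(\<lambda>n. ln (real_of_int (shifted_lucas_lcm s n)) / (real n)\<^sup>2) \<longlonglongrightarrow>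
    real (lcm_numerator (\<lambda>k. s k = 1) (12 * T)) / real (lcm_denominator (12 * T)) * (ln golden_ratio / pi\<^sup>2)"
proof -
  interpret periodic_signs "\<lambda>k. s k = 1" T
    by unfold_locales (use T in \<open>auto simp: has_period_def\<close>)
  have M: "12 * T > 0" using period_pos by simp
  let ?c = "\<lambda>r. 3 / pi\<^sup>2 * (real (weight (12 * T) r) / real (\<Sum>r<12 * T. weight (12 * T) r))"
  let ?G = "\<Sum>r<12 * T. \<Sum>u<Suc (12 * T). of_bool (first_mult (\<lambda>k. s k = 1) (r + 12 * T) u) * (?c r * (3 / real u)\<^sup>2)"
  have "(\<lambda>n. \<Sum>r<12 * T. class_sum r n / (real n)\<^sup>2) \<longlonglongrightarrow> ?G"
    by (intro tendsto_sum class_sum_tendsto totient_sum_tendsto_weight M) auto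
  hence "(\<lambda>n. (\<Sum>d\<in>adm_set (\<lambda>k. s k = 1) n. real (totient d)) / (real n)\<^sup>2) \<longlonglongrightarrow> ?G"
    by (simp only: adm_set_sum_eq sum_divide_distrib)
  hence "(\<lambda>n. ln golden_ratio * ((\<Sum>d\<in>adm_set (\<lambda>k. s k = 1) n. real (totient d)) / (real n)\<^sup>2)) \<longlonglongrightarrow> ln golden_ratio * ?G"
    by (intro tendsto_mult tendsto_const)
  from tendsto_add[OF ln_lcm_asymptotics[OF s] this]
  have "(\<lambda>n. ln (real_of_int (shifted_lucas_lcm s n)) / (real n)\<^sup>2) \<longlonglongrightarrow> ln golden_ratio * ?G"
    by (simp add: diff_divide_distrib)
  moreover have "real (lcm_numerator (\<lambda>k. s k = 1) (12 * T)) / real (lcm_denominator (12 * T)) * (ln golden_ratio / pi\<^sup>2) = ln golden_ratio * ?G"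
    unfolding lcm_quotient_eq[OF M] by simp
  ultimately show ?thesis by (simp only:)
qed

text \<open>The class \<open>r = 0\<close> contributes a positive summand, as its least multiplier
  is at most 6 and hence within the search range.\<close>

lemma lcm_numerator_pos:
  assumes T: "has_period s T"
  shows "lcm_numerator (\<lambda>k. s k = 1) (12 * T) > 0"
proof -
  interpret periodic_signs "\<lambda>k. s k = 1" T
    by unfold_locales (use T in \<open>auto simp: has_period_def\<close>)
  let ?u = "if s 1 = 1 then 3 else 6 :: nat"
  have "\<exists>v\<le>?u. first_mult (\<lambda>k. s k = 1) (12 * T) v"
    by (rule first_mult_exists[OF ex_adm_zero_class]) simp
  then obtain u where u: "u \<le> ?u" "first_mult (\<lambda>k. s k = 1) (12 * T) u" by blast
  have M: "12 * T > 0" "12 \<le> 12 * T" using period_pos by auto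
  have uM: "u \<le> 12 * T" "u > 0" using u M(2) by (simp_all add: first_mult_iff split: if_splits)
  let ?f = "\<lambda>r u. of_bool (first_mult (\<lambda>k. s k = 1) (r + 12 * T) u) * (weight (12 * T) r * (fact (12 * T) div u * (fact (12 * T) div u)))"
  have "u \<le> fact (12 * T)" using uM fact_ge_self[of "12 * T"] by linarith
  hence "fact (12 * T) div u > 0" using uM by (simp only: div_greater_zero_iff)
  hence "0 < weight (12 * T) 0 * (fact (12 * T) div u * (fact (12 * T) div u))"
    using weight_pos[OF M(1)] by (intro mult_pos_pos)
  also have "\<dots> = ?f 0 u" using u(2) by (simp only: add_0 of_bool_eq mult_1_left)
  also have "\<dots> \<le> (\<Sum>u<Suc (12 * T). ?f 0 u)" 
    by (rule member_le_sum[of u "{..<Suc (12 * T)}" "?f 0"])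
      (use uM in \<open>simp_all only: lessThan_iff finite_lessThan zero_le less_Suc_eq_le\<close>)
  also have "\<dots> \<le> (\<Sum>r<12 * T. \<Sum>u<Suc (12 * T). ?f r u)"
    by (rule member_le_sum[of 0 "{..<12 * T}" "\<lambda>r. \<Sum>u<Suc (12 * T). ?f r u"]) (use M in \<open>simp_all only: lessThan_iff finite_lessThan zero_le\<close>)
  finally have "0 < (\<Sum>r<12 * T. \<Sum>u<Suc (12 * T). ?f r u)" .
  thus ?thesis unfolding lcm_numerator_def by (rule mult_pos_pos[rotated]) simp
qed

lemma asymp_equiv_quadratic:
  assumes "(\<lambda>n. f n / (real n)\<^sup>2) \<longlonglongrightarrow> (c :: real)" "c \<noteq> 0"
  shows "f \<sim>[sequentially] (\<lambda>n. c * (real n)\<^sup>2)"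
proof (rule asymp_equivI')
  have "(\<lambda>n. f n / (real n)\<^sup>2 / c) \<longlonglongrightarrow> c / c" by (intro tendsto_divide assms tendsto_const)
  thus "(\<lambda>n. f n / (c * (real n)\<^sup>2)) \<longlonglongrightarrow> 1" using assms(2) by (simp add: mult.commute)
qed

theorem theorem1p3:
  "\<exists>B :: (nat \<Rightarrow> int) \<Rightarrow> rat.
     effectively_computable B \<and>
     (\<forall>s. sign_sequence s \<and> periodic s \<longrightarrow>
        B s > 0 \<and>
        (\<lambda>n. ln (real_of_int (shifted_lucas_lcm s n)))
          \<sim>[sequentially] (\<lambda>n. real_of_rat (B s) * (ln golden_ratio / pi\<^sup>2) * (real n)\<^sup>2))"
proof -
  define Q :: "(nat \<Rightarrow> int) \<Rightarrow> nat \<Rightarrow> rat" where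
    "Q = (\<lambda>s T. of_nat (lcm_numerator (\<lambda>k. s k = 1) (12 * T)) / of_nat (lcm_denominator (12 * T)))"
  \<comment> \<open>Any period may be chosen: \<open>Q_unique\<close> shows that all give the same
    value, because each value is determined by the same limit.\<close>
  define B where "B = (\<lambda>s. Q s (SOME T. has_period s T))"
  have Q_lim: "(\<lambda>n. ln (real_of_int (shifted_lucas_lcm s n)) / (real n)\<^sup>2) \<longlonglongrightarrow>
      real_of_rat (Q s T) * (ln golden_ratio / pi\<^sup>2)" if "sign_sequence s" "has_period s T" for s T
    using ln_lcm_tendsto[OF that] by (simp add: Q_def of_rat_divide)
  have c_nz: "ln golden_ratio / pi\<^sup>2 \<noteq> 0" using ln_golden_ratio by simp
  have Q_unique: "Q s T = Q s T'" if "sign_sequence s" "has_period s T" "has_period s T'" for s T T'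
    using LIMSEQ_unique[OF Q_lim[OF that(1,2)] Q_lim[OF that(1,3)]] c_nz by simp
  have Q_pos: "Q s T > 0" if "has_period s T" for s T
    using lcm_numerator_pos[OF that] lcm_denominator_pos[of "12 * T"] that by (auto simp: Q_def has_period_def)
  have B_eq: "B s = Q s T" if "sign_sequence s" "has_period s T" for s T
    unfolding B_def by (rule Q_unique[OF that(1) someI[of "has_period s"] that(2)]) (rule that(2))
  have "effectively_computable B"
    by (rule effectively_computableI) (use B_eq lcm_denominator_pos in \<open>auto simp: Q_def\<close>)
  moreover have "B s > 0 \<and> (\<lambda>n. ln (real_of_int (shifted_lucas_lcm s n)))
      \<sim>[sequentially] (\<lambda>n. real_of_rat (B s) * (ln golden_ratio / pi\<^sup>2) * (real n)\<^sup>2)"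
    if s: "sign_sequence s" "periodic s" for s
  proof -
    obtain T where T: "has_period s T" using s(2) unfolding periodic_def by blast
    have pos: "B s > 0" using B_eq[OF s(1) T] Q_pos[OF T] by simp
    moreover have "real_of_rat (B s) * (ln golden_ratio / pi\<^sup>2) \<noteq> 0" using pos c_nz by simp
    ultimately show ?thesis
      using asymp_equiv_quadratic[OF Q_lim[OF s(1) T]] B_eq[OF s(1) T] by simp
  qed
  ultimately show ?thesis by (intro exI[of _ B]) simp
qed

end
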